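(* Let $A$ be an associative unital algebra over a commutative field $\mathbb{K}$ with product $\mu$, let $\sigma\in\mathrm{Aut}(A\otimes A)$ be a linear automorphism satisfying (2) $\sigma_1(\mu\otimes\mathrm{Id})=(\mathrm{Id}\otimes\mu)\sigma_1\sigma_2$ and $\sigma_1(\mathrm{Id}\otimes\mu)=(\mu\otimes\mathrm{Id})\sigma_2\sigma_1$ on $A^{\otimes 3}$; (3) $\sigma(a\otimes 1_A)=1_A\otimes a$ and $\sigma(1_A\otimes a)=a\otimes 1_A$ for all $a\in A$; (4) $\mu\circ\sigma=\mu$; and let $M$ be an $A$-bimodule. Then $\mathrm{Id}_M\otimes\varphi_\sigma : M\otimes T(A)\otimes T(A)\to M\otimes T(A)$ is a morphism of complexes from the chain complex $(M\otimes T(A)\otimes T(A),\rho)$ to the Hochschild chain complex of $A$ with coefficients in $M$.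
   Context: $T(A)=\bigoplus_{k\ge0}A^{\otimes k}$. For $i<n$, $\sigma_i=\mathrm{Id}^{\otimes i-1}\otimes\sigma\otimes\mathrm{Id}^{\otimes n-i-1}$ on $A^{\otimes n}$; juxtaposition is composition. Quantum shuffle product (with sign): for $p+q=n$, $S_{p,n}$ is the set of permutations $w$ of $\{1,\dots,n\}$ with $w(1)<\dots<w(p)$ and $w(p+1)<\dots<w(n)$. For $w\in S_{p,n}$ with reduced decomposition $w=\nu_{i_1}\cdots\nu_{i_r}$, $\nu_i=(i,i+1)$, put $T_\sigma(w)=\sigma_{i_1}\cdots\sigma_{i_r}$ (for shuffles two reduced decompositions differ only by commutations $\nu_i\nu_j=\nu_j\nu_i$, $|i-j|\ge2$, so this is well defined). Then $\varphi_\sigma(\underline a\otimes\underline b)=\sum_{w\in S_{p,n}}(-1)^{|w|}T_\sigma(w)(\underline a\otimes\underline b)$ for $\underline a\in A^{\otimes p}$, $\underline b\in A^{\otimes q}$, where $(-1)^{|w|}$ is the sign; when $p=0$ or $q=0$ it is scalar multiplication. Hochschild chain complex: degree $n$ part $M\otimes A^{\otimes n}$, differential $\alpha\otimes a^1\otimes\cdots\otimes a^n\mapsto \alpha a^1\otimes a^2\otimes\cdots\otimes a^n+\sum_{i=1}^{n-1}(-1)^i\alpha\otimes a^1\otimes\cdots\otimes a^ia^{i+1}\otimes\cdots\otimes a^n+(-1)^n a^n\alpha\otimes a^1\otimes\cdots\otimes a^{n-1}$. The complex $(M\otimes T(A)\otimes T(A),\rho)$: degree $n$ part $\bigoplus_{p+q=n}M\otimes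 A^{\otimes p}\otimes A^{\otimes q}$, with $\rho_n=\sum_{p+q=n}\rho_{p,q}$, where for $\underline a=a^1\otimes\cdots\otimes a^p$, $\underline b=b^1\otimes\cdots\otimes b^q$, writing $\sigma_q\cdots\sigma_1(a^p\otimes\underline b)=\sum_k\underline b_k\otimes a^p_k$ (with $\underline b_k\in A^{\otimes q}$) and $\sigma_1\cdots\sigma_p(\underline a\otimes b^1)=\sum_l b^1_l\otimes\underline a_l$ (with $\underline a_l\in A^{\otimes p}$), $$\begin{aligned}\rho_{p,q}(\alpha\otimes\underline a\otimes\underline b)=\;&\alpha a^1\otimes a^2\otimes\cdots\otimes a^p\otimes\underline b+\sum_{i=1}^{p-1}(-1)^i\alpha\otimes a^1\otimes\cdots\otimes a^ia^{i+1}\otimes\cdots\otimes a^p\otimes\underline b\\&+(-1)^p\sum_k a^p_k\alpha\otimes a^1\otimes\cdots\otimes a^{p-1}\otimes\underline b_k+(-1)^p\sum_l\alpha b^1_l\otimes\underline a_l\otimes b^2\otimes\cdots\otimes b^q\\&+\sum_{i=1}^{q-1}(-1)^{i+p}\alpha\otimes\underline a\otimes b^1\otimes\cdots\otimes b^ib^{i+1}\otimes\cdots\otimes b^q+(-1)^{p+q}b^q\alpha\otimes\underline a\otimes b^1\otimes\cdots\otimes b^{q-1},\end{aligned}$$ the first three (resp. last three) terms being absent if $p=0$ (resp. $q=0$). *)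

theory Defs
  imports Complex_Main "HOL-Library.Poly_Mapping" "HOL-Combinatorics.Permutations"
begin

section \<open>Tensor products as quotients of free vector spaces\<close>

text \<open>
  Tensor powers are built in the textbook way, as the free vector space on tuples modulo
  multilinearity.  An element of the free vector space on a type of generators is a finitely
  supported function; an element of a tensor product is a coset.  The tuples of
  \<open>T(A)\<close> are lists of arbitrary length, so that all tensor powers of \<open>A\<close> are obtained at
  once, graded by the length; those of \<open>M \<otimes> T(A)\<close>, \<open>T(A) \<otimes> T(A)\<close> and
  \<open>M \<otimes> T(A) \<otimes> T(A)\<close> are pairs and triples.
\<close>

type_synonym ('x, 'k) free = "'x \<Rightarrow>\<^sub>0 'k"

abbreviation gen :: "'x \<Rightarrow> ('x, 'k::field) free" where
  "gen x \<equiv> Poly_Mapping.single x 1"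

definition fscale :: "'k::field \<Rightarrow> ('x, 'k) free \<Rightarrow> ('x, 'k) free" where
  "fscale c p = Poly_Mapping.map ((*) c) p"

lemma lookup_fscale [simp]: "Poly_Mapping.lookup (fscale c p) x = c * Poly_Mapping.lookup p x"
  unfolding fscale_def by transfer (simp add: when_def)

lemma vector_space_fscale: "vector_space (fscale :: 'k::field \<Rightarrow> ('x, 'k) free \<Rightarrow> _)"
  by unfold_locales (auto intro!: poly_mapping_eqI simp: lookup_add algebra_simps)

definition extend :: "('x \<Rightarrow> ('y, 'k::field) free) \<Rightarrow> ('x, 'k) free \<Rightarrow> ('y, 'k) free" where
  "extend h p = (\<Sum>x\<in>Poly_Mapping.keys p. fscale (Poly_Mapping.lookup p x) (h x))"

text \<open>In what follows \<open>R\<close> is a set of relations; the quotient is by its linear span.\<close>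

definition coset :: "('x, 'k::field) free set \<Rightarrow> ('x, 'k) free \<Rightarrow> ('x, 'k) free set" where
  "coset R p = {q. q - p \<in> module.span fscale R}"

definition pure :: "('x, 'k::field) free set \<Rightarrow> 'x \<Rightarrow> ('x, 'k) free set" where
  "pure R x = coset R (gen x)"

definition rep :: "('x, 'k::field) free set \<Rightarrow> ('x, 'k) free" where
  "rep X = (SOME p. p \<in> X)"

definition qadd :: "('x, 'k::field) free set \<Rightarrow> ('x, 'k) free set \<Rightarrow> ('x, 'k) free set
    \<Rightarrow> ('x, 'k) free set" where
  "qadd R X Y = coset R (rep X + rep Y)"

definition qscale :: "('x, 'k::field) free set \<Rightarrow> 'k \<Rightarrow> ('x, 'k) free set \<Rightarrow> ('x, 'k) free set" where
  "qscale R c X = coset R (fscale c (rep X))"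

definition quot :: "('x, 'k::field) free set \<Rightarrow> ('x, 'k) free set set" where
  "quot R = range (coset R)"

text \<open>The homogeneous part of degree \<open>n\<close>, for a degree function on the generators.\<close>

definition part :: "('x, 'k::field) free set \<Rightarrow> ('x \<Rightarrow> nat) \<Rightarrow> nat \<Rightarrow> ('x, 'k) free set set" where
  "part R deg n = coset R ` {p. \<forall>x\<in>Poly_Mapping.keys p. deg x = n}"

definition linear_from_to :: "('x, 'k::field) free set \<Rightarrow> ('x, 'k) free set set
    \<Rightarrow> ('y, 'k) free set \<Rightarrow> ('y, 'k) free set set
    \<Rightarrow> (('x, 'k) free set \<Rightarrow> ('y, 'k) free set) \<Rightarrow> bool" where
  "linear_from_to R V S W f \<longleftrightarrow> f ` V \<subseteq> W \<and>
     (\<forall>X\<in>V. \<forall>Y\<in>V. f (qadd R X Y) = qadd S (f X) (f Y)) \<and>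
     (\<forall>c. \<forall>X\<in>V. f (qscale R c X) = qscale S c (f X))"

text \<open>
  The linear map on the quotient given on generators by \<open>h\<close>.  It does not depend on the choice of
  representatives (\<open>rep\<close>) if the linear extension of \<open>h\<close> maps relations to the span of the
  relations \<open>S\<close>; below this holds whenever \<open>\<sigma>\<close> is linear on the tensor square.
\<close>

definition induced :: "('y, 'k::field) free set \<Rightarrow> ('x \<Rightarrow> ('y, 'k) free)
    \<Rightarrow> ('x, 'k) free set \<Rightarrow> ('y, 'k) free set" where
  "induced S h X = coset S (extend h (rep X))"

text \<open>Linearity in one argument of the tuple, where \<open>s v\<close> is the tuple with \<open>v\<close> at that place.\<close>

definition slot_rel :: "('k::field \<Rightarrow> 'v \<Rightarrow> 'v) \<Rightarrow> ('v::ab_group_add \<Rightarrow> 'x) \<Rightarrow> ('x, 'k) free set" where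
  "slot_rel sc s = {gen (s (u + v)) - gen (s u) - gen (s v) | u v. True}
     \<union> {gen (s (sc c v)) - fscale c (gen (s v)) | c v. True}"

definition T_rel :: "('k::field \<Rightarrow> 'a \<Rightarrow> 'a) \<Rightarrow> ('a::ab_group_add list, 'k) free set" where
  "T_rel sA = (\<Union>us vs. slot_rel sA (\<lambda>a. us @ a # vs))"

definition TT_rel :: "('k::field \<Rightarrow> 'a \<Rightarrow> 'a)
    \<Rightarrow> ('a::ab_group_add list \<times> 'a list, 'k) free set" where
  "TT_rel sA = (\<Union>us vs ys. slot_rel sA (\<lambda>a. (us @ a # vs, ys)))
     \<union> (\<Union>xs us vs. slot_rel sA (\<lambda>b. (xs, us @ b # vs)))"

definition MT_rel :: "('k::field \<Rightarrow> 'm \<Rightarrow> 'm) \<Rightarrow> ('k \<Rightarrow> 'a \<Rightarrow> 'a)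
    \<Rightarrow> ('m::ab_group_add \<times> 'a::ab_group_add list, 'k) free set" where
  "MT_rel sM sA = (\<Union>xs. slot_rel sM (\<lambda>m. (m, xs)))
     \<union> (\<Union>m us vs. slot_rel sA (\<lambda>a. (m, us @ a # vs)))"

definition MTT_rel :: "('k::field \<Rightarrow> 'm \<Rightarrow> 'm) \<Rightarrow> ('k \<Rightarrow> 'a \<Rightarrow> 'a)
    \<Rightarrow> ('m::ab_group_add \<times> 'a::ab_group_add list \<times> 'a list, 'k) free set" where
  "MTT_rel sM sA = (\<Union>xs ys. slot_rel sM (\<lambda>m. (m, xs, ys)))
     \<union> (\<Union>m us vs ys. slot_rel sA (\<lambda>a. (m, us @ a # vs, ys)))
     \<union> (\<Union>m xs us vs. slot_rel sA (\<lambda>b. (m, xs, us @ b # vs)))"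

abbreviation tensor_power :: "('k::field \<Rightarrow> 'a::ab_group_add \<Rightarrow> 'a) \<Rightarrow> nat
    \<Rightarrow> ('a list, 'k) free set set" where
  "tensor_power sA n \<equiv> part (T_rel sA) length n"


section \<open>Algebras and bimodules\<close>

text \<open>
  The class intersection below is that of associative rings with unit, the zero ring included
  (which the class \<open>ring_1\<close> excludes).
\<close>

locale unital_algebra = vector_space sA
  for sA :: "'k::field \<Rightarrow> 'a::{ring,monoid_mult} \<Rightarrow> 'a" +
  assumes scale_mult_left: "sA c (a * b) = sA c a * b"
    and scale_mult_right: "sA c (a * b) = a * sA c b"

locale algebra_bimodule = A: unital_algebra sA + M: vector_space sM
  for sA :: "'k::field \<Rightarrow> 'a::{ring,monoid_mult} \<Rightarrow> 'a"
    and sM :: "'k \<Rightarrow> 'm::ab_group_add \<Rightarrow> 'm" +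
  fixes l :: "'a \<Rightarrow> 'm \<Rightarrow> 'm" and r :: "'m \<Rightarrow> 'a \<Rightarrow> 'm"
  assumes l_add_left: "l (a + b) m = l a m + l b m"
    and l_add_right: "l a (m + m') = l a m + l a m'"
    and l_scale_left: "l (sA c a) m = sM c (l a m)"
    and l_scale_right: "l a (sM c m) = sM c (l a m)"
    and l_mult: "l (a * b) m = l a (l b m)"
    and l_one: "l 1 m = m"
    and r_add_left: "r (m + m') a = r m a + r m' a"
    and r_add_right: "r m (a + b) = r m a + r m b"
    and r_scale_left: "r (sM c m) a = sM c (r m a)"
    and r_scale_right: "r m (sA c a) = sM c (r m a)"
    and r_mult: "r m (a * b) = r (r m a) b"
    and r_one: "r m 1 = m"
    and l_r_assoc: "r (l a m) b = l a (r m b)"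


section \<open>Operators on tensor powers\<close>

text \<open>
  \<open>Id \<otimes> \<dots> \<otimes> Id \<otimes> f \<otimes> Id \<otimes> \<dots> \<otimes> Id\<close>, where \<open>f\<close> is defined on the \<open>k\<close>-th tensor power and acts on
  the factors \<open>i, \<dots>, i + k - 1\<close> (counted from 1).  It is set to zero on the tensor powers with too
  few factors.
\<close>

definition act_at :: "('k::field \<Rightarrow> 'a::ab_group_add \<Rightarrow> 'a) \<Rightarrow> nat
    \<Rightarrow> (('a list, 'k) free set \<Rightarrow> ('a list, 'k) free set) \<Rightarrow> nat
    \<Rightarrow> ('a list, 'k) free set \<Rightarrow> ('a list, 'k) free set" where
  "act_at sA k f i = induced (T_rel sA) (\<lambda>xs.
     if i - 1 + k \<le> length xs
     then extend (\<lambda>zs. gen (take (i - 1) xs @ zs @ drop (i - 1 + k) xs))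
            (rep (f (pure (T_rel sA) (take k (drop (i - 1) xs)))))
     else 0)"

text \<open>\<open>sigma_at sA \<sigma> i\<close> is the operator \<open>\<sigma>\<close> with index \<open>i\<close> on any tensor power.\<close>

definition sigma_at :: "('k::field \<Rightarrow> 'a::ab_group_add \<Rightarrow> 'a)
    \<Rightarrow> (('a list, 'k) free set \<Rightarrow> ('a list, 'k) free set) \<Rightarrow> nat
    \<Rightarrow> ('a list, 'k) free set \<Rightarrow> ('a list, 'k) free set" where
  "sigma_at sA \<sigma> i = act_at sA 2 \<sigma> i"

text \<open>\<open>sigma_word sA \<sigma> [i\<^sub>1, \<dots>, i\<^sub>r]\<close> applies the operator with index \<open>i\<^sub>r\<close> first.\<close>

definition sigma_word :: "('k::field \<Rightarrow> 'a::ab_group_add \<Rightarrow> 'a)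
    \<Rightarrow> (('a list, 'k) free set \<Rightarrow> ('a list, 'k) free set) \<Rightarrow> nat list
    \<Rightarrow> ('a list, 'k) free set \<Rightarrow> ('a list, 'k) free set" where
  "sigma_word sA \<sigma> is X = foldr (sigma_at sA \<sigma>) is X"

definition mu :: "('k::field \<Rightarrow> 'a::{ring,monoid_mult} \<Rightarrow> 'a)
    \<Rightarrow> ('a list, 'k) free set \<Rightarrow> ('a list, 'k) free set" where
  "mu sA = induced (T_rel sA) (\<lambda>xs. case xs of [a, b] \<Rightarrow> gen [a * b] | _ \<Rightarrow> 0)"


section \<open>The quantum shuffle product\<close>

definition shuffle_perms :: "nat \<Rightarrow> nat \<Rightarrow> (nat \<Rightarrow> nat) set" where
  "shuffle_perms p n =
     {w. w permutes {1..n} \<and> strict_mono_on {1..p} w \<and> strict_mono_on {p+1..n} w}"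

definition word_perm :: "nat list \<Rightarrow> nat \<Rightarrow> nat" where
  "word_perm is = foldr (\<lambda>i g. Transposition.transpose i (i + 1) \<circ> g) is id"

definition reduced_words :: "nat \<Rightarrow> (nat \<Rightarrow> nat) \<Rightarrow> nat list set" where
  "reduced_words n w = {is. set is \<subseteq> {1..<n} \<and> word_perm is = w \<and>
     (\<forall>js. set js \<subseteq> {1..<n} \<and> word_perm js = w \<longrightarrow> length is \<le> length js)}"

text \<open>For a shuffle \<open>w\<close> any two reduced words give the same operator.\<close>

definition T_sigma :: "('k::field \<Rightarrow> 'a::ab_group_add \<Rightarrow> 'a)
    \<Rightarrow> (('a list, 'k) free set \<Rightarrow> ('a list, 'k) free set) \<Rightarrow> nat \<Rightarrow> (nat \<Rightarrow> nat)
    \<Rightarrow> ('a list, 'k) free set \<Rightarrow> ('a list, 'k) free set" where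
  "T_sigma sA \<sigma> n w = sigma_word sA \<sigma> (SOME is. is \<in> reduced_words n w)"

definition quantum_shuffle :: "('k::field \<Rightarrow> 'a::ab_group_add \<Rightarrow> 'a)
    \<Rightarrow> (('a list, 'k) free set \<Rightarrow> ('a list, 'k) free set)
    \<Rightarrow> ('a list \<times> 'a list, 'k) free set \<Rightarrow> ('a list, 'k) free set" where
  "quantum_shuffle sA \<sigma> = induced (T_rel sA) (\<lambda>(xs, ys).
     let n = length xs + length ys in
     \<Sum>w\<in>shuffle_perms (length xs) n.
       fscale (of_int (sign w)) (rep (T_sigma sA \<sigma> n w (pure (T_rel sA) (xs @ ys)))))"

text \<open>The map \<open>Id\<^sub>M \<otimes> \<phi>\<close> for a linear map \<open>\<phi>\<close> from \<open>T(A) \<otimes> T(A)\<close> to \<open>T(A)\<close>.\<close>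

definition id_M_tensor :: "('k::field \<Rightarrow> 'm::ab_group_add \<Rightarrow> 'm) \<Rightarrow> ('k \<Rightarrow> 'a::ab_group_add \<Rightarrow> 'a)
    \<Rightarrow> (('a list \<times> 'a list, 'k) free set \<Rightarrow> ('a list, 'k) free set)
    \<Rightarrow> ('m \<times> 'a list \<times> 'a list, 'k) free set \<Rightarrow> ('m \<times> 'a list, 'k) free set" where
  "id_M_tensor sM sA \<phi> = induced (MT_rel sM sA) (\<lambda>(m, xs, ys).
     extend (\<lambda>zs. gen (m, zs)) (rep (\<phi> (pure (TT_rel sA) (xs, ys)))))"


section \<open>The two complexes\<close>

text \<open>
  A complex is given by its total space, the quotient by \<open>R\<close> graded by \<open>deg\<close>, and its total
  differential.
\<close>

definition chain_complex :: "('x, 'k::field) free set \<Rightarrow> ('x \<Rightarrow> nat)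
    \<Rightarrow> (('x, 'k) free set \<Rightarrow> ('x, 'k) free set) \<Rightarrow> bool" where
  "chain_complex R deg d \<longleftrightarrow> linear_from_to R (quot R) R (quot R) d \<and>
     d ` part R deg 0 \<subseteq> {coset R 0} \<and>
     (\<forall>n. d ` part R deg (Suc n) \<subseteq> part R deg n) \<and>
     (\<forall>X\<in>quot R. d (d X) = coset R 0)"

definition chain_morphism :: "('x, 'k::field) free set \<Rightarrow> ('x \<Rightarrow> nat)
    \<Rightarrow> (('x, 'k) free set \<Rightarrow> ('x, 'k) free set)
    \<Rightarrow> ('y, 'k) free set \<Rightarrow> ('y \<Rightarrow> nat)
    \<Rightarrow> (('y, 'k) free set \<Rightarrow> ('y, 'k) free set)
    \<Rightarrow> (('x, 'k) free set \<Rightarrow> ('y, 'k) free set) \<Rightarrow> bool" where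
  "chain_morphism R deg d S deg' d' f \<longleftrightarrow>
     chain_complex R deg d \<and> chain_complex S deg' d' \<and>
     linear_from_to R (quot R) S (quot S) f \<and>
     (\<forall>n. f ` part R deg n \<subseteq> part S deg' n) \<and>
     (\<forall>X\<in>quot R. f (d X) = d' (f X))"

text \<open>\<open>merge i\<close> multiplies the entries \<open>i\<close> and \<open>i + 1\<close> (counted from 1).\<close>

definition merge :: "nat \<Rightarrow> 'a::times list \<Rightarrow> 'a list" where
  "merge i xs = take (i - 1) xs @ (xs ! (i - 1) * xs ! i) # drop (i + 1) xs"

definition hochschild_d :: "('k::field \<Rightarrow> 'a::{ring,monoid_mult} \<Rightarrow> 'a)
    \<Rightarrow> ('k \<Rightarrow> 'm::ab_group_add \<Rightarrow> 'm) \<Rightarrow> ('a \<Rightarrow> 'm \<Rightarrow> 'm) \<Rightarrow> ('m \<Rightarrow> 'a \<Rightarrow> 'm)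
    \<Rightarrow> ('m \<times> 'a list, 'k) free set \<Rightarrow> ('m \<times> 'a list, 'k) free set" where
  "hochschild_d sA sM l r = induced (MT_rel sM sA) (\<lambda>(m, xs). let n = length xs in
     if n = 0 then 0 else
       gen (r m (hd xs), tl xs)
       + (\<Sum>i=1..n-1. fscale ((-1) ^ i) (gen (m, merge i xs)))
       + fscale ((-1) ^ n) (gen (l (last xs) m, butlast xs)))"

text \<open>
  In the third term the tuples \<open>zs\<close> run over an expression of
  \<open>\<sigma>\<^sub>q \<dots> \<sigma>\<^sub>1 (a\<^sup>p \<otimes> b)\<close> as a combination of pure tensors, whose last factor acts on \<open>m\<close>; in the
  fourth term over an expression of \<open>\<sigma>\<^sub>1 \<dots> \<sigma>\<^sub>p (a \<otimes> b\<^sup>1)\<close>, whose first factor acts on \<open>m\<close>.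
\<close>

definition rho :: "('k::field \<Rightarrow> 'a::{ring,monoid_mult} \<Rightarrow> 'a)
    \<Rightarrow> ('k \<Rightarrow> 'm::ab_group_add \<Rightarrow> 'm) \<Rightarrow> ('a \<Rightarrow> 'm \<Rightarrow> 'm) \<Rightarrow> ('m \<Rightarrow> 'a \<Rightarrow> 'm)
    \<Rightarrow> (('a list, 'k) free set \<Rightarrow> ('a list, 'k) free set)
    \<Rightarrow> ('m \<times> 'a list \<times> 'a list, 'k) free set \<Rightarrow> ('m \<times> 'a list \<times> 'a list, 'k) free set" where
  "rho sA sM l r \<sigma> = induced (MTT_rel sM sA) (\<lambda>(m, xs, ys).
     let p = length xs; q = length ys in
     (if p = 0 then 0 else
        gen (r m (hd xs), tl xs, ys)
        + (\<Sum>i=1..p-1. fscale ((-1) ^ i) (gen (m, merge i xs, ys)))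
        + fscale ((-1) ^ p) (extend (\<lambda>zs. gen (l (last zs) m, butlast xs, butlast zs))
            (rep (sigma_word sA \<sigma> (rev [1..<q+1]) (pure (T_rel sA) (last xs # ys))))))
     + (if q = 0 then 0 else
        fscale ((-1) ^ p) (extend (\<lambda>zs. gen (r m (hd zs), tl zs, tl ys))
            (rep (sigma_word sA \<sigma> [1..<p+1] (pure (T_rel sA) (xs @ [hd ys])))))
        + (\<Sum>i=1..q-1. fscale ((-1) ^ (i + p)) (gen (m, xs, merge i ys)))
        + fscale ((-1) ^ (p + q)) (gen (l (last ys) m, xs, butlast ys))))"

end

(*
  An identity in a quotient of a free vector space can be tested on the linear functionals that kill the
  relations, which here are the multilinear functions of tuples.  Every operator is therefore replaced by
  its transpose acting on multilinear functions, and congruences become equations between scalars.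

  The differential rho is A + (-1)^p B, where A and B are Hochschild differentials with coefficients in
  the bimodules M (x) A^q and M (x) A^p; sigma carries an element acting from the far side across the
  other tensor factor.  A and B commute because the two words moving a^p and b^1 past each other differ
  by commutations only.

  A shuffle begins either with a^1 or with b^1 moved across a, and ends either with b^q or with a^p moved
  across b.  These two recursions account for the first and the last face of the Hochschild differential.
  The interior faces follow by induction from the first recursion: products of two entries of a, or of
  two entries of b, come from (2), and the products a b and b a cancel by mu sigma = mu.
*)

theory Submission
  imports Defs
begin

section \<open>Testing against functionals\<close>

text \<open>Every map is built with the arbitrary choice \<open>rep\<close>, so almost no equation
  holds between representatives themselves. Evaluation at a function killing the relations does not
  see the choice. The braiding is known only on cosets; \<open>pairs_of\<close> fixes, for each pair
  of elements, one expression of \<sigma>(a \<otimes> b) as a sum of pure tensors. The commutation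
  laws and both shuffle recursions are then identities of finite sums, valid against arbitrary
  functions, while (2) and (4) are available only against bilinear and linear ones. This is why the
  computation is accompanied by lemmas on multilinearity.

  There is no braid relation among the assumptions, so words in the \<sigma>_i may be changed by
  commutations only. The operator of a reduced word is tied to the shuffle by counting: its length
  is the number of inversions, so each letter must create a new inversion. The shuffle sum is built
  from its first output onwards; its last recursion needs an induction, whose one delicate case is
  the same exchange that makes A and B commute.\<close>

interpretation free: vector_space "fscale :: 'k::field \<Rightarrow> ('x, 'k) free \<Rightarrow> ('x, 'k) free"
  by (rule vector_space_fscale)

section \<open>Evaluating functions of generators on finite combinations\<close>

definition ev :: "('x \<Rightarrow> 'k::field) \<Rightarrow> ('x, 'k) free \<Rightarrow> 'k" where
  "ev F p = (\<Sum>x\<in>Poly_Mapping.keys p. Poly_Mapping.lookup p x * F x)"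

lemma ev_superset:
  assumes "finite A" "Poly_Mapping.keys p \<subseteq> A"
  shows "ev F p = (\<Sum>x\<in>A. Poly_Mapping.lookup p x * F x)"
  unfolding ev_def using assms by (intro sum.mono_neutral_left) (auto simp: in_keys_iff)

lemma ev_gen [simp]: "ev F (gen x) = F x"
  by (simp add: ev_def)

lemma ev_zero [simp]: "ev F 0 = 0"
  by (simp add: ev_def)

lemma ev_add [simp]: "ev F (p + q) = ev F p + ev F q"
proof -
  let ?A = "Poly_Mapping.keys p \<union> Poly_Mapping.keys q"
  have "Poly_Mapping.keys (p + q) \<subseteq> ?A" by (rule keys_add)
  then show ?thesis
    by (simp add: ev_superset[of ?A] lookup_add sum.distrib algebra_simps)
qed

lemma ev_fscale [simp]: "ev F (fscale c p) = c * ev F p"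
proof -
  have "Poly_Mapping.keys (fscale c p) \<subseteq> Poly_Mapping.keys p"
    by (auto simp: in_keys_iff)
  then show ?thesis
    by (simp add: ev_superset[of "Poly_Mapping.keys p"] sum_distrib_left mult.assoc)
qed

lemma ev_diff [simp]: "ev F (p - q) = ev F p - ev F q"
  using ev_add[of F "p - q" q] by simp

lemma ev_sum [simp]: "ev F (\<Sum>i\<in>A. f i) = (\<Sum>i\<in>A. ev F (f i))"
  by (induction A rule: infinite_finite_induct) auto

text \<open>So the transpose of \<open>extend h\<close> sends \<open>F\<close> to
  \<open>\<lambda>x. ev F (h x)\<close>. A composite of linear maps becomes a nest of evaluations in
  which the outermost one belongs to the map that acts first.\<close>

lemma ev_extend [simp]: "ev F (extend h p) = ev (\<lambda>x. ev F (h x)) p"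
  unfolding extend_def by (simp add: ev_def[of _ p])

lemma ev_fun_add: "ev (\<lambda>x. F x + G x) p = ev F p + ev G p"
  by (simp add: ev_def algebra_simps sum.distrib)

lemma ev_fun_minus: "ev (\<lambda>x. - F x) p = - ev F p"
  by (simp add: ev_def sum_negf)

lemma ev_fun_diff: "ev (\<lambda>x. F x - G x) p = ev F p - ev G p"
  by (simp add: ev_def algebra_simps sum_subtractf)

lemma ev_fun_mult: "ev (\<lambda>x. c * F x) p = c * ev F p"
  by (simp add: ev_def sum_distrib_left mult_ac)

lemma ev_fun_zero [simp]: "ev (\<lambda>x. 0) p = 0"
  by (simp add: ev_def)

lemma ev_fun_sum: "ev (\<lambda>x. \<Sum>i\<in>A. F i x) p = (\<Sum>i\<in>A. ev (F i) p)"
  unfolding ev_def by (simp add: sum_distrib_left sum.swap[of _ A])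

lemma ev_cong: "(\<And>x. x \<in> Poly_Mapping.keys p \<Longrightarrow> F x = G x) \<Longrightarrow> ev F p = ev G p"
  by (simp add: ev_def)

text \<open>Two finite sums over independent ranges commute. All commutation laws between crossings
  reduce to this.\<close>

lemma ev_swap: "ev (\<lambda>x. ev (\<lambda>y. F x y) q) p = ev (\<lambda>y. ev (\<lambda>x. F x y) p) q"
  unfolding ev_def by (simp add: sum_distrib_left sum.swap[of _ "Poly_Mapping.keys q"] mult_ac)

lemma keys_extend:
  assumes "y \<in> Poly_Mapping.keys (extend h p)"
  obtains x where "x \<in> Poly_Mapping.keys p" "y \<in> Poly_Mapping.keys (h x)"
proof -
  have "\<exists>x\<in>Poly_Mapping.keys p. y \<in> Poly_Mapping.keys (h x)"
  proof (rule ccontr)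
    assume "\<not> ?thesis"
    then have "Poly_Mapping.lookup (extend h p) y = 0"
      by (auto simp: extend_def lookup_sum in_keys_iff intro!: sum.neutral)
    with assms show False by (simp add: in_keys_iff)
  qed
  with that show thesis by blast
qed

section \<open>Functions killing the relations separate cosets\<close>

definition annihilates :: "('x, 'k::field) free set \<Rightarrow> ('x \<Rightarrow> 'k) \<Rightarrow> bool" where
  "annihilates R F \<longleftrightarrow> (\<forall>r\<in>R. ev F r = 0)"

lemma annihilates_span:
  assumes "annihilates R F" "p \<in> module.span fscale R"
  shows "ev F p = 0"
  using assms(2)
proof (induction rule: free.span_induct)
  case base
  show ?case by (auto simp: free.subspace_def)
next
  case (step x)
  then show ?case using assms(1) by (simp add: annihilates_def)
qed

lemma gen_expansion: "p = (\<Sum>x\<in>Poly_Mapping.keys p. fscale (Poly_Mapping.lookup p x) (gen x))"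
  by (rule poly_mapping_eqI)
    (auto simp: lookup_sum lookup_single when_def in_keys_iff if_distrib[of "(*) _"] cong: if_cong)

text \<open>A maximal independent subset of \<open>R\<close> stays independent when \<open>p\<close>
  is added. A linear functional that is 1 at \<open>p\<close> and 0 on that subset vanishes on all
  of \<open>R\<close>.\<close>

lemma separating_functional:
  fixes p :: "('b, 'a::field) free"
  assumes "p \<notin> module.span fscale R"
  obtains F where "annihilates R F" "ev F p \<noteq> 0"
proof -
  interpret pr: vector_space_pair "fscale :: 'a \<Rightarrow> ('b, 'a) free \<Rightarrow> _" "(*) :: 'a \<Rightarrow> 'a \<Rightarrow> 'a"
    by unfold_locales (auto simp: algebra_simps)
  obtain B where B: "B \<subseteq> R" "free.independent B" "R \<subseteq> free.span B"
    using free.maximal_independent_subset[of R] by blast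
  have "free.span B \<subseteq> free.span R" by (rule free.span_mono) (rule B(1))
  then have pB: "p \<notin> free.span B" using assms by blast
  then have "free.independent (insert p B)"
    using B(2) by (rule free.independent_insertI)
  then obtain g where g: "Vector_Spaces.linear fscale (*) g" "\<And>x. x \<in> insert p B \<Longrightarrow> g x = (if x = p then 1 else 0)"
    using pr.linear_independent_extend[of "insert p B" "\<lambda>x. if x = p then 1 else 0"] by blast
  \<comment> \<open>A linear functional is determined by its values on generators, so it has the
    form \<open>ev F\<close>.\<close>
  have gev: "ev (\<lambda>x. g (gen x)) q = g q" for q
  proof -
    have "g q = g (\<Sum>x\<in>Poly_Mapping.keys q. fscale (Poly_Mapping.lookup q x) (gen x))"
      using gen_expansion[of q] by simp
    also have "\<dots> = (\<Sum>x\<in>Poly_Mapping.keys q. Poly_Mapping.lookup q x * g (gen x))"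
      by (simp add: pr.linear_sum[OF g(1)] pr.linear_scale[OF g(1)])
    finally show ?thesis by (simp add: ev_def)
  qed
  have "p \<notin> B" using pB free.span_base by blast
  then have "g x = 0" if "x \<in> B" for x using g(2)[of x] that by auto
  then have "g r = 0" if "r \<in> R" for r
    using pr.linear_eq_0_on_span[OF g(1)] B(3) that by blast
  then show thesis
    using that[of "\<lambda>x. g (gen x)"] gev g(2)[of p] by (auto simp: annihilates_def)
qed

lemma coset_eq_span: "coset R p = coset R q \<longleftrightarrow> p - q \<in> module.span fscale R"
proof
  assume "coset R p = coset R q"
  moreover have "p \<in> coset R p" by (simp add: coset_def free.span_zero)
  ultimately show "p - q \<in> free.span R" by (simp add: coset_def)
next
  assume *: "p - q \<in> free.span R"
  have "x - p \<in> free.span R \<longleftrightarrow> x - q \<in> free.span R" for x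
    using free.span_add[OF _ *, of "x - p"] free.span_diff[OF _ *, of "x - q"] by auto
  then show "coset R p = coset R q" by (auto simp: coset_def)
qed

lemma coset_eq_iff: "coset R p = coset R q \<longleftrightarrow> (\<forall>F. annihilates R F \<longrightarrow> ev F p = ev F q)"
proof
  assume "coset R p = coset R q"
  then have "p - q \<in> free.span R" by (simp add: coset_eq_span)
  then show "\<forall>F. annihilates R F \<longrightarrow> ev F p = ev F q"
    using annihilates_span by fastforce
next
  assume *: "\<forall>F. annihilates R F \<longrightarrow> ev F p = ev F q"
  show "coset R p = coset R q"
  proof (rule ccontr)
    assume "coset R p \<noteq> coset R q"
    then have "p - q \<notin> free.span R" by (simp add: coset_eq_span)
    then obtain F where "annihilates R F" "ev F (p - q) \<noteq> 0" by (rule separating_functional)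
    with * show False by simp
  qed
qed

lemma coset_rep: "X \<in> quot R \<Longrightarrow> coset R (rep X) = X"
proof -
  assume "X \<in> quot R"
  then obtain p where X: "X = coset R p" by (auto simp: quot_def)
  have "p \<in> X" by (simp add: X coset_def free.span_zero)
  then have "rep X \<in> X" unfolding rep_def by (rule someI)
  then have "rep X - p \<in> free.span R" by (simp add: X coset_def)
  then show ?thesis by (simp add: X coset_eq_span)
qed

lemma coset_in_quot [simp]: "coset R p \<in> quot R"
  by (simp add: quot_def)

text \<open>This removes every occurrence of \<open>rep\<close>: two representatives differ by an
  element of the span of the relations.\<close>

lemma ev_rep_coset [simp]: "annihilates R F \<Longrightarrow> ev F (rep (coset R p)) = ev F p"
  using coset_rep[of "coset R p" R] coset_eq_iff[of R "rep (coset R p)" p] by simp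

lemma ev_rep_pure [simp]: "annihilates R F \<Longrightarrow> ev F (rep (pure R x)) = F x"
  by (simp add: pure_def)

lemma pure_in_quot [simp]: "pure R x \<in> quot R"
  by (simp add: pure_def)

lemma quot_eqI:
  assumes "X \<in> quot R" "Y \<in> quot R" "\<And>F. annihilates R F \<Longrightarrow> ev F (rep X) = ev F (rep Y)"
  shows "X = Y"
  using assms coset_rep[of X] coset_rep[of Y] coset_eq_iff[of R "rep X" "rep Y"] by simp

lemma pure_in_part [simp]: "pure R x \<in> part R deg (deg x)"
  by (auto simp: part_def pure_def)

section \<open>Induced maps, complexes and morphisms, checked on generators\<close>

lemma induced_in_quot [simp]: "induced S h X \<in> quot S"
  by (simp add: induced_def)

lemma ev_rep_induced [simp]:
  "annihilates S F \<Longrightarrow> ev F (rep (induced S h X)) = ev (\<lambda>x. ev F (h x)) (rep X)"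
  by (simp add: induced_def)

text \<open>By separation this is equivalent to \<open>extend h\<close> sending \<open>R\<close>
  into the span of \<open>S\<close>, that is, to \<open>induced S h\<close> being independent of
  representatives. The dual form is the one that the transposed operators verify directly.\<close>

definition compatible :: "('x, 'k::field) free set \<Rightarrow> ('y, 'k) free set \<Rightarrow> ('x \<Rightarrow> ('y, 'k) free) \<Rightarrow> bool"
  where "compatible R S h \<longleftrightarrow> (\<forall>F. annihilates S F \<longrightarrow> annihilates R (\<lambda>x. ev F (h x)))"

lemma compatible_linear:
  assumes "compatible R S h"
  shows "linear_from_to R (quot R) S (quot S) (induced S h)"
proof -
  have *: "annihilates R (\<lambda>x. ev F (h x))" if "annihilates S F" for F
    using assms that by (auto simp: compatible_def)
  show ?thesis
    unfolding linear_from_to_def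
  proof (intro conjI ballI allI)
    fix X Y
    show "induced S h (qadd R X Y) = qadd S (induced S h X) (induced S h Y)"
      by (rule quot_eqI[of _ S]) (simp_all add: qadd_def *)
  next
    fix c X
    show "induced S h (qscale R c X) = qscale S c (induced S h X)"
      by (rule quot_eqI[of _ S]) (simp_all add: qscale_def *)
  qed auto
qed

text \<open>Dual form of homogeneity: the span of the relations contains the homogeneous components
  of its elements.\<close>

definition graded :: "('x, 'k::field) free set \<Rightarrow> ('x \<Rightarrow> nat) \<Rightarrow> bool" where
  "graded R deg \<longleftrightarrow> (\<forall>F n. annihilates R F \<longrightarrow> annihilates R (\<lambda>x. if deg x = n then F x else 0))"

text \<open>A representative of the image is projected to degree \<open>k\<close>. The projection
  stays in the same coset, because an annihilator and its truncation to degree \<open>k\<close>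
  differ by an annihilator that vanishes in degree \<open>k\<close>.\<close>

lemma induced_part:
  assumes "compatible R S h" "graded S deg'"
    and zero: "\<And>F x. annihilates S F \<Longrightarrow> deg x = n \<Longrightarrow> (\<And>y. deg' y = k \<Longrightarrow> F y = 0) \<Longrightarrow> ev F (h x) = 0"
  shows "induced S h ` part R deg n \<subseteq> part S deg' k"
proof
  fix Y assume "Y \<in> induced S h ` part R deg n"
  then obtain p where p: "\<forall>x\<in>Poly_Mapping.keys p. deg x = n" and Y: "Y = induced S h (coset R p)"
    by (auto simp: part_def)
  define q where "q = extend (\<lambda>y. if deg' y = k then gen y else 0) (extend h p)"
  have "deg' y = k" if "y \<in> Poly_Mapping.keys q" for y
    using that unfolding q_def by (elim keys_extend) (auto split: if_splits)
  moreover have "Y = coset S q"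
  proof (rule quot_eqI[of _ S])
    fix F assume F: "annihilates S F"
    define F0 where "F0 y = (if deg' y = k then F y else 0)" for y
    have F0: "annihilates S F0" using F assms(2) unfolding graded_def F0_def by blast
    have "annihilates S (\<lambda>y. F y - F0 y)" using F F0 by (simp add: annihilates_def ev_fun_diff)
    then have "ev F (h x) = ev F0 (h x)" if "deg x = n" for x
      using zero[of "\<lambda>y. F y - F0 y" x] that by (simp add: F0_def[abs_def] ev_fun_diff)
    then have "ev (\<lambda>x. ev F (h x)) p = ev (\<lambda>x. ev F0 (h x)) p"
      using p ev_cong[of p "\<lambda>x. ev F (h x)" "\<lambda>x. ev F0 (h x)"] by blast
    moreover have "ev F (if deg' y = k then gen y else 0) = F0 y" for y by (simp add: F0_def)
    moreover have "annihilates R (\<lambda>x. ev F (h x))" using F assms(1) by (auto simp: compatible_def)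
    ultimately show "ev F (rep Y) = ev F (rep (coset S q))"
      using F by (simp add: Y q_def)
  qed (auto simp: Y)
  ultimately show "Y \<in> part S deg' k" by (auto simp: part_def)
qed

text \<open>The degree and square conditions concern single generators. Compatibility handles the
  second application of the differential, which reads the first result through an arbitrary
  representative.\<close>

lemma chain_complex_induced:
  assumes comp: "compatible R R h" and gr: "graded R deg"
    and deg0: "\<And>F x. annihilates R F \<Longrightarrow> deg x = 0 \<Longrightarrow> ev F (h x) = 0"
    and degS: "\<And>F x. annihilates R F \<Longrightarrow> (\<And>y. Suc (deg y) = deg x \<Longrightarrow> F y = 0) \<Longrightarrow> ev F (h x) = 0"
    and sq: "\<And>F x. annihilates R F \<Longrightarrow> ev (\<lambda>y. ev F (h y)) (h x) = 0"
  shows "chain_complex R deg (induced R h)"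
  unfolding chain_complex_def
proof (intro conjI allI ballI)
  show "linear_from_to R (quot R) R (quot R) (induced R h)"
    using comp by (rule compatible_linear)
  have *: "annihilates R (\<lambda>x. ev F (h x))" if "annihilates R F" for F
    using comp that by (auto simp: compatible_def)
  show "induced R h ` part R deg 0 \<subseteq> {coset R 0}"
  proof
    fix Y assume "Y \<in> induced R h ` part R deg 0"
    then obtain p where p: "\<forall>x\<in>Poly_Mapping.keys p. deg x = 0" and Y: "Y = induced R h (coset R p)"
      by (auto simp: part_def)
    have "Y = coset R 0"
    proof (rule quot_eqI[of _ R])
      fix F assume F: "annihilates R F"
      have "ev (\<lambda>x. ev F (h x)) p = ev (\<lambda>x. 0) p"
        using p deg0[OF F] by (intro ev_cong) auto
      then show "ev F (rep Y) = ev F (rep (coset R 0))" using F * by (simp add: Y)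
    qed (auto simp: Y)
    then show "Y \<in> {coset R 0}" by simp
  qed
  show "induced R h ` part R deg (Suc n) \<subseteq> part R deg n" for n
    by (rule induced_part[OF comp gr]) (auto intro: degS)
  show "induced R h (induced R h X) = coset R 0" if "X \<in> quot R" for X
    by (rule quot_eqI[of _ R]) (auto simp: * sq)
qed

lemma chain_morphism_induced:
  assumes "chain_complex R deg (induced R h)" "chain_complex S deg' (induced S h')"
    and comp: "compatible R R h" "compatible S S h'" "compatible R S f" and gr: "graded S deg'"
    and degf: "\<And>F x. annihilates S F \<Longrightarrow> (\<And>y. deg' y = deg x \<Longrightarrow> F y = 0) \<Longrightarrow> ev F (f x) = 0"
    and comm: "\<And>F x. annihilates S F \<Longrightarrow> ev (\<lambda>y. ev F (f y)) (h x) = ev (\<lambda>y. ev F (h' y)) (f x)"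
  shows "chain_morphism R deg (induced R h) S deg' (induced S h') (induced S f)"
  unfolding chain_morphism_def
proof (intro conjI allI ballI assms(1,2))
  show "linear_from_to R (quot R) S (quot S) (induced S f)"
    using comp(3) by (rule compatible_linear)
  show "induced S f ` part R deg n \<subseteq> part S deg' n" for n
    by (rule induced_part[OF comp(3) gr]) (auto intro: degf)
  have f: "annihilates R (\<lambda>x. ev F (f x))" if "annihilates S F" for F
    using comp that by (auto simp: compatible_def)
  have h': "annihilates S (\<lambda>x. ev F (h' x))" if "annihilates S F" for F
    using comp that by (auto simp: compatible_def)
  show "induced S f (induced R h X) = induced S h' (induced S f X)" for X
    by (rule quot_eqI[of _ S]) (auto simp: f h' comm)
qed

section \<open>Multilinear functions as the annihilators of the tensor relations\<close>

definition lin :: "('k::field \<Rightarrow> 'v \<Rightarrow> 'v) \<Rightarrow> ('v::ab_group_add \<Rightarrow> 'k) \<Rightarrow> bool" where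
  "lin sc g \<longleftrightarrow> (\<forall>u v. g (u + v) = g u + g v) \<and> (\<forall>c v. g (sc c v) = c * g v)"

lemma annihilates_slot_rel: "annihilates (slot_rel sc s) F \<longleftrightarrow> lin sc (\<lambda>v. F (s v))"
proof -
  have "annihilates (slot_rel sc s) F \<longleftrightarrow>
      (\<forall>u v. ev F (gen (s (u + v)) - gen (s u) - gen (s v)) = 0)
      \<and> (\<forall>c v. ev F (gen (s (sc c v)) - fscale c (gen (s v))) = 0)"
    unfolding annihilates_def slot_rel_def by blast
  then show ?thesis by (auto simp: lin_def algebra_simps)
qed

lemma annihilates_Un: "annihilates (A \<union> B) F \<longleftrightarrow> annihilates A F \<and> annihilates B F"
  by (auto simp: annihilates_def)

lemma annihilates_UN: "annihilates (\<Union>i\<in>I. R i) F \<longleftrightarrow> (\<forall>i\<in>I. annihilates (R i) F)"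
  by (auto simp: annihilates_def)

text \<open>No length is fixed: such a function is a family of unrelated multilinear forms, one for
  each length.\<close>

definition multilin :: "('k::field \<Rightarrow> 'a \<Rightarrow> 'a) \<Rightarrow> ('a::ab_group_add list \<Rightarrow> 'k) \<Rightarrow> bool" where
  "multilin sA F \<longleftrightarrow> (\<forall>us vs. lin sA (\<lambda>a. F (us @ a # vs)))"

lemma annihilates_T_rel: "annihilates (T_rel sA) F \<longleftrightarrow> multilin sA F"
  by (simp add: T_rel_def annihilates_UN annihilates_slot_rel multilin_def)

lemma annihilates_TT_rel: "annihilates (TT_rel sA) F \<longleftrightarrow>
    (\<forall>ys. multilin sA (\<lambda>xs. F (xs, ys))) \<and> (\<forall>xs. multilin sA (\<lambda>ys. F (xs, ys)))"
  by (auto simp add: TT_rel_def annihilates_Un annihilates_UN annihilates_slot_rel multilin_def)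

lemma annihilates_MT_rel: "annihilates (MT_rel sM sA) F \<longleftrightarrow>
    (\<forall>xs. lin sM (\<lambda>m. F (m, xs))) \<and> (\<forall>m. multilin sA (\<lambda>xs. F (m, xs)))"
  by (auto simp add: MT_rel_def annihilates_Un annihilates_UN annihilates_slot_rel multilin_def)

lemma annihilates_MTT_rel: "annihilates (MTT_rel sM sA) F \<longleftrightarrow>
    (\<forall>xs ys. lin sM (\<lambda>m. F (m, xs, ys))) \<and> (\<forall>m ys. multilin sA (\<lambda>xs. F (m, xs, ys)))
    \<and> (\<forall>m xs. multilin sA (\<lambda>ys. F (m, xs, ys)))"
  by (auto simp add: MTT_rel_def annihilates_Un annihilates_UN annihilates_slot_rel multilin_def)

lemma lin_zero [simp]: "lin sc (\<lambda>v. 0)"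
  by (simp add: lin_def)

lemma lin_add: "lin sc f \<Longrightarrow> lin sc g \<Longrightarrow> lin sc (\<lambda>v. f v + g v)"
  by (simp add: lin_def algebra_simps)

lemma lin_diff: "lin sc f \<Longrightarrow> lin sc g \<Longrightarrow> lin sc (\<lambda>v. f v - g v)"
  by (simp add: lin_def algebra_simps)

lemma lin_minus: "lin sc f \<Longrightarrow> lin sc (\<lambda>v. - f v)"
  by (simp add: lin_def algebra_simps)

lemma lin_mult: "lin sc f \<Longrightarrow> lin sc (\<lambda>v. c * f v)"
  by (simp add: lin_def algebra_simps)

lemma lin_sum: "(\<And>i. i \<in> A \<Longrightarrow> lin sc (f i)) \<Longrightarrow> lin sc (\<lambda>v. \<Sum>i\<in>A. f i v)"
  by (induction A rule: infinite_finite_induct) (auto intro: lin_add)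

lemma lin_ev: "(\<And>x. x \<in> Poly_Mapping.keys p \<Longrightarrow> lin sc (\<lambda>v. f v x)) \<Longrightarrow> lin sc (\<lambda>v. ev (f v) p)"
  unfolding ev_def by (intro lin_sum lin_mult) auto

lemma lin_if: "(b \<Longrightarrow> lin sc f) \<Longrightarrow> (\<not> b \<Longrightarrow> lin sc g) \<Longrightarrow> lin sc (\<lambda>v. if b then f v else g v)"
  by (cases b) simp_all

lemmas lin_intros = lin_if lin_zero lin_add lin_diff lin_minus lin_mult lin_ev

lemma graded_MT_rel: "graded (MT_rel sM sA) (\<lambda>(m, xs). length xs)"
  by (auto simp: graded_def annihilates_MT_rel multilin_def intro!: lin_if)

lemma graded_MTT_rel: "graded (MTT_rel sM sA) (\<lambda>(m, xs, ys). length xs + length ys)"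
  by (auto simp: graded_def annihilates_MTT_rel multilin_def intro!: lin_if)

section \<open>Moving an element across a tuple\<close>

text \<open>The transpose of the interior Hochschild faces; \<open>bar_merge\<close> recovers the
  alternating sum. The recursion on the first entry is chosen to match the first recursion of the
  shuffle sum.\<close>

fun bar :: "('a::times list \<Rightarrow> 'k::field) \<Rightarrow> 'a list \<Rightarrow> 'k" where
  "bar F [] = 0"
| "bar F [x] = 0"
| "bar F (x # y # zs) = - F (x * y # zs) - bar (\<lambda>w. F (x # w)) (y # zs)"

lemma bar_cong:
  "(\<And>w. Suc (length w) = length xs \<Longrightarrow> F w = G w) \<Longrightarrow> bar F xs = bar G xs"
proof (induction F xs arbitrary: G rule: bar.induct)
  case (3 F x y zs)
  have "bar (\<lambda>w. F (x # w)) (y # zs) = bar (\<lambda>w. G (x # w)) (y # zs)"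
    by (rule 3(1)) (simp add: 3(2))
  then show ?case using 3(2) by simp
qed auto

lemma bar_ev: "bar (\<lambda>w. ev (K w) p) xs = ev (\<lambda>z. bar (\<lambda>w. K w z) xs) p"
  by (induction "\<lambda>w. ev (K w) p" xs arbitrary: K rule: bar.induct)
    (simp_all add: ev_fun_diff ev_fun_minus)

lemma bar_zero [simp]: "bar (\<lambda>w. 0) xs = 0"
  by (induction xs rule: induct_list012) simp_all

lemma bar_add: "bar (\<lambda>w. F w + G w) xs = bar F xs + bar G xs"
  by (induction "\<lambda>w. F w + G w" xs arbitrary: F G rule: bar.induct) simp_all

lemma bar_minus: "bar (\<lambda>w. - F w) xs = - bar F xs"
  by (induction F xs rule: bar.induct) simp_all

lemma bar_diff: "bar (\<lambda>w. F w - G w) xs = bar F xs - bar G xs"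
  using bar_add[of F "\<lambda>w. - G w" xs] by (simp add: bar_minus)

lemma bar_mult: "bar (\<lambda>w. c * F w) xs = c * bar F xs"
  by (induction F xs rule: bar.induct) (simp_all add: algebra_simps)

lemma bar_swap: "bar (\<lambda>w. bar (\<lambda>v. F w v) ys) xs = bar (\<lambda>v. bar (\<lambda>w. F w v) xs) ys"
  by (induction "\<lambda>w. bar (\<lambda>v. F w v) ys" xs arbitrary: F rule: bar.induct)
    (simp_all add: bar_diff bar_minus)

text \<open>Splits off the last interior face, which must be compared with the last outer face in
  \<open>coeff_dual_coeff_dual\<close>.\<close>

lemma bar_snoc:
  "bar F (ws @ [x, y]) = bar (\<lambda>w. F (w @ [y])) (ws @ [x]) + (-1) ^ Suc (length ws) * F (ws @ [x * y])"
proof (induction ws arbitrary: F)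
  case (Cons w ws)
  then show ?case by (cases ws) (simp_all add: algebra_simps)
qed simp

text \<open>The double bar behind \<open>x\<close> vanishes by induction. What remains are the two
  ways of merging \<open>x\<close> with its successors, and these agree by associativity.\<close>

lemma bar_bar: "bar (bar F) (xs :: 'a::semigroup_mult list) = 0"
proof (induction F xs rule: bar.induct)
  case (3 F x y zs)
  show ?case
  proof (cases zs)
    case (Cons z zs')
    have "bar (\<lambda>w. bar F (x # w)) (y # zs)
        = bar (\<lambda>w. - F (x * hd w # tl w) - bar (\<lambda>w. F (x # w)) w) (y # zs)"
    proof (rule bar_cong)
      fix w :: "'a list" assume "Suc (length w) = length (y # zs)"
      then show "bar F (x # w) = - F (x * hd w # tl w) - bar (\<lambda>w. F (x # w)) w"
        using Cons by (cases w) auto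
    qed
    also have "\<dots> = - bar (\<lambda>w. F (x * hd w # tl w)) (y # zs)"
      using 3 by (simp add: bar_diff bar_minus)
    finally have eq: "bar (\<lambda>w. bar F (x # w)) (y # zs) = - bar (\<lambda>w. F (x * hd w # tl w)) (y # zs)" .
    show ?thesis
      unfolding bar.simps(3)[of "bar F"] eq using Cons by (simp add: mult.assoc)
  qed simp
qed auto

lemma bar_merge:
  fixes F :: "'a::times list \<Rightarrow> 'k::field"
  shows "bar F xs = (\<Sum>i=1..length xs - 1. (-1) ^ i * F (merge i xs))"
proof (induction F xs rule: bar.induct)
  case (3 F x y zs)
  have shift: "(\<Sum>i=1..Suc n. f i) = f 1 + (\<Sum>i=1..n. f (Suc i))" for f :: "nat \<Rightarrow> 'k" and n
    by (induction n) (simp_all add: add.assoc)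
  have "(\<Sum>i=1..Suc (length zs). (-1) ^ i * F (merge i (x # y # zs)))
      = - F (x * y # zs) + (\<Sum>i=1..length zs. (-1) ^ Suc i * F (merge (Suc i) (x # y # zs)))"
    unfolding shift by (simp add: merge_def)
  also have "(\<Sum>i=1..length zs. (-1) ^ Suc i * F (merge (Suc i) (x # y # zs)))
      = (\<Sum>i=1..length zs. - ((-1) ^ i * F (x # merge i (y # zs))))"
  proof (rule sum.cong)
    fix i assume "i \<in> {1..length zs}"
    then obtain j where "i = Suc j" by (cases i) auto
    then show "(-1) ^ Suc i * F (merge (Suc i) (x # y # zs)) = - ((-1) ^ i * F (x # merge i (y # zs)))"
      by (simp add: merge_def)
  qed simp
  finally show ?case using 3 by (simp add: sum_negf)
qed auto

lemma multilin_lin: "multilin sA F \<Longrightarrow> lin sA (\<lambda>a. F (us @ a # vs))"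
  by (simp add: multilin_def)

lemma multilin_lin_Cons: "multilin sA F \<Longrightarrow> lin sA (\<lambda>a. F (a # vs))"
  using multilin_lin[of sA F "[]"] by simp

lemma multilin_Cons: "multilin sA F \<Longrightarrow> multilin sA (\<lambda>w. F (x # w))"
  using multilin_lin[of sA F "x # _"] by (simp add: multilin_def)

lemma lin_bar: "(\<And>w. lin sc (\<lambda>a. F a w)) \<Longrightarrow> lin sc (\<lambda>a. bar (F a) xs)"
proof -
  assume "\<And>w. lin sc (\<lambda>a. F a w)"
  then have "F (u + v) = (\<lambda>w. F u w + F v w)" "F (sc c v) = (\<lambda>w. c * F v w)" for u v c
    by (auto simp: lin_def)
  then show ?thesis by (simp add: lin_def bar_add bar_mult)
qed

text \<open>\<open>s a b\<close> stands for an expression of \<sigma>(a \<otimes> b) as a sum of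
  pure tensors. No law is imposed on it here, so the commutations and shuffle recursions proved in
  this locale are bare identities of finite sums.\<close>

locale braiding = unital_algebra sA
  for sA :: "'k::field \<Rightarrow> 'a::{ring,monoid_mult} \<Rightarrow> 'a" +
  fixes s :: "'a \<Rightarrow> 'a \<Rightarrow> ('a \<times> 'a, 'k) free"
begin

definition bilin :: "('a \<Rightarrow> 'a \<Rightarrow> 'k) \<Rightarrow> bool" where
  "bilin G \<longleftrightarrow> (\<forall>b. lin sA (\<lambda>a. G a b)) \<and> (\<forall>a. lin sA (G a))"

text \<open>The transpose of \<sigma>. In nested occurrences the outermost \<open>S\<close> is the
  operator that acts first on the tensor.\<close>

definition S :: "('a \<Rightarrow> 'a \<Rightarrow> 'k) \<Rightarrow> 'a \<Rightarrow> 'a \<Rightarrow> 'k" where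
  "S G a b = ev (\<lambda>t. G (fst t) (snd t)) (s a b)"

lemma lin_mult_left: "lin sA f \<Longrightarrow> lin sA (\<lambda>x. f (x * y))"
  by (simp add: lin_def scale_mult_left[symmetric] algebra_simps)

lemma lin_mult_right: "lin sA f \<Longrightarrow> lin sA (\<lambda>x. f (y * x))"
  by (simp add: lin_def scale_mult_right[symmetric] algebra_simps)

lemma multilin_bar: 
  assumes "multilin sA F"
  shows "multilin sA (bar F)"
proof -
  have "lin sA (\<lambda>a. bar F (us @ a # vs))" for us vs
    using assms
  proof (induction us arbitrary: F)
    case Nil
    then show ?case
      by (cases vs)
        (auto intro!: lin_intros lin_bar lin_mult_left[of "\<lambda>x. F (x # _)"] dest: multilin_lin_Cons)
  next
    case (Cons u us)
    have IH: "lin sA (\<lambda>a. bar (\<lambda>w. F (u # w)) (us @ a # vs))"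
      by (rule Cons.IH) (rule multilin_Cons[OF Cons.prems])
    show ?case
    proof (cases us)
      case Nil
      then show ?thesis using IH multilin_lin_Cons[OF Cons.prems]
        by (auto intro!: lin_intros lin_mult_right[of "\<lambda>x. F (x # _)"])
    next
      case (Cons u' us')
      then show ?thesis using IH multilin_lin[OF Cons.prems, of "u * u' # us'" vs]
        by (auto intro!: lin_intros)
    qed
  qed
  then show ?thesis by (simp add: multilin_def)
qed

text \<open>\<open>left_sum xs c\<close> represents \<open>\<sigma>\<^sub>1 \<dots> \<sigma>\<^sub>p (xs \<otimes> c)\<close> and \<open>right_sum ys a\<close> represents
  \<open>\<sigma>\<^sub>q \<dots> \<sigma>\<^sub>1 (a \<otimes> ys)\<close>, with the moved factor split off.\<close>

primrec left_sum :: "'a list \<Rightarrow> 'a \<Rightarrow> ('a \<times> 'a list, 'k) free" where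
  "left_sum [] c = gen (c, [])"
| "left_sum (x # xs) c =
    extend (\<lambda>z. extend (\<lambda>t. gen (fst t, snd t # snd z)) (s x (fst z))) (left_sum xs c)"

primrec right_sum :: "'a list \<Rightarrow> 'a \<Rightarrow> ('a list \<times> 'a, 'k) free" where
  "right_sum [] a = gen ([], a)"
| "right_sum (y # ys) a =
    extend (\<lambda>t. extend (\<lambda>z. gen (fst t # fst z, snd z)) (right_sum ys (snd t))) (s a y)"

definition L :: "'a list \<Rightarrow> 'a \<Rightarrow> ('a \<Rightarrow> 'a list \<Rightarrow> 'k) \<Rightarrow> 'k" where
  "L xs c K = ev (\<lambda>z. K (fst z) (snd z)) (left_sum xs c)"

definition R :: "'a \<Rightarrow> 'a list \<Rightarrow> ('a list \<Rightarrow> 'a \<Rightarrow> 'k) \<Rightarrow> 'k" where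
  "R a ys K = ev (\<lambda>z. K (fst z) (snd z)) (right_sum ys a)"

lemma L_Nil [simp]: "L [] c K = K c []"
  by (simp add: L_def)

lemma L_Cons: "L (x # xs) c K = L xs c (\<lambda>c' w. S (\<lambda>u v. K u (v # w)) x c')"
  by (simp add: L_def S_def)

lemma R_Nil [simp]: "R a [] K = K [] a"
  by (simp add: R_def)

lemma R_Cons: "R a (y # ys) K = S (\<lambda>u v. R v ys (\<lambda>w a'. K (u # w) a')) a y"
  by (simp add: R_def S_def)

lemmas op_defs = S_def L_def R_def

lemma S_L: "S (\<lambda>u v. L xs c (\<lambda>c' w. F u v c' w)) a b = L xs c (\<lambda>c' w. S (\<lambda>u v. F u v c' w) a b)"
  unfolding op_defs by (rule ev_swap)

lemma S_R: "S (\<lambda>u v. R c xs (\<lambda>w c'. F u v c' w)) a b = R c xs (\<lambda>w c'. S (\<lambda>u v. F u v c' w) a b)"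
  unfolding op_defs by (rule ev_swap)

lemma L_R: "L xs c (\<lambda>c' w. R a ys (\<lambda>w' a'. F c' w w' a')) = R a ys (\<lambda>w' a'. L xs c (\<lambda>c' w. F c' w w' a'))"
  unfolding op_defs by (rule ev_swap)

lemma bar_S: "bar (\<lambda>w. S (\<lambda>u v. F w u v) a b) xs = S (\<lambda>u v. bar (\<lambda>w. F w u v) xs) a b"
  unfolding op_defs by (rule bar_ev)

lemma bar_L: "bar (\<lambda>w. L ys c (\<lambda>u v. F w u v)) xs = L ys c (\<lambda>u v. bar (\<lambda>w. F w u v) xs)"
  unfolding op_defs by (rule bar_ev)

lemma S_diff: "S (\<lambda>u v. F u v - G u v) a b = S F a b - S G a b"
  unfolding op_defs by (rule ev_fun_diff)

lemma S_minus: "S (\<lambda>u v. - F u v) a b = - S F a b"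
  unfolding op_defs by (rule ev_fun_minus)

lemma L_add: "L xs c (\<lambda>u v. F u v + G u v) = L xs c F + L xs c G"
  unfolding op_defs by (rule ev_fun_add)

lemma L_zero [simp]: "L xs c (\<lambda>u v. 0) = 0"
  unfolding op_defs by (rule ev_fun_zero)

lemma L_diff: "L xs c (\<lambda>u v. F u v - G u v) = L xs c F - L xs c G"
  unfolding op_defs by (rule ev_fun_diff)

lemma L_minus: "L xs c (\<lambda>u v. - F u v) = - L xs c F"
  unfolding op_defs by (rule ev_fun_minus)

lemma L_mult_const: "L xs c (\<lambda>u v. k * F u v) = k * L xs c F"
  unfolding op_defs by (rule ev_fun_mult)

lemma R_add: "R c xs (\<lambda>u v. F u v + G u v) = R c xs F + R c xs G"
  unfolding op_defs by (rule ev_fun_add)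

lemma R_zero [simp]: "R c xs (\<lambda>u v. 0) = 0"
  unfolding op_defs by (rule ev_fun_zero)

lemma R_mult_const: "R c xs (\<lambda>u v. k * F u v) = k * R c xs F"
  unfolding op_defs by (rule ev_fun_mult)

lemma length_left_sum: "z \<in> Poly_Mapping.keys (left_sum xs c) \<Longrightarrow> length (snd z) = length xs"
  by (induction xs arbitrary: z) (auto elim!: keys_extend)

lemma length_right_sum: "z \<in> Poly_Mapping.keys (right_sum ys a) \<Longrightarrow> length (fst z) = length ys"
  by (induction ys arbitrary: z a) (auto elim!: keys_extend)

text \<open>A crossing preserves the length of the tuple crossed, so a nonempty tuple may be split
  into head and tail, or at its last entry, under \<open>L\<close>.\<close>

lemma L_cong: "(\<And>u w. length w = length xs \<Longrightarrow> F u w = G u w) \<Longrightarrow> L xs c F = L xs c G"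
  unfolding L_def by (rule ev_cong) (simp add: length_left_sum)

lemma R_cong: "(\<And>w u. length w = length ys \<Longrightarrow> F w u = G w u) \<Longrightarrow> R a ys F = R a ys G"
  unfolding R_def by (rule ev_cong) (simp add: length_right_sum)

text \<open>The element coming from the right meets the last entry first. Thus this form exposes the
  operator that acts first and \<open>L_Cons\<close> the one that acts last; for \<open>R\<close>
  the roles are reversed.\<close>

lemma L_snoc: "L (xs @ [a]) c K = S (\<lambda>u v. L xs u (\<lambda>c' w. K c' (w @ [v]))) a c"
  by (induction xs arbitrary: K) (simp_all add: L_Cons)

lemma R_snoc: "R a (ys @ [b]) K = R a ys (\<lambda>w a'. S (\<lambda>u v. K (w @ [u]) v) a' b)"
  by (induction ys arbitrary: a K) (simp_all add: R_Cons)

text \<open>The words in the \<open>\<sigma>\<^sub>i\<close> on the two sides differ by commutations only.\<close>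

lemma L_R_exchange:
  "L (xs @ [a]) y (\<lambda>y' v. R (last v) ys (\<lambda>w a'. F y' (butlast v) w a'))
    = R a (y # ys) (\<lambda>v a'. L xs (hd v) (\<lambda>y' w. F y' w (tl v) a'))"
  by (simp add: L_snoc R_Cons L_R)

definition multilin2 :: "('a \<Rightarrow> 'a list \<Rightarrow> 'k) \<Rightarrow> bool" where
  "multilin2 K \<longleftrightarrow> (\<forall>w. lin sA (\<lambda>c. K c w)) \<and> (\<forall>c. multilin sA (K c))"

end

text \<open>The transposes of: linearity of \<sigma>, the two identities in (2), and (4). They are
  restricted to bilinear \<open>G\<close> and linear \<open>g\<close>, since the value at any other
  function depends on the chosen expression \<open>s a b\<close>.\<close>

locale multiplicative_braiding = braiding sA s
  for sA :: "'k::field \<Rightarrow> 'a::{ring,monoid_mult} \<Rightarrow> 'a"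
    and s :: "'a \<Rightarrow> 'a \<Rightarrow> ('a \<times> 'a, 'k) free" +
  assumes bilin_S: "bilin G \<Longrightarrow> bilin (S G)"
    and S_mult_left: "bilin G \<Longrightarrow> S G (a * b) c = S (\<lambda>u v. S (\<lambda>x y. G x (y * v)) a u) b c"
    and S_mult_right: "bilin G \<Longrightarrow> S G a (b * c) = S (\<lambda>u v. S (\<lambda>x y. G (u * x) y) v c) a b"
    and S_mu: "lin sA g \<Longrightarrow> S (\<lambda>x y. g (x * y)) a b = g (a * b)"
begin

lemma multilin2D1: "multilin2 K \<Longrightarrow> lin sA (\<lambda>c. K c w)"
  by (simp add: multilin2_def)

lemma multilin2D2: "multilin2 K \<Longrightarrow> lin sA (\<lambda>a. K c (us @ a # vs))"
  by (simp add: multilin2_def multilin_def)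

lemma multilin2D3: "multilin2 K \<Longrightarrow> lin sA (\<lambda>a. K c (a # vs))"
  using multilin2D2[of K c "[]"] by simp

lemma lin_S: "(\<And>u v. lin sc (\<lambda>a. F a u v)) \<Longrightarrow> lin sc (\<lambda>a. S (F a) b c)"
  unfolding op_defs by (rule lin_ev)

lemma lin_L: "(\<And>u v. lin sc (\<lambda>a. F a u v)) \<Longrightarrow> lin sc (\<lambda>a. L b c (F a))"
  unfolding op_defs by (rule lin_ev)

lemma lin_R: "(\<And>u v. lin sc (\<lambda>a. F a u v)) \<Longrightarrow> lin sc (\<lambda>a. R b c (F a))"
  unfolding op_defs by (rule lin_ev)

lemma multilin2_L_step:
  assumes "multilin2 K"
  shows "multilin2 (\<lambda>c w. S (\<lambda>u v. K u (v # w)) x c)"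
proof -
  have "bilin (\<lambda>u v. K u (v # w))" for w
    using multilin2D1[OF assms] multilin2D3[OF assms] by (simp add: bilin_def)
  then have "lin sA (S (\<lambda>u v. K u (v # w)) x)" for w
    using bilin_S by (simp add: bilin_def)
  moreover have "lin sA (\<lambda>a. S (\<lambda>u v. K u (v # us @ a # vs)) x c)" for c us vs
    using multilin2D2[OF assms, of _ "_ # _"] by (auto intro!: lin_S)
  ultimately show ?thesis by (simp add: multilin2_def multilin_def)
qed

lemma multilin2_L:
  assumes "multilin2 K"
  shows "multilin2 (\<lambda>c xs. L xs c K)"
proof -
  have "lin sA (\<lambda>c. L xs c K)" for xs
    using assms
    by (induction xs arbitrary: K) (auto simp: L_Cons multilin2D1 intro: multilin2_L_step)
  moreover have "lin sA (\<lambda>a. L (us @ a # vs) c K)" for c us vs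
    using assms
  proof (induction us arbitrary: K)
    case Nil
    have "bilin (\<lambda>u v. K u (v # w))" for w
      using multilin2D1[OF Nil] multilin2D3[OF Nil] by (simp add: bilin_def)
    then have "lin sA (\<lambda>a. S (\<lambda>u v. K u (v # w)) a c')" for w c'
      using bilin_S by (simp add: bilin_def)
    then show ?case by (auto simp: L_Cons intro: lin_L)
  qed (simp add: L_Cons multilin2_L_step)
  ultimately show ?thesis by (simp add: multilin2_def multilin_def)
qed

lemma multilin2_R_step: "multilin2 (\<lambda>c w. K w c) \<Longrightarrow> multilin2 (\<lambda>c w. K (u # w) c)"
  by (auto simp: multilin2_def intro: multilin_Cons)

lemma multilin2_R:
  assumes "multilin2 (\<lambda>c w. K w c)"
  shows "multilin2 (\<lambda>a ys. R a ys K)"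
proof -
  have 1: "lin sA (\<lambda>a. R a ys K)" if "multilin2 (\<lambda>c w. K w c)" for ys K
    using that
  proof (induction ys arbitrary: K)
    case (Cons y ys)
    have "bilin (\<lambda>u v. R v ys (\<lambda>w. K (u # w)))"
      using Cons.IH[OF multilin2_R_step[OF Cons.prems]] multilin2D3[OF Cons.prems]
      by (auto simp: bilin_def intro: lin_R)
    then show ?case using bilin_S by (simp add: R_Cons bilin_def)
  qed (use multilin2D1[of "\<lambda>c w. K w c" for K] in simp)
  have bil: "bilin (\<lambda>u v. R v ys (\<lambda>w. K (u # w)))" if "multilin2 (\<lambda>c w. K w c)" for ys K
    using 1[OF multilin2_R_step[OF that]] multilin2D3[OF that] by (auto simp: bilin_def intro: lin_R)
  have "lin sA (\<lambda>b. R a (us @ b # vs) K)" for a us vs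
    using assms
  proof (induction us arbitrary: a K)
    case Nil
    then show ?case using bilin_S[OF bil[OF Nil]] by (simp add: R_Cons bilin_def)
  next
    case (Cons u us)
    then show ?case by (auto simp: R_Cons intro!: lin_S Cons.IH multilin2_R_step)
  qed
  then show ?thesis using 1[OF assms] by (simp add: multilin2_def multilin_def)
qed

lemma bilin_L_arg: "multilin2 K \<Longrightarrow> bilin (\<lambda>u v. K u (v # w))"
  using multilin2D1 multilin2D3 by (simp add: bilin_def)

lemma bilin_R_arg:
  assumes "multilin2 (\<lambda>c w. K w c)"
  shows "bilin (\<lambda>u v. R v ys (\<lambda>w. K (u # w)))"
proof -
  from multilin2D1[OF multilin2_R[OF multilin2_R_step[OF assms]]] multilin2D3[OF assms]
  show ?thesis by (auto simp: bilin_def intro: lin_R)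
qed

text \<open>By the first identity in (2), an element crosses a product of two entries as it crosses
  the entries one after the other, the results being multiplied afterwards. So crossing commutes
  with every interior face.\<close>

lemma L_bar:
  assumes "multilin2 K"
  shows "bar (\<lambda>w. L w c K) xs = L xs c (\<lambda>c' w. bar (K c') w)"
  using assms
proof (induction xs arbitrary: K rule: induct_list012)
  case (3 x x2 zs)
  let ?K' = "\<lambda>c' w. S (\<lambda>u v. K u (v # w)) x c'"
  have "bar (\<lambda>w. L (x # w) c K) (x2 # zs) = L (x2 # zs) c (\<lambda>c' w. bar (?K' c') w)"
    unfolding L_Cons by (subst L_Cons[symmetric], rule 3(2)) (rule multilin2_L_step[OF 3(3)])
  also have "\<dots> = L (x2 # zs) c (\<lambda>c' w. S (\<lambda>u v. bar (\<lambda>w. K u (v # w)) w) x c')"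
    by (simp add: bar_S)
  finally have 1: "bar (\<lambda>w. L (x # w) c K) (x2 # zs)
    = L (x2 # zs) c (\<lambda>c' w. S (\<lambda>u v. bar (\<lambda>w. K u (v # w)) w) x c')" .
  have "L (x * x2 # zs) c K = L zs c (\<lambda>c' w. S (\<lambda>u v. S (\<lambda>u' v'. K u' (v' * v # w)) x u) x2 c')"
    using S_mult_left[OF bilin_L_arg[OF 3(3)]] by (simp add: L_Cons)
  \<comment> \<open>The entry \<open>x2\<close> is crossed before \<open>x\<close> and survives as
    \<open>hd w\<close>; in this shape the term is the first face of \<open>bar\<close>.\<close>
  also have "\<dots> = L (x2 # zs) c (\<lambda>c' w. S (\<lambda>u v. K u (v * hd w # tl w)) x c')"
    by (simp add: L_Cons)
  finally have 2: "L (x * x2 # zs) c K = L (x2 # zs) c (\<lambda>c' w. S (\<lambda>u v. K u (v * hd w # tl w)) x c')" .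
  have "L (x # x2 # zs) c (\<lambda>c' w. bar (K c') w)
      = L (x2 # zs) c (\<lambda>c' w. S (\<lambda>u v. bar (K u) (v # w)) x c')"
    by (simp add: L_Cons[of x])
  also have "\<dots> = L (x2 # zs) c (\<lambda>c' w. - S (\<lambda>u v. K u (v * hd w # tl w)) x c'
      - S (\<lambda>u v. bar (\<lambda>w. K u (v # w)) w) x c')"
  proof (rule L_cong)
    fix c' :: 'a and w :: "'a list"
    assume "length w = length (x2 # zs)"
    then show "S (\<lambda>u v. bar (K u) (v # w)) x c' = - S (\<lambda>u v. K u (v * hd w # tl w)) x c'
      - S (\<lambda>u v. bar (\<lambda>w. K u (v # w)) w) x c'"
      by (cases w) (simp_all add: S_diff S_minus)
  qed
  finally show ?case using 1 2 by (simp add: L_diff L_minus)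
qed (simp_all add: L_Cons S_def)

text \<open>The factor \<open>a\<close>, nearer to the tuple, crosses first and \<open>b\<close>
  crosses what it leaves behind. At each entry this is the second identity in (2). It makes the
  action through a tuple a right action.\<close>

lemma L_mult:
  assumes "multilin2 K"
  shows "L xs (a * b) K = L xs a (\<lambda>c w. L w b (\<lambda>c' v. K (c * c') v))"
  using assms
proof (induction xs arbitrary: K)
  case (Cons x xs)
  have "L (x # xs) (a * b) K
      = L xs a (\<lambda>c w. L w b (\<lambda>c' v. S (\<lambda>u' v'. K u' (v' # v)) x (c * c')))"
    unfolding L_Cons by (rule Cons.IH) (rule multilin2_L_step[OF Cons.prems])
  also have "\<dots> = L xs a (\<lambda>c w. L w b (\<lambda>c' v. S (\<lambda>u u'. S (\<lambda>x y. K (u * x) (y # v)) u' c') x c))"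
    using S_mult_right[OF bilin_L_arg[OF Cons.prems]] by simp
  also have "\<dots> = L (x # xs) a (\<lambda>c w. L w b (\<lambda>c' v. K (c * c') v))"
    by (simp add: L_Cons S_L)
  finally show ?case .
qed simp

text \<open>Here the moving element crosses a product from the left, so it is the second identity in
  (2) that enters.\<close>

lemma R_bar:
  assumes "multilin2 (\<lambda>c w. K w c)"
  shows "bar (\<lambda>w. R a w K) ys = R a ys (\<lambda>w a'. bar (\<lambda>w. K w a') w)"
  using assms
proof (induction ys arbitrary: a K rule: induct_list012)
  case (2 y)
  show ?case by (simp add: R_Cons S_def)
next
  case (3 y y2 zs)
  note m = multilin2_R_step[OF 3(3)]
  have 1: "bar (\<lambda>w. R a (y # w) K) (y2 # zs)
      = S (\<lambda>u v. R v (y2 # zs) (\<lambda>w a'. bar (\<lambda>w. K (u # w) a') w)) a y"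
    unfolding R_Cons[of _ y] bar_S 3(2)[OF m] ..
  have 2: "R a (y * y2 # zs) K = S (\<lambda>u v. R v (y2 # zs) (\<lambda>w a'. K (u * hd w # tl w) a')) a y"
    unfolding R_Cons S_mult_right[OF bilin_R_arg[OF 3(3)]] by simp
  have "R a (y # y2 # zs) (\<lambda>w a'. bar (\<lambda>w. K w a') w)
      = S (\<lambda>u v. R v (y2 # zs) (\<lambda>w a'. bar (\<lambda>w. K w a') (u # w))) a y"
    by (rule R_Cons)
  also have "\<dots> = S (\<lambda>u v. R v (y2 # zs) (\<lambda>w a'. (- 1) * K (u * hd w # tl w) a'
      + (- 1) * bar (\<lambda>w. K (u # w) a') w)) a y"
    unfolding S_def
  proof (rule ev_cong, rule R_cong)
    fix t and w :: "'a list" and a'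
    assume "length w = length (y2 # zs)"
    then show "bar (\<lambda>w. K w a') (fst t # w) = (- 1) * K (fst t * hd w # tl w) a'
      + (- 1) * bar (\<lambda>w. K (fst t # w) a') w"
      by (cases w) simp_all
  qed
  also have "\<dots> = - S (\<lambda>u v. R v (y2 # zs) (\<lambda>w a'. K (u * hd w # tl w) a')) a y
      - S (\<lambda>u v. R v (y2 # zs) (\<lambda>w a'. bar (\<lambda>w. K (u # w) a') w)) a y"
    unfolding R_add R_mult_const by (simp add: S_diff S_minus)
  finally show ?case using 1 2 by simp
qed simp

text \<open>Now \<open>b\<close> is nearer to the tuple and crosses first. By the first identity in
  (2), the action through the tuple is a left action.\<close>

lemma R_mult:
  assumes "multilin2 (\<lambda>c w. K w c)"
  shows "R (a * b) ys K = R b ys (\<lambda>w b'. R a w (\<lambda>v a'. K v (a' * b')))"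
  using assms
proof (induction ys arbitrary: a b K)
  case (Cons y ys)
  note m = multilin2_R_step[OF Cons.prems]
  have "R (a * b) (y # ys) K = S (\<lambda>u v. S (\<lambda>u' v'. R (v' * v) ys (\<lambda>w. K (u' # w))) a u) b y"
    unfolding R_Cons S_mult_left[OF bilin_R_arg[OF Cons.prems]] ..
  also have "\<dots> = S (\<lambda>u v. S (\<lambda>u' v'. R v ys (\<lambda>w b'. R v' w (\<lambda>v a'. K (u' # v) (a' * b')))) a u) b y"
    unfolding Cons.IH[OF m] ..
  also have "\<dots> = R b (y # ys) (\<lambda>w b'. R a w (\<lambda>v a'. K v (a' * b')))"
    by (simp add: R_Cons S_R)
  finally show ?case .
qed simp

text \<open>The crossing of \<open>x\<close> is the last to act, and multiplying its two outputs
  undoes it by (4).\<close>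

lemma L_mu:
  assumes "\<And>w. lin sA (\<lambda>c. F c w)"
  shows "L (x # xs) y (\<lambda>c v. F (c * hd v) (tl v)) = L xs y (\<lambda>c w. F (x * c) w)"
  using S_mu[OF assms] by (simp add: L_Cons)

lemma R_mu:
  assumes "\<And>w. lin sA (\<lambda>c. F w c)"
  shows "R a (ys @ [b]) (\<lambda>w a'. F (butlast w) (last w * a')) = R a ys (\<lambda>w a'. F w (a' * b))"
  using S_mu[OF assms] by (simp add: R_snoc)

end

section \<open>The shuffle sum\<close>

text \<open>Two-letter words stand in for shuffles, so that sums over them can be split at the first
  letter. The section on reduced words returns to permutations.\<close>

definition words :: "nat \<Rightarrow> nat \<Rightarrow> bool list set" where
  "words p q = {e. count_list e True = p \<and> count_list e False = q}"

lemma length_count_bool: "length e = count_list e True + count_list e False"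
  by (induction e) auto

lemma finite_words [simp]: "finite (words p q)"
proof (rule finite_subset)
  show "words p q \<subseteq> {e. set e \<subseteq> UNIV \<and> length e = p + q}"
    by (auto simp: words_def length_count_bool)
qed (rule finite_lists_length_eq, simp)

lemma words_0_0: "words 0 0 = {[]}"
proof -
  have "e = []" if "e \<in> words 0 0" for e
    using that length_count_bool[of e] by (simp add: words_def)
  then show ?thesis by (auto simp: words_def)
qed

lemma words_rec:
  assumes "p + q > 0"
  shows "words p q = (if p = 0 then {} else Cons True ` words (p - 1) q)
    \<union> (if q = 0 then {} else Cons False ` words p (q - 1))"
proof (intro set_eqI)
  fix e
  show "e \<in> words p q \<longleftrightarrow> e \<in> (if p = 0 then {} else Cons True ` words (p - 1) q)
    \<union> (if q = 0 then {} else Cons False ` words p (q - 1))"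
  proof (cases e)
    case Nil
    then show ?thesis using assms by (auto simp: words_def)
  next
    case (Cons b e')
    then show ?thesis by (cases b) (auto simp: words_def)
  qed
qed

lemma sum_words_rec:
  assumes "p + q > 0"
  shows "(\<Sum>e\<in>words p q. f e) = (if p = 0 then 0 else \<Sum>e\<in>words (p - 1) q. f (True # e))
    + (if q = 0 then 0 else \<Sum>e\<in>words p (q - 1). f (False # e))"
  unfolding words_rec[OF assms]
  by (subst sum.union_disjoint) (auto simp: sum.reindex comp_def)

text \<open>An entry of the second tuple passes all entries of the first that come out later; this
  is the sign of the inversion count.\<close>

primrec word_sign :: "bool list \<Rightarrow> 'k::field" where
  "word_sign [] = 1"
| "word_sign (b # e) = (if b then 1 else (-1) ^ count_list e True) * word_sign e"

context braiding
begin

text \<open>The word \<open>e\<close> records, for each output position of a shuffle, whether its entry comes from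
  \<open>xs\<close> (\<open>True\<close>) or from \<open>ys\<close>.\<close>

primrec word_sum :: "bool list \<Rightarrow> 'a list \<Rightarrow> 'a list \<Rightarrow> ('a list, 'k) free" where
  "word_sum [] xs ys = gen []"
| "word_sum (b # e) xs ys =
    (if b then extend (\<lambda>zs. gen (hd xs # zs)) (word_sum e (tl xs) ys)
     else extend (\<lambda>z. extend (\<lambda>zs. gen (fst z # zs)) (word_sum e (snd z) (tl ys))) (left_sum xs (hd ys)))"

definition shuffle :: "'a list \<Rightarrow> 'a list \<Rightarrow> ('a list \<Rightarrow> 'k) \<Rightarrow> 'k" where
  "shuffle xs ys K = ev K (\<Sum>e\<in>words (length xs) (length ys). fscale (word_sign e) (word_sum e xs ys))"

lemma shuffle_sum: "shuffle xs ys K = (\<Sum>e\<in>words (length xs) (length ys). word_sign e * ev K (word_sum e xs ys))"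
  by (simp add: shuffle_def)

lemma shuffle_minus: "shuffle xs ys (\<lambda>zs. - F zs) = - shuffle xs ys F"
  unfolding shuffle_def by (rule ev_fun_minus)

lemma shuffle_diff: "shuffle xs ys (\<lambda>zs. F zs - G zs) = shuffle xs ys F - shuffle xs ys G"
  unfolding shuffle_def by (rule ev_fun_diff)

lemma shuffle_add: "shuffle xs ys (\<lambda>zs. F zs + G zs) = shuffle xs ys F + shuffle xs ys G"
  unfolding shuffle_def by (rule ev_fun_add)

lemma shuffle_mult: "shuffle xs ys (\<lambda>zs. c * F zs) = c * shuffle xs ys F"
  unfolding shuffle_def by (rule ev_fun_mult)

lemma lin_shuffle: "(\<And>zs. lin sc (\<lambda>a. F a zs)) \<Longrightarrow> lin sc (\<lambda>a. shuffle xs ys (F a))"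
  unfolding shuffle_def by (rule lin_ev)

lemma shuffle_Nil_Nil: "shuffle [] [] K = K []"
  by (simp add: shuffle_def words_0_0)

text \<open>The words are split at the first letter. If the first output comes from
  \<open>ys\<close>, it has crossed all of \<open>xs\<close>, and each crossing contributes a
  sign.\<close>

lemma shuffle_rec:
  assumes "xs \<noteq> [] \<or> ys \<noteq> []"
  shows "shuffle xs ys K = (if xs = [] then 0 else shuffle (tl xs) ys (\<lambda>zs. K (hd xs # zs)))
    + (if ys = [] then 0 else
        (-1) ^ length xs * L xs (hd ys) (\<lambda>c w. shuffle w (tl ys) (\<lambda>zs. K (c # zs))))"
proof -
  define p q where "p = length xs" and "q = length ys"
  have "p + q > 0" using assms by (simp add: p_def q_def)
  have T: "(\<Sum>e\<in>words (p - 1) q. word_sign (True # e) * ev K (word_sum (True # e) xs ys))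
      = shuffle (tl xs) ys (\<lambda>zs. K (hd xs # zs))"
    by (simp add: shuffle_sum p_def q_def)
  have F: "(\<Sum>e\<in>words p (q - 1). word_sign (False # e) * ev K (word_sum (False # e) xs ys))
      = (-1) ^ p * L xs (hd ys) (\<lambda>c w. shuffle w (tl ys) (\<lambda>zs. K (c # zs)))"
  proof -
    have "L xs (hd ys) (\<lambda>c w. shuffle w (tl ys) (\<lambda>zs. K (c # zs)))
        = L xs (hd ys) (\<lambda>c w. \<Sum>e\<in>words p (q - 1).
            word_sign e * ev (\<lambda>zs. K (c # zs)) (word_sum e w (tl ys)))"
      \<comment> \<open>The range of the sum depends on the length of \<open>w\<close>; under
        \<open>L\<close> that length is fixed.\<close>
      by (rule L_cong) (simp add: shuffle_sum p_def q_def)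
    also have "\<dots> = (\<Sum>e\<in>words p (q - 1). word_sign e * ev K (word_sum (False # e) xs ys))"
      by (simp add: L_def ev_fun_sum ev_fun_mult)
    finally have "(-1) ^ p * L xs (hd ys) (\<lambda>c w. shuffle w (tl ys) (\<lambda>zs. K (c # zs)))
        = (\<Sum>e\<in>words p (q - 1). (-1) ^ p * (word_sign e * ev K (word_sum (False # e) xs ys)))"
      by (simp only: sum_distrib_left)
    moreover have "(\<Sum>e\<in>words p (q - 1). word_sign (False # e) * ev K (word_sum (False # e) xs ys))
        = (\<Sum>e\<in>words p (q - 1). (-1) ^ p * (word_sign e * ev K (word_sum (False # e) xs ys)))"
      by (rule sum.cong) (simp_all add: words_def mult.assoc del: word_sum.simps)
    ultimately show ?thesis by (rule trans[OF _ sym, rotated])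
  qed
  have "shuffle xs ys K = (if p = 0 then 0 else shuffle (tl xs) ys (\<lambda>zs. K (hd xs # zs)))
      + (if q = 0 then 0 else (-1) ^ p * L xs (hd ys) (\<lambda>c w. shuffle w (tl ys) (\<lambda>zs. K (c # zs))))"
    unfolding T[symmetric] F[symmetric] shuffle_sum[of xs ys] p_def[symmetric] q_def[symmetric]
    by (rule sum_words_rec) fact
  then show ?thesis by (simp only: p_def q_def length_0_conv)
qed

lemma shuffle_Nil_left [simp]: "shuffle [] ys K = K ys"
proof (induction ys arbitrary: K)
  case (Cons y ys)
  then show ?case by (subst shuffle_rec) simp_all
qed (rule shuffle_Nil_Nil)

lemma shuffle_Nil_right [simp]: "shuffle xs [] K = K xs"
proof (induction xs arbitrary: K)
  case (Cons x xs)
  then show ?case by (subst shuffle_rec) simp_all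
qed (rule shuffle_Nil_Nil)

lemma shuffle_Cons_Cons: "shuffle (x # xs) (y # ys) K = shuffle xs (y # ys) (\<lambda>zs. K (x # zs))
    - (-1) ^ length xs * L (x # xs) y (\<lambda>c w. shuffle w ys (\<lambda>zs. K (c # zs)))"
  by (subst shuffle_rec) simp_all

lemma length_word_sum:
  "e \<in> words (length xs) (length ys) \<Longrightarrow> zs \<in> Poly_Mapping.keys (word_sum e xs ys) \<Longrightarrow> length zs = length e"
proof (induction e arbitrary: xs ys zs)
  case (Cons b e)
  show ?case
  proof (cases b)
    case True
    with Cons.prems(1) have e: "e \<in> words (length (tl xs)) (length ys)"
      by (auto simp: words_def)
    from Cons.prems(2) True obtain zs'
      where "zs' \<in> Poly_Mapping.keys (word_sum e (tl xs) ys)" "zs = hd xs # zs'"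
      by (auto elim: keys_extend)
    with Cons.IH[OF e] show ?thesis by simp
  next
    case False
    from Cons.prems(2) False obtain z zs' where z: "z \<in> Poly_Mapping.keys (left_sum xs (hd ys))"
      and zs': "zs' \<in> Poly_Mapping.keys (word_sum e (snd z) (tl ys))" "zs = fst z # zs'"
      by (auto elim!: keys_extend)
    from Cons.prems(1) False length_left_sum[OF z] have "e \<in> words (length (snd z)) (length (tl ys))"
      by (auto simp: words_def)
    from Cons.IH[OF this zs'(1)] zs'(2) show ?thesis by simp
  qed
qed simp

lemma shuffle_cong:
  assumes "\<And>zs. length zs = length xs + length ys \<Longrightarrow> F zs = G zs"
  shows "shuffle xs ys F = shuffle xs ys G"
proof -
  have "ev F (word_sum e xs ys) = ev G (word_sum e xs ys)" if "e \<in> words (length xs) (length ys)" for e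
    using that length_word_sum[OF that] length_count_bool[of e] assms
    by (intro ev_cong) (auto simp: words_def)
  then show ?thesis by (simp add: shuffle_sum)
qed

text \<open>Splitting by both the first and the last output gives four pieces, reached from either
  recursion. In the piece that starts in \<open>ys\<close> and ends in \<open>xs\<close>, one
  element crosses all of \<open>xs\<close> and another all of \<open>ys\<close>;
  \<open>L_R_exchange\<close> reverses the order of these two moves.\<close>

lemma shuffle_rec_last:
  assumes "xs \<noteq> [] \<or> ys \<noteq> []"
  shows "shuffle xs ys K = (if ys = [] then 0 else shuffle xs (butlast ys) (\<lambda>zs. K (zs @ [last ys])))
    + (if xs = [] then 0 else
        (-1) ^ length ys * R (last xs) ys (\<lambda>w a. shuffle (butlast xs) w (\<lambda>zs. K (zs @ [a]))))"
  using assms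
proof (induction "length xs + length ys" arbitrary: xs ys K rule: less_induct)
  case less
  show ?case
  proof (cases "xs = [] \<or> ys = []")
    case True
    then show ?thesis using less.prems by auto
  next
    case False
    then obtain x xs' y ys' where xs: "xs = x # xs'" and ys: "ys = y # ys'"
      by (metis neq_Nil_conv)
    have xs_ne: "xs \<noteq> []" by (simp add: xs)
    define p q :: nat where "p = length xs'" and "q = length ys'"
    \<comment> \<open>\<open>A\<close> starts and ends in \<open>xs\<close>, \<open>B\<close> starts
      and ends in \<open>ys\<close>, \<open>C\<close> starts in \<open>ys\<close> and ends in
      \<open>xs\<close>. If a tail is empty, a single entry would have to be both first and last
      while the other tuple is nonempty, so the piece is 0.\<close>
    define A where "A = (if xs' = [] then 0 else
      R (last xs) ys (\<lambda>w a. shuffle (butlast xs') w (\<lambda>zs. K (x # zs @ [a]))))"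
    define B where "B = (if ys' = [] then 0 else
      L xs y (\<lambda>c w. shuffle w (butlast ys') (\<lambda>zs. K (c # zs @ [last ys]))))"
    define C where "C = L xs y (\<lambda>c w. R (last w) ys'
      (\<lambda>v a. shuffle (butlast w) v (\<lambda>zs. K (c # zs @ [a]))))"
    have 1: "shuffle xs' ys (\<lambda>zs. K (x # zs))
        = shuffle xs' (butlast ys) (\<lambda>zs. K (x # zs @ [last ys])) - (-1) ^ q * A"
      by (subst less.hyps) (auto simp: xs ys A_def q_def)
    have 2: "L xs y (\<lambda>c w. shuffle w ys' (\<lambda>zs. K (c # zs))) = B + (-1) ^ q * C"
    proof -
      have "L xs y (\<lambda>c w. shuffle w ys' (\<lambda>zs. K (c # zs)))
        = L xs y (\<lambda>c w. (if ys' = [] then 0 else shuffle w (butlast ys') (\<lambda>zs. K (c # zs @ [last ys])))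
          + (-1) ^ q * R (last w) ys' (\<lambda>v a. shuffle (butlast w) v (\<lambda>zs. K (c # zs @ [a]))))"
      proof (rule L_cong)
        fix c and w :: "'a list"
        assume "length w = length xs"
        then have "w \<noteq> []" by (auto simp: xs)
        then show "shuffle w ys' (\<lambda>zs. K (c # zs)) =
            (if ys' = [] then 0 else shuffle w (butlast ys') (\<lambda>zs. K (c # zs @ [last ys])))
            + (-1) ^ q * R (last w) ys' (\<lambda>v a. shuffle (butlast w) v (\<lambda>zs. K (c # zs @ [a])))"
          using less.hyps[of w ys' "\<lambda>zs. K (c # zs)"] \<open>length w = length xs\<close>
          by (auto simp: ys q_def)
      qed
      then show ?thesis by (auto simp: L_add L_mult_const B_def C_def)
    qed
    have LHS: "shuffle xs ys K = shuffle xs' (butlast ys) (\<lambda>zs. K (x # zs @ [last ys])) - (-1) ^ q * A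
        - (-1) ^ p * (B + (-1) ^ q * C)"
      using 1 2 by (simp add: xs ys shuffle_Cons_Cons p_def)
    have 3: "shuffle xs (butlast ys) (\<lambda>zs. K (zs @ [last ys]))
        = shuffle xs' (butlast ys) (\<lambda>zs. K (x # zs @ [last ys])) - (-1) ^ p * B"
      by (cases "ys' = []") (simp_all add: xs ys B_def shuffle_Cons_Cons p_def)
    have "R (last xs) ys (\<lambda>w a. shuffle (butlast xs) w (\<lambda>zs. K (zs @ [a])))
        = R (last xs) ys (\<lambda>w a. (if xs' = [] then 0 else shuffle (butlast xs') w (\<lambda>zs. K (x # zs @ [a])))
          + (-1) ^ p * L (butlast xs) (hd w) (\<lambda>c v. shuffle v (tl w) (\<lambda>zs. K (c # zs @ [a]))))"
    proof (rule R_cong)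
      fix a and w :: "'a list"
      assume "length w = length ys"
      then have "w \<noteq> []" by (auto simp: ys)
      then show "shuffle (butlast xs) w (\<lambda>zs. K (zs @ [a]))
          = (if xs' = [] then 0 else shuffle (butlast xs') w (\<lambda>zs. K (x # zs @ [a])))
          + (-1) ^ p * L (butlast xs) (hd w) (\<lambda>c v. shuffle v (tl w) (\<lambda>zs. K (c # zs @ [a])))"
        by (subst shuffle_rec) (auto simp: xs p_def)
    qed
    also have "\<dots> = A + (-1) ^ p * R (last xs) ys
        (\<lambda>w a. L (butlast xs) (hd w) (\<lambda>c v. shuffle v (tl w) (\<lambda>zs. K (c # zs @ [a]))))"
      by (auto simp: R_add R_mult_const A_def)
    also have "R (last xs) ys
        (\<lambda>w a. L (butlast xs) (hd w) (\<lambda>c v. shuffle v (tl w) (\<lambda>zs. K (c # zs @ [a])))) = C"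
      using L_R_exchange[of "butlast xs" "last xs" y ys' "\<lambda>c w v a. shuffle w v (\<lambda>zs. K (c # zs @ [a]))"]
      by (simp add: C_def ys xs_ne)
    finally have 4: "R (last xs) ys (\<lambda>w a. shuffle (butlast xs) w (\<lambda>zs. K (zs @ [a]))) = A + (-1) ^ p * C" .
    show ?thesis
      unfolding LHS using 3 4 by (simp add: xs ys q_def algebra_simps)
  qed
qed

end

section \<open>Multilinearity of the shuffle sum in each tuple\<close>

context multiplicative_braiding
begin

text \<open>The second premise is an induction hypothesis in the next lemma and the conclusion of
  that lemma afterwards.\<close>

lemma multilin2_shuffle_aux:
  assumes "multilin sA K" and "\<And>K. multilin sA K \<Longrightarrow> multilin sA (\<lambda>w. shuffle w ys K)"
  shows "multilin2 (\<lambda>c w. shuffle w ys (\<lambda>zs. K (c # zs)))"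
proof -
  have "lin sA (\<lambda>c. shuffle w ys (\<lambda>zs. K (c # zs)))" for w
    by (rule lin_shuffle) (rule multilin_lin_Cons[OF assms(1)])
  moreover have "multilin sA (\<lambda>w. shuffle w ys (\<lambda>zs. K (c # zs)))" for c
    by (rule assms(2)) (rule multilin_Cons[OF assms(1)])
  ultimately show ?thesis by (simp add: multilin2_def)
qed

lemma multilin_shuffle_left:
  assumes "multilin sA K"
  shows "multilin sA (\<lambda>xs. shuffle xs ys K)"
  using assms
proof (induction ys arbitrary: K)
  case (Cons y ys)
  note m2 = multilin2_L[OF multilin2_shuffle_aux[OF _ Cons.IH]]
  have "lin sA (\<lambda>a. shuffle (us @ a # vs) (y # ys) K)" if "multilin sA K" for us vs K
    using that
  proof (induction us arbitrary: K)
    case Nil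
    have "lin sA (\<lambda>a. shuffle vs (y # ys) (\<lambda>zs. K (a # zs)))"
      by (rule lin_shuffle) (rule multilin_lin_Cons[OF Nil])
    with multilin2D3[OF m2[OF Nil]] show ?case
      by (simp add: shuffle_Cons_Cons lin_diff lin_mult)
  next
    case (Cons u us)
    from Cons.IH[OF multilin_Cons[OF Cons.prems]]
      multilin2D2[OF m2[OF Cons.prems], where us = "u # us" and vs = vs]
    show ?case
      by (simp add: shuffle_Cons_Cons lin_add lin_diff lin_mult)
  qed
  then show ?case using Cons.prems by (simp add: multilin_def)
qed simp

lemma multilin2_shuffle:
  "multilin sA K \<Longrightarrow> multilin2 (\<lambda>c w. shuffle w ys (\<lambda>zs. K (c # zs)))"
  by (rule multilin2_shuffle_aux[OF _ multilin_shuffle_left])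

text \<open>The outer induction is on the place in the second tuple: a crossing replaces the first
  tuple by others, so the hypothesis must be available for all of them.\<close>

lemma multilin_shuffle_right:
  assumes "multilin sA K"
  shows "multilin sA (\<lambda>ys. shuffle xs ys K)"
proof -
  have "lin sA (\<lambda>b. shuffle xs (us @ b # vs) K)" for us vs
    using assms
  proof (induction us arbitrary: xs K)
    case Nil
    then show ?case
    proof (induction xs arbitrary: K)
      case Nil
      then show ?case by (simp add: multilin_lin_Cons)
    next
      case (Cons x xs)
      from Cons.IH[OF multilin_Cons[OF Cons.prems]]
        multilin2D1[OF multilin2_L[OF multilin2_shuffle[OF Cons.prems]]]
      show ?case by (simp add: shuffle_Cons_Cons lin_diff lin_mult)
    qed
  next
    case (Cons u us)
    note IH = Cons.IH
    from Cons.prems show ?case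
    proof (induction xs arbitrary: K)
      case Nil
      then show ?case using multilin_lin[OF Nil, of "u # us"] by simp
    next
      case (Cons x xs)
      have "lin sA (\<lambda>a. L (x # xs) u (\<lambda>c w. shuffle w (us @ a # vs) (\<lambda>zs. K (c # zs))))"
        by (intro lin_L IH) (rule multilin_Cons[OF Cons.prems])
      with Cons.IH[OF multilin_Cons[OF Cons.prems]] show ?case
        by (simp add: shuffle_Cons_Cons lin_diff lin_mult)
    qed
  qed
  then show ?thesis by (simp add: multilin_def)
qed

end

text \<open>The first interior face of \<open>x # zs\<close>. The value 0 on the empty tuple lets
  \<open>bar_Cons\<close> hold without a case distinction.\<close>

definition front :: "'a::times \<Rightarrow> ('a list \<Rightarrow> 'k::field) \<Rightarrow> 'a list \<Rightarrow> 'k" where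
  "front x F zs = (if zs = [] then 0 else F (x * hd zs # tl zs))"

lemma bar_Cons: "bar F (x # zs) = - front x F zs - bar (\<lambda>w. F (x # w)) zs"
  by (cases zs) (simp_all add: front_def)

context multiplicative_braiding
begin

text \<open>The products of an entry of \<open>xs\<close> with an entry of \<open>ys\<close> cancel in pairs by \<open>\<mu>\<sigma> = \<mu>\<close>.\<close>

lemma shuffle_bar:
  assumes "multilin sA F"
  shows "shuffle xs ys (bar F)
    = bar (\<lambda>w. shuffle w ys F) xs + (-1) ^ length xs * bar (\<lambda>w. shuffle xs w F) ys"
  using assms
proof (induction "length xs + length ys" arbitrary: xs ys F rule: less_induct)
  case less
  show ?case
  proof (cases "xs = [] \<or> ys = []")
    case True
    then show ?thesis by auto
  next
    case False
    then obtain x xs' y ys' where xs: "xs = x # xs'" and ys: "ys = y # ys'"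
      by (metis neq_Nil_conv)
    define p :: nat where "p = length xs'"
    let ?e = "(-1) ^ p :: 'k"
    have mF: "multilin sA (\<lambda>w. F (x # w))" for x
      by (rule multilin_Cons[OF less.prems])
    define Q where "Q c v = shuffle v ys' (\<lambda>zs. F (c # zs))" for c v
    \<comment> \<open>\<open>A\<close>, \<open>X\<close> and \<open>B\<close> collect the products
      of the first two outputs: both from \<open>xs\<close>, one from each tuple, both from
      \<open>ys\<close>. The others carry an interior face behind the first output:
      \<open>b1\<close> and \<open>b2\<close> after \<open>x\<close>, in \<open>xs'\<close> and in
      \<open>ys\<close>; \<open>E\<close> and \<open>C\<close> after the moved \<open>y\<close>, in
      the crossed tuple and in \<open>ys'\<close>.\<close>
    define A where "A = (if xs' = [] then 0 else shuffle (tl xs') ys (\<lambda>zs. F (x * hd xs' # zs)))"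
    define X where "X = L xs' y (\<lambda>c w. Q (x * c) w)"
    define b1 where "b1 = bar (\<lambda>w. shuffle w ys (\<lambda>zs. F (x # zs))) xs'"
    define b2 where "b2 = bar (\<lambda>w. shuffle xs' w (\<lambda>zs. F (x # zs))) ys"
    define B where "B = (if ys' = [] then 0 else
      L xs y (\<lambda>c w. L w (hd ys') (\<lambda>c' v. shuffle v (tl ys') (\<lambda>zs. F (c * c' # zs)))))"
    define C where "C = L xs y (\<lambda>c w. bar (\<lambda>v. shuffle w v (\<lambda>zs. F (c # zs))) ys')"
    define E where "E = L xs y (\<lambda>c w. bar (Q c) w)"
    have Q2: "multilin2 Q"
      unfolding Q_def by (rule multilin2_shuffle[OF less.prems])
    have LHS1: "shuffle xs' ys (\<lambda>zs. bar F (x # zs)) = - (A + ?e * X) - (b1 + ?e * b2)"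
    proof -
      have "shuffle xs' ys (front x F) = A + ?e * X"
      proof -
        have "shuffle xs' ys (front x F) = (if xs' = [] then 0 else shuffle (tl xs') ys (\<lambda>zs. front x F (hd xs' # zs)))
            + ?e * L xs' y (\<lambda>c w. shuffle w ys' (\<lambda>zs. front x F (c # zs)))"
          by (subst shuffle_rec) (simp_all add: ys p_def)
        then show ?thesis by (simp add: front_def A_def X_def Q_def)
      qed
      moreover have "shuffle xs' ys (bar (\<lambda>zs. F (x # zs))) = b1 + ?e * b2"
        unfolding b1_def b2_def p_def by (rule less.hyps) (auto simp: xs intro: mF)
      ultimately show ?thesis by (simp add: bar_Cons shuffle_diff shuffle_minus)
    qed
    have LHS2: "L xs y (\<lambda>c w. shuffle w ys' (\<lambda>zs. bar F (c # zs))) = - (X - ?e * B) - (E - ?e * C)"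
    proof -
      have "L xs y (\<lambda>c w. shuffle w ys' (\<lambda>zs. bar F (c # zs)))
        = L xs y (\<lambda>c w. - (Q (c * hd w) (tl w) - ?e * (if ys' = [] then 0 else
              L w (hd ys') (\<lambda>c' v. shuffle v (tl ys') (\<lambda>zs. F (c * c' # zs)))))
            - (bar (Q c) w - ?e * bar (\<lambda>v. shuffle w v (\<lambda>zs. F (c # zs))) ys'))"
      proof (rule L_cong)
        fix c and w :: "'a list"
        assume w: "length w = length xs"
        then have "w \<noteq> []" by (auto simp: xs)
        have "shuffle w ys' (bar (\<lambda>zs. F (c # zs)))
            = bar (Q c) w - ?e * bar (\<lambda>v. shuffle w v (\<lambda>zs. F (c # zs))) ys'"
          using less.hyps[OF _ mF, of w ys' c] w by (simp add: xs ys p_def Q_def[abs_def])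
        moreover have "shuffle w ys' (front c F) = Q (c * hd w) (tl w) - ?e * (if ys' = [] then 0 else
              L w (hd ys') (\<lambda>c' v. shuffle v (tl ys') (\<lambda>zs. F (c * c' # zs))))"
          by (subst shuffle_rec) (use w \<open>w \<noteq> []\<close> in \<open>simp_all add: front_def Q_def xs p_def\<close>)
        ultimately show "shuffle w ys' (\<lambda>zs. bar F (c # zs))
          = - (Q (c * hd w) (tl w) - ?e * (if ys' = [] then 0 else
              L w (hd ys') (\<lambda>c' v. shuffle v (tl ys') (\<lambda>zs. F (c * c' # zs)))))
            - (bar (Q c) w - ?e * bar (\<lambda>v. shuffle w v (\<lambda>zs. F (c # zs))) ys')"
          by (simp only: bar_Cons shuffle_diff shuffle_minus)
      qed
      also have "\<dots> = - (L xs y (\<lambda>c w. Q (c * hd w) (tl w)) - ?e * B) - (E - ?e * C)"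
        by (cases "ys' = []") (simp_all add: L_diff L_minus L_mult_const B_def C_def E_def)
      \<comment> \<open>By (4) the products with \<open>y\<close> in front of \<open>x\<close> equal
        those with \<open>x\<close> in front of \<open>y\<close>. The two occurrences of
        \<open>X\<close> then carry opposite signs in the shuffle sum.\<close>
      also have "L xs y (\<lambda>c w. Q (c * hd w) (tl w)) = X"
        unfolding xs X_def by (rule L_mu) (rule multilin2D1[OF Q2])
      finally show ?thesis .
    qed
    have LHS: "shuffle xs ys (bar F) = - (A + ?e * X) - (b1 + ?e * b2)
        - ?e * (- (X - ?e * B) - (E - ?e * C))"
      using LHS1 LHS2 by (simp add: xs ys shuffle_Cons_Cons p_def)
    have RHS1: "bar (\<lambda>w. shuffle w ys F) xs = - A - b1 + ?e * E"
    proof -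
      have "bar (\<lambda>w. shuffle (x # w) ys F) xs'
          = bar (\<lambda>w. shuffle w ys (\<lambda>zs. F (x # zs)) + ?e * L (x # w) y Q) xs'"
      proof (rule bar_cong)
        fix w :: "'a list" assume "Suc (length w) = length xs'"
        \<comment> \<open>Merging has shortened the tuple by one, so the second term of the
          recursion changes sign.\<close>
        then have "?e = - ((-1) ^ length w)" unfolding p_def by (metis power_Suc mult_minus1)
        then show "shuffle (x # w) ys F = shuffle w ys (\<lambda>zs. F (x # zs)) + ?e * L (x # w) y Q"
          by (simp add: ys shuffle_Cons_Cons Q_def[abs_def])
      qed
      then have 1: "bar (\<lambda>w. shuffle (x # w) ys F) xs' = b1 + ?e * bar (\<lambda>w. L (x # w) y Q) xs'"
        by (simp add: bar_add bar_mult b1_def)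
      have 2: "front x (\<lambda>w. shuffle w ys F) xs' = A + ?e * front x (\<lambda>w. L w y Q) xs'"
        by (cases xs') (simp_all add: front_def A_def ys shuffle_Cons_Cons Q_def[abs_def] p_def)
      have "bar (\<lambda>w. L w y Q) xs = E"
        unfolding E_def by (rule L_bar[OF Q2])
      \<comment> \<open>Expanding \<open>E\<close> at the entry \<open>x\<close> produces exactly
        the \<open>L\<close> terms left over in 1 and 2.\<close>
      then have 3: "E = - front x (\<lambda>w. L w y Q) xs' - bar (\<lambda>w. L (x # w) y Q) xs'"
        by (simp add: xs bar_Cons)
      then show ?thesis
        unfolding xs bar_Cons 1 2 3 by (simp add: algebra_simps)
    qed
    have RHS2: "bar (\<lambda>w. shuffle xs w F) ys = b2 - ?e * (- B - C)"
    proof -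
      define Z where "Z w = L xs (hd w) (\<lambda>c v. shuffle v (tl w) (\<lambda>zs. F (c # zs)))" for w
      have "bar (\<lambda>w. shuffle xs w F) ys = bar (\<lambda>w. shuffle xs' w (\<lambda>zs. F (x # zs)) - ?e * Z w) ys"
      \<comment> \<open>The recursion needs a nonempty \<open>w\<close>. It would fail when
        \<open>ys\<close> has one entry, but then both sides are 0.\<close>
      proof (cases "ys' = []")
        case False
        show ?thesis
        proof (rule bar_cong)
          fix w :: "'a list" assume "Suc (length w) = length ys"
          then have "w \<noteq> []" using False by (auto simp: ys)
          then show "shuffle xs w F = shuffle xs' w (\<lambda>zs. F (x # zs)) - ?e * Z w"
            by (cases w) (simp_all add: xs shuffle_Cons_Cons Z_def p_def)
        qed
      qed (simp add: ys)
      then have 1: "bar (\<lambda>w. shuffle xs w F) ys = b2 - ?e * bar Z ys"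
        by (simp add: bar_diff bar_mult b2_def)
      have "bar (\<lambda>w. Z (y # w)) ys' = C"
        by (simp add: Z_def C_def bar_L)
      moreover have "front y Z ys' = B"
      proof (cases ys')
        case (Cons y2 ys2)
        then show ?thesis
          using L_mult[OF multilin2_shuffle[OF less.prems], of xs y y2 ys2]
          by (simp add: front_def Z_def B_def)
      qed (simp add: front_def B_def)
      ultimately have "bar Z ys = - B - C"
        by (simp add: ys bar_Cons)
      then show ?thesis using 1 by simp
    qed
    have "- (A + e * X) - (b1 + e * b2) - e * (- (X - e * B) - (E - e * C))
        = (- A - b1 + e * E) + - e * (b2 - e * (- B - C))" for e
      by (simp add: algebra_simps)
    moreover have "(-1) ^ length xs = - ?e" by (simp add: xs p_def)
    ultimately show ?thesis
      unfolding LHS RHS1 RHS2 by (simp only:)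
  qed
qed

end

section \<open>The transposed differentials\<close>

text \<open>The transpose of the Hochschild differential, acting on functions on coefficients and tuples;
  \<open>rm\<close> and \<open>lm\<close> are the right and left actions on the coefficients.\<close>

definition coeff_dual :: "('a::times \<Rightarrow> 'n \<Rightarrow> ('n, 'k::field) free) \<Rightarrow> ('a \<Rightarrow> 'n \<Rightarrow> ('n, 'k) free)
    \<Rightarrow> ('n \<Rightarrow> 'a list \<Rightarrow> 'k) \<Rightarrow> 'n \<Rightarrow> 'a list \<Rightarrow> 'k" where
  "coeff_dual rm lm G n xs = (if xs = [] then 0 else
     ev (\<lambda>n'. G n' (tl xs)) (rm (hd xs) n) + bar (G n) xs
     + (-1) ^ length xs * ev (\<lambda>n'. G n' (butlast xs)) (lm (last xs) n))"

text \<open>The bimodule laws are required only against the given \<open>G\<close>: for coefficients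
  such as M \<otimes> A^q they come from (2) and hold against multilinear functions.\<close>

lemma coeff_dual_coeff_dual:
  fixes G :: "'n \<Rightarrow> 'a::semigroup_mult list \<Rightarrow> 'k::field"
  assumes rr: "\<And>a b n xs. ev (\<lambda>n'. ev (\<lambda>n. G n xs) (rm b n')) (rm a n) = ev (\<lambda>n. G n xs) (rm (a * b) n)"
    and ll: "\<And>a b n xs. ev (\<lambda>n'. ev (\<lambda>n. G n xs) (lm a n')) (lm b n) = ev (\<lambda>n. G n xs) (lm (a * b) n)"
    and rl: "\<And>a b n xs. ev (\<lambda>n'. ev (\<lambda>n. G n xs) (rm a n')) (lm b n)
      = ev (\<lambda>n'. ev (\<lambda>n. G n xs) (lm b n')) (rm a n)"
  shows "coeff_dual rm lm (coeff_dual rm lm G) n xs = 0"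
proof -
  \<comment> \<open>\<open>P\<close> and \<open>Q\<close> are the two outer faces. In the square of
    the sum, the right action cancels against products at the front, the left action against
    products at the end, and the two outer faces cancel because the actions commute.\<close>
  define P where "P G n xs = (if xs = [] then 0 else ev (\<lambda>n'. G n' (tl xs)) (rm (hd xs) n))"
    for G :: "'n \<Rightarrow> 'a list \<Rightarrow> 'k" and n xs
  define Q where "Q G n xs = (if xs = [] then 0 else (-1) ^ length xs * ev (\<lambda>n'. G n' (butlast xs)) (lm (last xs) n))"
    for G :: "'n \<Rightarrow> 'a list \<Rightarrow> 'k" and n xs
  have h: "coeff_dual rm lm G n xs = P G n xs + bar (G n) xs + Q G n xs" for G n xs
    by (simp add: coeff_dual_def P_def Q_def)
  have P_add: "P (\<lambda>n w. G n w + H n w) n xs = P G n xs + P H n xs" for G H n xs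
    by (simp add: P_def ev_fun_add)
  have Q_add: "Q (\<lambda>n w. G n w + H n w) n xs = Q G n xs + Q H n xs" for G H n xs
    by (simp add: Q_def ev_fun_add algebra_simps)
  have expand: "coeff_dual rm lm (coeff_dual rm lm G) n xs =
      (P (P G) n xs + P (\<lambda>n. bar (G n)) n xs + bar (P G n) xs)
      + (Q (Q G) n xs + Q (\<lambda>n. bar (G n)) n xs + bar (Q G n) xs)
      + (P (Q G) n xs + Q (P G) n xs) + bar (bar (G n)) xs"
    unfolding h[abs_def] P_add Q_add bar_add by (simp add: algebra_simps)
  have 1: "P (P G) n xs + P (\<lambda>n. bar (G n)) n xs + bar (P G n) xs = 0"
  proof (cases xs)
    case (Cons x ys)
    then show ?thesis
    proof (cases ys)
      case Nil
      with Cons show ?thesis by (simp add: P_def)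
    next
      case (Cons y zs)
      with \<open>xs = x # ys\<close> show ?thesis
        by (simp add: P_def rr bar_ev)
    qed
  qed (simp add: P_def)
  have 2: "Q (Q G) n xs + Q (\<lambda>n. bar (G n)) n xs + bar (Q G n) xs = 0"
  proof (cases xs rule: rev_cases)
    case (snoc ys x)
    then show ?thesis
    proof (cases ys rule: rev_cases)
      case Nil
      with snoc show ?thesis by (simp add: Q_def)
    next
      case (snoc zs y)
      have "bar (\<lambda>w. Q G n (w @ [x])) ys = bar (\<lambda>w. - ((-1) ^ length zs) * ev (\<lambda>n'. G n' w) (lm x n)) ys"
        by (rule bar_cong) (simp add: Q_def snoc)
      also have "\<dots> = - ((-1) ^ length zs) * ev (\<lambda>n'. bar (G n') ys) (lm x n)"
        by (simp add: bar_mult bar_minus bar_ev)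
      finally have "bar (\<lambda>w. Q G n (w @ [x])) (zs @ [y]) = - ((-1) ^ length zs) * ev (\<lambda>n'. bar (G n') ys) (lm x n)"
        by (simp add: snoc)
      with snoc \<open>xs = ys @ [x]\<close> show ?thesis
        by (simp add: bar_snoc) (simp add: Q_def butlast_append ll ev_fun_mult ev_fun_minus)
    qed
  qed (simp add: Q_def)
  have 3: "P (Q G) n xs + Q (P G) n xs = 0"
  proof (cases xs)
    case (Cons x ys)
    then show ?thesis
    proof (cases ys rule: rev_cases)
      case Nil
      with Cons show ?thesis by (simp add: P_def Q_def)
    next
      case (snoc zs y)
      with Cons show ?thesis
        by (simp add: P_def Q_def butlast_append ev_fun_mult ev_fun_minus rl)
    qed
  qed (simp add: P_def Q_def)
  show ?thesis unfolding expand 1 2 3 bar_bar by simp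
qed

locale braided_bimodule = multiplicative_braiding sA s + algebra_bimodule sA sM l r
  for sA :: "'k::field \<Rightarrow> 'a::{ring,monoid_mult} \<Rightarrow> 'a"
    and s :: "'a \<Rightarrow> 'a \<Rightarrow> ('a \<times> 'a, 'k) free"
    and sM :: "'k \<Rightarrow> 'm::ab_group_add \<Rightarrow> 'm"
    and l :: "'a \<Rightarrow> 'm \<Rightarrow> 'm" and r :: "'m \<Rightarrow> 'a \<Rightarrow> 'm"
begin

definition multilin_M :: "('m \<times> 'a list \<Rightarrow> 'k) \<Rightarrow> bool" where
  "multilin_M F \<longleftrightarrow> (\<forall>xs. lin sM (\<lambda>m. F (m, xs))) \<and> (\<forall>m. multilin sA (\<lambda>xs. F (m, xs)))"

definition multilin_MM :: "('m \<times> 'a list \<times> 'a list \<Rightarrow> 'k) \<Rightarrow> bool" where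
  "multilin_MM F \<longleftrightarrow>
    (\<forall>xs ys. lin sM (\<lambda>m. F (m, xs, ys))) \<and> (\<forall>m ys. multilin sA (\<lambda>xs. F (m, xs, ys)))
    \<and> (\<forall>m xs. multilin sA (\<lambda>ys. F (m, xs, ys)))"

lemma multilin_MM_D:
  assumes "multilin_MM F"
  shows "lin sM (\<lambda>m. F (m, xs, ys))" "multilin sA (\<lambda>xs. F (m, xs, ys))"
    "multilin sA (\<lambda>ys. F (m, xs, ys))"
  using assms by (auto simp: multilin_MM_def)

lemma lin_l: "lin sM g \<Longrightarrow> lin sA (\<lambda>a. g (l a m))"
  by (simp add: lin_def l_add_left l_scale_left)

lemma lin_r: "lin sM g \<Longrightarrow> lin sA (\<lambda>a. g (r m a))"
  by (simp add: lin_def r_add_right r_scale_right)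

lemma lin_l_M: "lin sM g \<Longrightarrow> lin sM (\<lambda>m. g (l a m))"
  by (simp add: lin_def l_add_right l_scale_right)

lemma lin_r_M: "lin sM g \<Longrightarrow> lin sM (\<lambda>m. g (r m a))"
  by (simp add: lin_def r_add_left r_scale_left)

text \<open>Transpose of the differential A: the last entry of \<open>xs\<close> must cross
  \<open>ys\<close> to reach \<open>m\<close> from the left. In \<open>right_dual\<close>, which
  transposes B, the first entry of \<open>ys\<close> crosses \<open>xs\<close> instead.\<close>

definition left_dual :: "('m \<times> 'a list \<times> 'a list \<Rightarrow> 'k) \<Rightarrow> 'm \<times> 'a list \<times> 'a list \<Rightarrow> 'k" where
  "left_dual G = (\<lambda>(m, xs, ys). if xs = [] then 0 else
     G (r m (hd xs), tl xs, ys) + bar (\<lambda>w. G (m, w, ys)) xs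
     + (-1) ^ length xs * R (last xs) ys (\<lambda>w a. G (l a m, butlast xs, w)))"

definition right_dual :: "('m \<times> 'a list \<times> 'a list \<Rightarrow> 'k) \<Rightarrow> 'm \<times> 'a list \<times> 'a list \<Rightarrow> 'k" where
  "right_dual G = (\<lambda>(m, xs, ys). if ys = [] then 0 else
     L xs (hd ys) (\<lambda>c w. G (r m c, w, tl ys)) + bar (\<lambda>w. G (m, xs, w)) ys
     + (-1) ^ length ys * G (l (last ys) m, xs, butlast ys))"

definition rho_dual :: "('m \<times> 'a list \<times> 'a list \<Rightarrow> 'k) \<Rightarrow> 'm \<times> 'a list \<times> 'a list \<Rightarrow> 'k" where
  "rho_dual G = (\<lambda>(m, xs, ys). left_dual G (m, xs, ys) + (-1) ^ length xs * right_dual G (m, xs, ys))"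

text \<open>The Hochschild complex is the row \<open>ys = []\<close> of the double complex.
  Extending \<open>F\<close> by 0 off this row lets it inherit its square and its multilinearity
  from \<open>left_dual\<close>.\<close>

definition hochschild_dual :: "('m \<times> 'a list \<Rightarrow> 'k) \<Rightarrow> 'm \<times> 'a list \<Rightarrow> 'k" where
  "hochschild_dual F = (\<lambda>(m, xs). left_dual (\<lambda>(m, xs, ys). if ys = [] then F (m, xs) else 0) (m, xs, []))"

lemma hochschild_dual_apply:
  "hochschild_dual F (m, xs) = left_dual (\<lambda>(m, xs, ys). if ys = [] then F (m, xs) else 0) (m, xs, [])"
  by (simp add: hochschild_dual_def)

lemma multilin_MM_Nil:
  "multilin_M F \<Longrightarrow> multilin_MM (\<lambda>(m, xs, ys). if ys = [] then F (m, xs) else 0)"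
  by (auto simp: multilin_MM_def multilin_M_def multilin_def intro!: lin_if)

lemma multilin2_l:
  assumes "multilin_MM G"
  shows "multilin2 (\<lambda>c w. G (l c m, xs, w))"
  unfolding multilin2_def
  using lin_l[OF multilin_MM_D(1)[OF assms]] multilin_MM_D(3)[OF assms] by blast

lemma multilin2_r:
  assumes "multilin_MM G"
  shows "multilin2 (\<lambda>c w. G (r m c, w, ys))"
  unfolding multilin2_def
  using lin_r[OF multilin_MM_D(1)[OF assms]] multilin_MM_D(2)[OF assms] by blast

text \<open>The pair of \<open>m\<close> and \<open>ys\<close> serves as coefficient;
  \<open>R_mult\<close> is the associativity of its left action.\<close>

lemma left_dual_left_dual:
  assumes "multilin_MM G"
  shows "left_dual (left_dual G) z = 0"
proof (cases z)
  case (fields m xs ys)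
  define lm where "lm x n = extend (\<lambda>z. gen (l (snd z) (fst n), fst z)) (right_sum (snd n) x)" for x n
  define rm :: "'a \<Rightarrow> 'm \<times> 'a list \<Rightarrow> ('m \<times> 'a list, 'k) free"
    where "rm x n = gen (r (fst n) x, snd n)" for x n
  have lm: "ev g (lm x n) = R x (snd n) (\<lambda>w a. g (l a (fst n), w))" for g x n
    by (simp add: lm_def R_def)
  have rm: "ev g (rm x n) = g (r (fst n) x, snd n)" for g x n
    by (simp add: rm_def)
  have h: "coeff_dual rm lm (\<lambda>n xs. G (fst n, xs, snd n)) n xs = left_dual G (fst n, xs, snd n)" for G n xs
    by (simp add: coeff_dual_def left_dual_def lm rm)
  have "coeff_dual rm lm (coeff_dual rm lm (\<lambda>n xs. G (fst n, xs, snd n))) (m, ys) xs = 0"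
  proof (rule coeff_dual_coeff_dual)
    fix a b :: 'a and n :: "'m \<times> 'a list" and xs :: "'a list"
    show "ev (\<lambda>n'. ev (\<lambda>n. G (fst n, xs, snd n)) (rm b n')) (rm a n)
        = ev (\<lambda>n. G (fst n, xs, snd n)) (rm (a * b) n)"
      by (simp add: rm r_mult)
    show "ev (\<lambda>n'. ev (\<lambda>n. G (fst n, xs, snd n)) (lm a n')) (lm b n)
        = ev (\<lambda>n. G (fst n, xs, snd n)) (lm (a * b) n)"
      using R_mult[OF multilin2_l[OF assms]] by (simp add: lm l_mult)
    show "ev (\<lambda>n'. ev (\<lambda>n. G (fst n, xs, snd n)) (rm a n')) (lm b n)
        = ev (\<lambda>n'. ev (\<lambda>n. G (fst n, xs, snd n)) (lm b n')) (rm a n)"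
      by (simp add: lm rm l_r_assoc)
  qed
  then show ?thesis unfolding fields h[abs_def] h by (simp add: h[of "left_dual G"])
qed

text \<open>Here the coefficient is the pair of \<open>m\<close> and \<open>xs\<close>, and
  \<open>L_mult\<close> gives the associativity of its right action.\<close>

lemma right_dual_right_dual:
  assumes "multilin_MM G"
  shows "right_dual (right_dual G) z = 0"
proof (cases z)
  case (fields m xs ys)
  define rm where "rm x n = extend (\<lambda>z. gen (r (fst n) (fst z), snd z)) (left_sum (snd n) x)" for x n
  define lm :: "'a \<Rightarrow> 'm \<times> 'a list \<Rightarrow> ('m \<times> 'a list, 'k) free"
    where "lm x n = gen (l x (fst n), snd n)" for x n
  have rm: "ev g (rm x n) = L (snd n) x (\<lambda>c w. g (r (fst n) c, w))" for g x n
    by (simp add: rm_def L_def)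
  have lm: "ev g (lm x n) = g (l x (fst n), snd n)" for g x n
    by (simp add: lm_def)
  have h: "coeff_dual rm lm (\<lambda>n ys. G (fst n, snd n, ys)) n ys = right_dual G (fst n, snd n, ys)" for G n ys
    by (simp add: coeff_dual_def right_dual_def lm rm)
  have "coeff_dual rm lm (coeff_dual rm lm (\<lambda>n ys. G (fst n, snd n, ys))) (m, xs) ys = 0"
  proof (rule coeff_dual_coeff_dual)
    fix a b :: 'a and n :: "'m \<times> 'a list" and ys :: "'a list"
    show "ev (\<lambda>n'. ev (\<lambda>n. G (fst n, snd n, ys)) (rm b n')) (rm a n)
        = ev (\<lambda>n. G (fst n, snd n, ys)) (rm (a * b) n)"
      using L_mult[OF multilin2_r[OF assms]] by (simp add: rm r_mult)
    show "ev (\<lambda>n'. ev (\<lambda>n. G (fst n, snd n, ys)) (lm a n')) (lm b n)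
        = ev (\<lambda>n. G (fst n, snd n, ys)) (lm (a * b) n)"
      by (simp add: lm l_mult)
    show "ev (\<lambda>n'. ev (\<lambda>n. G (fst n, snd n, ys)) (rm a n')) (lm b n)
        = ev (\<lambda>n'. ev (\<lambda>n. G (fst n, snd n, ys)) (lm b n')) (rm a n)"
      by (simp add: lm rm l_r_assoc)
  qed
  then show ?thesis unfolding fields h[abs_def] h by (simp add: h[of "right_dual G"])
qed

text \<open>Nine pairs of faces are matched. Two first faces or two last faces meet in a product,
  where (4) removes one crossing (\<open>L_mu\<close>, \<open>R_mu\<close>). An interior face passes
  a crossing by \<open>L_bar\<close> or \<open>R_bar\<close>. The pair of faces that cross each
  other is exchanged by \<open>L_R_exchange\<close>, and the remaining ones commute by the bimodule
  laws and \<open>bar_swap\<close>.\<close>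

lemma left_dual_right_dual:
  assumes G: "multilin_MM G"
  shows "left_dual (right_dual G) (m, xs, ys) = right_dual (left_dual G) (m, xs, ys)"
proof (cases "xs = [] \<or> ys = []")
  case True
  then show ?thesis
  proof (cases "xs = []")
    case True
    then show ?thesis by (simp add: left_dual_def right_dual_def)
  next
    case False
    with True have "ys = []" by simp
    then show ?thesis by (simp add: left_dual_def right_dual_def)
  qed
next
  case False
  then have xs: "xs \<noteq> []" and ys: "ys \<noteq> []" by auto
  let ?a = "last xs" and ?b = "last ys" and ?xb = "butlast xs" and ?yb = "butlast ys"
  let ?ep = "(-1) ^ length xs :: 'k" and ?eq = "(-1) ^ length ys :: 'k"
  \<comment> \<open>The two digits name the face in \<open>xs\<close> and the face in
    \<open>ys\<close>: 0 for first, 1 for interior, 2 for last.\<close>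
  define c00 where "c00 = L (tl xs) (hd ys) (\<lambda>c w. G (r m (hd xs * c), w, tl ys))"
  define c01 where "c01 = bar (\<lambda>w. G (r m (hd xs), tl xs, w)) ys"
  define c02 where "c02 = G (l ?b (r m (hd xs)), tl xs, ?yb)"
  define c10 where "c10 = L xs (hd ys) (\<lambda>c w. bar (\<lambda>v. G (r m c, v, tl ys)) w)"
  define c11 where "c11 = bar (\<lambda>w. bar (\<lambda>v. G (m, w, v)) ys) xs"
  define c12 where "c12 = bar (\<lambda>w. G (l ?b m, w, ?yb)) xs"
  define c20 where "c20 = R ?a ys (\<lambda>w a. L ?xb (hd w) (\<lambda>c v. G (r (l a m) c, v, tl w)))"
  define c21 where "c21 = R ?a ys (\<lambda>w a. bar (\<lambda>v. G (l a m, ?xb, v)) w)"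
  define c22 where "c22 = R ?a ?yb (\<lambda>w a. G (l (a * ?b) m, ?xb, w))"
  have right_dual_ne: "right_dual G (m, w, v) = L w (hd v) (\<lambda>c w. G (r m c, w, tl v)) + bar (\<lambda>v. G (m, w, v)) v
     + (-1) ^ length v * G (l (last v) m, w, butlast v)" if "v \<noteq> []" for m w v
    using that by (simp add: right_dual_def)
  have left_dual_ne: "left_dual G (m, w, v) = G (r m (hd w), tl w, v) + bar (\<lambda>w. G (m, w, v)) w
     + (-1) ^ length w * R (last w) v (\<lambda>v a. G (l a m, butlast w, v))" if "w \<noteq> []" for m w v
    using that by (simp add: left_dual_def)
  have "right_dual G (r m (hd xs), tl xs, ys) = c00 + c01 + ?eq * c02"
    by (simp add: right_dual_ne[OF ys] c00_def c01_def c02_def r_mult)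
  moreover have "bar (\<lambda>w. right_dual G (m, w, ys)) xs = c10 + c11 + ?eq * c12"
    unfolding right_dual_ne[OF ys] bar_add bar_mult L_bar[OF multilin2_r[OF G]] c10_def c11_def c12_def ..
  moreover have "R ?a ys (\<lambda>w a. right_dual G (l a m, ?xb, w)) = c20 + c21 + ?eq * c22"
  proof -
    have "R ?a ys (\<lambda>w a. right_dual G (l a m, ?xb, w))
      = R ?a ys (\<lambda>w a. L ?xb (hd w) (\<lambda>c v. G (r (l a m) c, v, tl w)) + bar (\<lambda>v. G (l a m, ?xb, v)) w
        + ?eq * G (l (last w * a) m, ?xb, butlast w))"
    proof (rule R_cong)
      fix w :: "'a list" and a
      assume "length w = length ys"
      moreover from this ys have "w \<noteq> []" by auto
      ultimately show "right_dual G (l a m, ?xb, w) = L ?xb (hd w) (\<lambda>c v. G (r (l a m) c, v, tl w))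
          + bar (\<lambda>v. G (l a m, ?xb, v)) w + ?eq * G (l (last w * a) m, ?xb, butlast w)"
        by (simp add: right_dual_ne l_mult)
    qed
    moreover have "R ?a (?yb @ [?b]) (\<lambda>w a. G (l (last w * a) m, ?xb, butlast w)) = c22"
      unfolding c22_def
      by (rule R_mu[of "\<lambda>w c. G (l c m, ?xb, w)"]) (rule lin_l[OF multilin_MM_D(1)[OF G]])
    ultimately show ?thesis
      using ys by (simp add: R_add R_mult_const c20_def c21_def)
  qed
  ultimately have A: "left_dual (right_dual G) (m, xs, ys) = (c00 + c01 + ?eq * c02) + (c10 + c11 + ?eq * c12)
      + ?ep * (c20 + c21 + ?eq * c22)"
    using xs by (simp add: left_dual_def[of "right_dual G"])
  obtain y ys' where ysC: "ys = y # ys'" using ys by (cases ys) auto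
  have "L xs y (\<lambda>c w. left_dual G (r m c, w, ys')) = c00 + c10 + ?ep * c20"
  proof -
    have "L xs y (\<lambda>c w. left_dual G (r m c, w, ys'))
      = L xs y (\<lambda>c w. G (r m (c * hd w), tl w, ys') + bar (\<lambda>w. G (r m c, w, ys')) w
        + ?ep * R (last w) ys' (\<lambda>v a. G (r (l a m) c, butlast w, v)))"
    proof (rule L_cong)
      fix c and w :: "'a list"
      assume "length w = length xs"
      moreover from this xs have "w \<noteq> []" by auto
      ultimately show "left_dual G (r m c, w, ys') = G (r m (c * hd w), tl w, ys')
        + bar (\<lambda>w. G (r m c, w, ys')) w
        + ?ep * R (last w) ys' (\<lambda>v a. G (r (l a m) c, butlast w, v))"
        by (simp add: left_dual_ne r_mult l_r_assoc)
    qed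
    moreover have "L (hd xs # tl xs) y (\<lambda>c w. G (r m (c * hd w), tl w, ys')) = c00"
      unfolding c00_def ysC list.sel
      by (rule L_mu[of "\<lambda>c w. G (r m c, w, ys')"]) (rule lin_r[OF multilin_MM_D(1)[OF G]])
    \<comment> \<open>Both elements travel across the other tuple; only the order of the two
      journeys differs.\<close>
    moreover have "L xs y (\<lambda>c w. R (last w) ys' (\<lambda>v a. G (r (l a m) c, butlast w, v))) = c20"
      using xs L_R_exchange[of ?xb ?a y ys' "\<lambda>c w v a. G (r (l a m) c, w, v)"]
      by (simp add: c20_def ysC)
    ultimately show ?thesis
      using xs by (simp add: L_add L_mult_const c10_def ysC)
  qed
  moreover have "bar (\<lambda>v. left_dual G (m, xs, v)) ys = c01 + c11 + ?ep * c21"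
    unfolding left_dual_ne[OF xs] bar_add bar_mult R_bar[OF multilin2_l[OF G]] c01_def c11_def c21_def
    by (simp only: bar_swap[of _ xs ys])
  moreover have "left_dual G (l ?b m, xs, ?yb) = c02 + c12 + ?ep * c22"
    by (simp add: left_dual_ne[OF xs] c02_def c12_def c22_def l_mult l_r_assoc)
  ultimately have B: "right_dual (left_dual G) (m, xs, ys) = (c00 + c10 + ?ep * c20) + (c01 + c11 + ?ep * c21)
      + ?eq * (c02 + c12 + ?ep * c22)"
    by (simp add: right_dual_def[of "left_dual G"] ysC)
  show ?thesis unfolding A B by (simp only: algebra_simps)
qed

text \<open>A lowers the length of \<open>xs\<close> by one and so meets the opposite sign in front
  of B. The two mixed terms therefore cancel.\<close>

lemma rho_dual_rho_dual:
  assumes G: "multilin_MM G"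
  shows "rho_dual (rho_dual G) z = 0"
proof (cases z)
  case (fields m xs ys)
  let ?e = "(-1) ^ length xs :: 'k"
  have "left_dual (rho_dual G) (m, xs, ys) = left_dual (left_dual G) (m, xs, ys) - ?e * left_dual (right_dual G) (m, xs, ys)"
  proof (cases xs)
    case (Cons x xs')
    \<comment> \<open>The sign is that of a first tuple one entry shorter than
      \<open>xs\<close>.\<close>
    have 2: "rho_dual G (m', w, v) = left_dual G (m', w, v) + (- ?e) * right_dual G (m', w, v)"
      if "Suc (length w) = length xs" for m' w v
      by (simp add: rho_dual_def flip: that)
    have "bar (\<lambda>w. rho_dual G (m, w, ys)) xs = bar (\<lambda>w. left_dual G (m, w, ys) + (- ?e) * right_dual G (m, w, ys)) xs"
      by (rule bar_cong) (rule 2)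
    then have 1: "bar (\<lambda>w. rho_dual G (m, w, ys)) xs
        = bar (\<lambda>w. left_dual G (m, w, ys)) xs + (- ?e) * bar (\<lambda>w. right_dual G (m, w, ys)) xs"
      by (simp only: bar_add bar_mult)
    have "Suc (length (butlast xs)) = length xs" using Cons by simp
    note 3 = 2[OF this]
    have 4: "rho_dual G (r m (hd xs), tl xs, ys) = left_dual G (r m (hd xs), tl xs, ys) + (- ?e) * right_dual G (r m (hd xs), tl xs, ys)"
      using Cons by (intro 2) simp
    have ne: "xs \<noteq> []" using Cons by simp
    show ?thesis
      unfolding left_dual_def[of "rho_dual G"] left_dual_def[of "left_dual G"] left_dual_def[of "right_dual G"]
        prod.case if_not_P[OF ne] 1 3 4 R_add R_mult_const
      by (simp add: algebra_simps)
  qed (simp add: left_dual_def)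
  moreover have "right_dual (rho_dual G) (m, xs, ys) = right_dual (left_dual G) (m, xs, ys) + ?e * right_dual (right_dual G) (m, xs, ys)"
  proof -
    have 1: "L xs (hd ys) (\<lambda>c w. rho_dual G (r m c, w, tl ys))
        = L xs (hd ys) (\<lambda>c w. left_dual G (r m c, w, tl ys)) + ?e * L xs (hd ys) (\<lambda>c w. right_dual G (r m c, w, tl ys))"
      unfolding L_mult_const[symmetric] L_add[symmetric] by (rule L_cong) (simp add: rho_dual_def)
    have 2: "rho_dual G (m', xs, v) = left_dual G (m', xs, v) + ?e * right_dual G (m', xs, v)" for m' v
      by (simp add: rho_dual_def)
    show ?thesis
      unfolding right_dual_def[of "rho_dual G"] right_dual_def[of "left_dual G"] right_dual_def[of "right_dual G"]
        prod.case 1 2 bar_add bar_mult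
      by (simp add: algebra_simps)
  qed
  moreover have "rho_dual (rho_dual G) (m, xs, ys) = left_dual (rho_dual G) (m, xs, ys) + ?e * right_dual (rho_dual G) (m, xs, ys)"
    by (simp only: rho_dual_def[of "rho_dual G"] prod.case)
  ultimately show ?thesis
    by (simp add: fields left_dual_left_dual[OF G] right_dual_right_dual[OF G] left_dual_right_dual[OF G])
qed

lemma hochschild_dual_hochschild_dual:
  assumes "multilin_M F"
  shows "hochschild_dual (hochschild_dual F) z = 0"
proof (cases z)
  case (Pair m xs)
  let ?G = "\<lambda>(m, xs, ys). if ys = [] then F (m, xs) else 0"
  have "hochschild_dual (hochschild_dual F) (m, xs)
      = left_dual (\<lambda>(m, xs, ys). if ys = [] then left_dual ?G (m, xs, []) else 0) (m, xs, [])"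
    by (simp only: hochschild_dual_apply)
  also have "\<dots> = left_dual (left_dual ?G) (m, xs, [])"
    by (simp add: left_dual_def[of "left_dual ?G"]
        left_dual_def[of "\<lambda>(m, xs, ys). if ys = [] then left_dual ?G (m, xs, []) else 0"])
  finally show ?thesis using left_dual_left_dual[OF multilin_MM_Nil[OF assms]] by (simp add: Pair)
qed

definition shuffle_dual :: "('m \<times> 'a list \<Rightarrow> 'k) \<Rightarrow> 'm \<times> 'a list \<times> 'a list \<Rightarrow> 'k" where
  "shuffle_dual F = (\<lambda>(m, xs, ys). shuffle xs ys (\<lambda>zs. F (m, zs)))"

lemma rho_dual_shuffle_dual:
  assumes F: "multilin_M F"
  shows "rho_dual (shuffle_dual F) z = shuffle_dual (hochschild_dual F) z"
proof (cases z)
  case (fields m xs ys)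
  show ?thesis
  proof (cases "xs = [] \<and> ys = []")
    case True
    then show ?thesis by (simp add: fields rho_dual_def shuffle_dual_def hochschild_dual_def left_dual_def right_dual_def)
  next
    case False
    let ?ep = "(-1) ^ length xs :: 'k" and ?eq = "(-1) ^ length ys :: 'k"
    have S0: "shuffle xs ys (\<lambda>zs. hochschild_dual F (m, zs)) = shuffle xs ys (\<lambda>zs. F (r m (hd zs), tl zs)
        + bar (\<lambda>w. F (m, w)) zs + ?ep * ?eq * F (l (last zs) m, butlast zs))"
    proof (rule shuffle_cong)
      fix zs :: "'a list"
      assume "length zs = length xs + length ys"
      moreover from this False have "zs \<noteq> []" by auto
      ultimately show "hochschild_dual F (m, zs) = F (r m (hd zs), tl zs)
          + bar (\<lambda>w. F (m, w)) zs + ?ep * ?eq * F (l (last zs) m, butlast zs)"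
        by (simp add: hochschild_dual_def left_dual_def power_add)
    qed
    have S1: "shuffle xs ys (\<lambda>zs. F (r m (hd zs), tl zs))
        = (if xs = [] then 0 else shuffle (tl xs) ys (\<lambda>zs. F (r m (hd xs), zs)))
          + ?ep * (if ys = [] then 0 else L xs (hd ys) (\<lambda>c w. shuffle w (tl ys) (\<lambda>zs. F (r m c, zs))))"
      by (subst shuffle_rec) (use False in auto)
    have S2: "shuffle xs ys (bar (\<lambda>w. F (m, w))) = bar (\<lambda>w. shuffle w ys (\<lambda>w. F (m, w))) xs
        + ?ep * bar (\<lambda>w. shuffle xs w (\<lambda>w. F (m, w))) ys"
      using F by (intro shuffle_bar) (simp add: multilin_M_def)
    have S3: "shuffle xs ys (\<lambda>zs. F (l (last zs) m, butlast zs))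
        = (if ys = [] then 0 else shuffle xs (butlast ys) (\<lambda>zs. F (l (last ys) m, zs)))
          + ?eq * (if xs = [] then 0 else
              R (last xs) ys (\<lambda>w a. shuffle (butlast xs) w (\<lambda>zs. F (l a m, zs))))"
      by (subst shuffle_rec_last) (use False in auto)
    have e: "?eq * ?eq = 1" by (simp add: power_add[symmetric])
    \<comment> \<open>The sign of the last Hochschild face and the sign in
      \<open>shuffle_rec_last\<close> combine to the sign of the third term of \<open>rho\<close>,
      since the square of \<open>?eq\<close> is 1.\<close>
    have e': "?ep * ?eq * (B + ?eq * A) = ?ep * A + ?ep * (?eq * B)" for A B
    proof -
      have "?ep * ?eq * (B + ?eq * A) = ?ep * (?eq * ?eq) * A + ?ep * (?eq * B)"
        by (simp only: algebra_simps)
      then show ?thesis by (simp add: e)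
    qed
    have "shuffle_dual (hochschild_dual F) (m, xs, ys) = rho_dual (shuffle_dual F) (m, xs, ys)"
      unfolding shuffle_dual_def[of "hochschild_dual F"] prod.case S0 shuffle_add shuffle_mult S1 S2 S3 e'
      by (simp add: rho_dual_def left_dual_def right_dual_def shuffle_dual_def algebra_simps)
    then show ?thesis by (simp add: fields)
  qed
qed

section \<open>The transposed maps preserve multilinearity\<close>

lemma multilin_left_dual:
  assumes G: "multilin_MM G"
  shows "multilin_MM (left_dual G)"
proof -
  note G1 = multilin_MM_D(1)[OF G] and G2 = multilin_MM_D(2)[OF G] and G3 = multilin_MM_D(3)[OF G]
  note G2' = multilin_lin[OF G2] and G3' = multilin_lin[OF G3]
  have "lin sM (\<lambda>m. left_dual G (m, xs, ys))" for xs ys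
  proof -
    have "lin sM (\<lambda>m. R (last xs) ys (\<lambda>w a. G (l a m, butlast xs, w)))"
      by (rule lin_R) (rule lin_l_M[OF G1])
    moreover have "lin sM (\<lambda>m. bar (\<lambda>w. G (m, w, ys)) xs)"
      by (rule lin_bar) (rule G1)
    ultimately show ?thesis
      unfolding left_dual_def prod.case using lin_r_M[OF G1] by (intro lin_if lin_add lin_mult lin_zero) auto
  qed
  moreover have "lin sA (\<lambda>a. left_dual G (m, us @ a # vs, ys))" for m us vs ys
  proof -
    have "lin sA (\<lambda>a. G (r m (hd (us @ a # vs)), tl (us @ a # vs), ys))"
      using lin_r[OF G1] G2' by (cases us) simp_all
    moreover have "lin sA (\<lambda>a. bar (\<lambda>w. G (m, w, ys)) (us @ a # vs))"
      by (rule multilin_lin[OF multilin_bar[OF G2]])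
    moreover have "lin sA (\<lambda>a. R (last (us @ a # vs)) ys (\<lambda>w c. G (l c m, butlast (us @ a # vs), w)))"
    proof (cases vs)
      case Nil
      then show ?thesis using multilin2D1[OF multilin2_R[OF multilin2_l[OF G]]]
        by (simp add: butlast_append)
    next
      case (Cons v vs')
      then show ?thesis using lin_R[OF G2'[of _ us "butlast vs"]]
        by (simp add: butlast_append)
    qed
    ultimately show ?thesis
      unfolding left_dual_def by (simp add: lin_add lin_diff lin_mult)
  qed
  moreover have "lin sA (\<lambda>b. left_dual G (m, xs, us @ b # vs))" for m xs us vs
  proof -
    have "lin sA (\<lambda>b. bar (\<lambda>w. G (m, w, us @ b # vs)) xs)"
      by (rule lin_bar) (rule G3')
    moreover have "lin sA (\<lambda>b. R (last xs) (us @ b # vs) (\<lambda>w a. G (l a m, butlast xs, w)))"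
      by (rule multilin2D2[OF multilin2_R[OF multilin2_l[OF G]]])
    ultimately show ?thesis
      unfolding left_dual_def prod.case using G3' by (intro lin_if lin_add lin_mult lin_zero) auto
  qed
  ultimately show ?thesis by (simp add: multilin_MM_def multilin_def)
qed

lemma multilin_right_dual:
  assumes G: "multilin_MM G"
  shows "multilin_MM (right_dual G)"
proof -
  note G1 = multilin_MM_D(1)[OF G] and G2 = multilin_MM_D(2)[OF G] and G3 = multilin_MM_D(3)[OF G]
  note G2' = multilin_lin[OF G2] and G3' = multilin_lin[OF G3]
  have "lin sM (\<lambda>m. right_dual G (m, xs, ys))" for xs ys
  proof -
    have "lin sM (\<lambda>m. L xs (hd ys) (\<lambda>c w. G (r m c, w, tl ys)))"
      by (rule lin_L) (rule lin_r_M[OF G1])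
    moreover have "lin sM (\<lambda>m. bar (\<lambda>w. G (m, xs, w)) ys)"
      by (rule lin_bar) (rule G1)
    ultimately show ?thesis
      unfolding right_dual_def prod.case using lin_l_M[OF G1] by (intro lin_if lin_add lin_mult lin_zero) auto
  qed
  moreover have "lin sA (\<lambda>b. right_dual G (m, xs, us @ b # vs))" for m us vs xs
  proof -
    have "lin sA (\<lambda>b. G (l (last (us @ b # vs)) m, xs, butlast (us @ b # vs)))"
    proof (cases vs)
      case Nil
      then show ?thesis using lin_l[OF G1] by (simp add: butlast_append)
    next
      case (Cons v vs')
      then show ?thesis using G3'[of _ _ us "butlast vs"] by (simp add: butlast_append)
    qed
    moreover have "lin sA (\<lambda>b. bar (\<lambda>w. G (m, xs, w)) (us @ b # vs))"
      by (rule multilin_lin[OF multilin_bar[OF G3]])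
    moreover have "lin sA (\<lambda>b. L xs (hd (us @ b # vs)) (\<lambda>c w. G (r m c, w, tl (us @ b # vs))))"
    proof (cases us)
      case Nil
      then show ?thesis using multilin2D1[OF multilin2_L[OF multilin2_r[OF G]]] by simp
    next
      case (Cons u us')
      then show ?thesis using lin_L[OF G3'] by simp
    qed
    ultimately show ?thesis
      unfolding right_dual_def by (simp add: lin_add lin_diff lin_mult)
  qed
  moreover have "lin sA (\<lambda>a. right_dual G (m, us @ a # vs, ys))" for m ys us vs
  proof -
    have "lin sA (\<lambda>a. bar (\<lambda>w. G (m, us @ a # vs, w)) ys)"
      by (rule lin_bar) (rule G2')
    moreover have "lin sA (\<lambda>a. L (us @ a # vs) (hd ys) (\<lambda>c w. G (r m c, w, tl ys)))"
      by (rule multilin2D2[OF multilin2_L[OF multilin2_r[OF G]]])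
    ultimately show ?thesis
      unfolding right_dual_def prod.case using G2' by (intro lin_if lin_add lin_mult lin_zero) auto
  qed
  ultimately show ?thesis by (simp add: multilin_MM_def multilin_def)
qed

lemma multilin_rho_dual: "multilin_MM G \<Longrightarrow> multilin_MM (rho_dual G)"
  using multilin_left_dual[of G] multilin_right_dual[of G]
  by (auto simp: multilin_MM_def multilin_def rho_dual_def intro!: lin_add lin_diff lin_mult)

lemma multilin_hochschild_dual:
  assumes "multilin_M F"
  shows "multilin_M (hochschild_dual F)"
proof -
  from multilin_left_dual[OF multilin_MM_Nil[OF assms]] show ?thesis
    by (auto simp: multilin_MM_def multilin_M_def hochschild_dual_def)
qed

lemma multilin_shuffle_dual: "multilin_M F \<Longrightarrow> multilin_MM (shuffle_dual F)"
  unfolding multilin_M_def multilin_MM_def shuffle_dual_def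
  using multilin_shuffle_left multilin_shuffle_right lin_shuffle[of sM "\<lambda>m zs. F (m, zs)"] by auto

end

section \<open>Reduced words of shuffles\<close>

context braiding
begin

text \<open>Places are counted from 0, so index \<open>i\<close> transposes \<sigma>_(i+1). The
  value 0 on short tuples follows the convention of \<open>act_at\<close>.\<close>

definition sigma_dual :: "nat \<Rightarrow> ('a list \<Rightarrow> 'k) \<Rightarrow> 'a list \<Rightarrow> 'k" where
  "sigma_dual i F xs = (if i + 2 \<le> length xs
     then S (\<lambda>u v. F (take i xs @ u # v # drop (i + 2) xs)) (xs ! i) (xs ! (i + 1)) else 0)"

text \<open>Transposition reverses composition: the head of the word acts last on tensors and is
  therefore applied first to the function.\<close>

primrec word_dual :: "nat list \<Rightarrow> ('a list \<Rightarrow> 'k) \<Rightarrow> 'a list \<Rightarrow> 'k" where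
  "word_dual [] F = F"
| "word_dual (i # is) F = word_dual is (sigma_dual (i - 1) F)"

lemma sigma_dual_0_Cons [simp]: "sigma_dual 0 F (a # b # zs) = S (\<lambda>u v. F (u # v # zs)) a b"
  by (simp add: sigma_dual_def)

lemma sigma_dual_Suc_Cons [simp]: "sigma_dual (Suc i) F (x # zs) = sigma_dual i (\<lambda>w. F (x # w)) zs"
  by (simp add: sigma_dual_def)

text \<open>Bilinearity is a premise because the lemma also serves to establish the laws of
  \<open>multiplicative_braiding\<close>.\<close>

lemma multilin_sigma_dual:
  assumes bil: "\<And>G. bilin G \<Longrightarrow> bilin (S G)" and F: "multilin sA F"
  shows "multilin sA (sigma_dual i F)"
proof -
  have linS: "lin sA (\<lambda>x. S (H x) a b)" if "\<And>u v. lin sA (\<lambda>x. H x u v)" for H a b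
    unfolding S_def using that by (intro lin_ev)
  have "lin sA (\<lambda>a. sigma_dual i F (us @ a # vs))" for us vs
    using F
  proof (induction us arbitrary: i F)
    case Nil
    show ?case
    proof (cases i)
      case 0
      have "bilin (\<lambda>u v. F (u # v # zs))" for zs
        using multilin_lin[OF Nil, of "[]"] multilin_lin[OF Nil, of "[_]"] by (simp add: bilin_def)
      from bil[OF this] show ?thesis
        by (cases vs) (simp_all add: 0 bilin_def sigma_dual_def)
    next
      case (Suc j)
      then show ?thesis
        using multilin_lin_Cons[OF Nil] by (auto simp: sigma_dual_def[of j] intro!: lin_if linS)
    qed
  next
    case (Cons u us)
    show ?case
    proof (cases i)
      case 0
      show ?thesis
      proof (cases us)
        case Nil
        have "bilin (\<lambda>u v. F (u # v # zs))" for zs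
          using multilin_lin[OF Cons.prems, of "[]"] multilin_lin[OF Cons.prems, of "[_]"]
          by (simp add: bilin_def)
        from bil[OF this] show ?thesis by (simp add: 0 Nil bilin_def)
      next
        case (Cons u' us')
        have "lin sA (\<lambda>a. F (x # y # us' @ a # vs))" for x y
          using multilin_lin[OF Cons.prems, of "x # y # us'"] by simp
        then show ?thesis by (simp add: 0 Cons linS)
      qed
    next
      case (Suc j)
      then show ?thesis using Cons.IH[OF multilin_Cons[OF Cons.prems]] by simp
    qed
  qed
  then show ?thesis by (simp add: multilin_def)
qed

lemma multilin_word_dual:
  "(\<And>G. bilin G \<Longrightarrow> bilin (S G)) \<Longrightarrow> multilin sA F \<Longrightarrow> multilin sA (word_dual is F)"
  by (induction "is" arbitrary: F) (simp_all add: multilin_sigma_dual)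

lemma word_dual_append: "word_dual (is @ js) F = word_dual js (word_dual is F)"
  by (induction "is" arbitrary: F) simp_all

lemma word_dual_Suc_Cons: "0 \<notin> set is \<Longrightarrow> word_dual (map Suc is) F (x # zs) = word_dual is (\<lambda>w. F (x # w)) zs"
proof (induction "is" arbitrary: F)
  case (Cons i "is")
  then obtain j where "i = Suc j" by (cases i) auto
  then show ?case using Cons by simp
qed simp

text \<open>Identifies a word in the definition of \<open>rho\<close> with a crossing. Its head
  \<sigma>_1 deals with \<open>x\<close> after the shifted word has moved \<open>c\<close> across
  \<open>xs\<close>.\<close>

lemma word_dual_L: "word_dual [1..<length xs + 1] F (xs @ [c]) = L xs c (\<lambda>c w. F (c # w))"
proof (induction xs arbitrary: F)
  case (Cons x xs)
  have "[1..<length (x # xs) + 1] = 1 # map Suc [1..<length xs + 1]"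
    by (simp add: map_Suc_upt upt_conv_Cons del: upt_Suc)
  then have eq: "word_dual [1..<length (x # xs) + 1] F ((x # xs) @ [c])
      = word_dual [1..<length xs + 1] (\<lambda>w. sigma_dual 0 F (x # w)) (xs @ [c])"
    by (simp add: word_dual_Suc_Cons del: upt_Suc)
  show ?case unfolding eq Cons.IH by (simp add: L_Cons)
qed simp

lemma word_dual_R: "word_dual (rev [1..<length ys + 1]) F (a # ys) = R a ys (\<lambda>w a'. F (w @ [a']))"
proof (induction ys arbitrary: a F)
  case (Cons y ys)
  have "rev [1..<length (y # ys) + 1] = map Suc (rev [1..<length ys + 1]) @ [1]"
    by (simp add: rev_map[symmetric] map_Suc_upt upt_conv_Cons del: upt_Suc)
  then have eq: "word_dual (rev [1..<length (y # ys) + 1]) F (a # y # ys)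
      = S (\<lambda>u v. word_dual (rev [1..<length ys + 1]) (\<lambda>w. F (u # w)) (v # ys)) a y"
    by (simp add: word_dual_append word_dual_Suc_Cons del: upt_Suc)
  show ?case unfolding eq Cons.IH by (simp add: R_Cons)
qed simp

lemma word_sum_initial:
  "ev F (word_sum (replicate (length xs) True @ replicate (length ys) False) xs ys) = F (xs @ ys)"
proof (induction xs arbitrary: F)
  case Nil
  show ?case by (induction ys arbitrary: F) simp_all
qed simp

text \<open>Creating an adjacent inversion adds one \<sigma>, acting last at that place. Behind the
  common prefix, the entry of \<open>ys\<close> crosses the leading entry of \<open>xs\<close> last,
  and the later outputs are formed from other factors.\<close>

lemma word_sum_swap:
  assumes "e1 @ True # False # e2 \<in> words (length xs) (length ys)"
  shows "ev F (word_sum (e1 @ False # True # e2) xs ys)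
    = ev (sigma_dual (length e1) F) (word_sum (e1 @ True # False # e2) xs ys)"
  using assms
proof (induction e1 arbitrary: xs ys F)
  case Nil
  then obtain x xs' y ys' where "xs = x # xs'" "ys = y # ys'"
    by (cases xs; cases ys) (auto simp: words_def)
  then show ?case
    by (simp add: S_def) (rule ev_cong, rule ev_swap)
next
  case (Cons b e1)
  show ?case
  proof (cases b)
    case True
    have "e1 @ True # False # e2 \<in> words (length (tl xs)) (length ys)"
      using Cons.prems True by (auto simp: words_def)
    from Cons.IH[OF this] show ?thesis using True by simp
  next
    case False
    have "e1 @ True # False # e2 \<in> words (length w) (length (tl ys))" if "length w = length xs" for w :: "'a list"
      using Cons.prems False that by (auto simp: words_def)
    note IH = Cons.IH[OF this]
    show ?thesis
      using False by simp (rule ev_cong, rule IH, erule length_left_sum)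
  qed
qed

end

section \<open>Shuffle permutations and two-letter words\<close>

primrec inversions :: "bool list \<Rightarrow> nat" where
  "inversions [] = 0"
| "inversions (b # e) = (if b then 0 else count_list e True) + inversions e"

lemma word_sign_inversions: "word_sign e = (-1) ^ inversions e"
  by (induction e) (simp_all add: power_add)

lemma inversions_swap:
  "inversions (e1 @ False # True # e2) = Suc (inversions (e1 @ True # False # e2))"
  by (induction e1) simp_all

lemma inversions_0:
  "inversions e = 0 \<Longrightarrow> e = replicate (count_list e True) True @ replicate (count_list e False) False"
proof (induction e)
  case (Cons b e)
  show ?case
  proof (cases b)
    case False
    with Cons.prems have "count_list e True = 0" by simp
    with Cons False show ?thesis by simp
  qed (use Cons in simp)
qed simp

lemma inversions_Suc:
  assumes "inversions e \<noteq> 0"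
  obtains e1 e2 where "e = e1 @ False # True # e2"
  using assms
proof (induction e arbitrary: thesis)
  case (Cons b e)
  show ?case
  proof (cases "inversions e = 0")
    case False
    then obtain e1 e2 where "e = e1 @ False # True # e2" using Cons.IH by blast
    then show ?thesis using Cons.prems(1)[of "b # e1" e2] by simp
  next
    case True
    with Cons.prems(2) have "\<not> b" "count_list e True \<noteq> 0" by (auto split: if_splits)
    with inversions_0[OF True] obtain e' where "e = True # e'"
      by (cases "count_list e True") auto
    then show ?thesis using Cons.prems(1)[of "[]" e'] \<open>\<not> b\<close> by simp
  qed
qed simp

text \<open>A permutation sends input places to output places, so the origin of an output is found
  with the inverse.\<close>

definition perm_word :: "nat \<Rightarrow> nat \<Rightarrow> (nat \<Rightarrow> nat) \<Rightarrow> bool list" where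
  "perm_word p n w = map (\<lambda>i. inv w i \<le> p) [1..<Suc n]"

lemma length_perm_word [simp]: "length (perm_word p n w) = n"
  by (simp add: perm_word_def)

lemma nth_perm_word: "i < n \<Longrightarrow> perm_word p n w ! i = (inv w (Suc i) \<le> p)"
  by (simp add: perm_word_def del: upt_Suc)

lemma perm_word_id: "perm_word p (p + q) id = replicate p True @ replicate q False"
  by (rule nth_equalityI) (auto simp: nth_perm_word nth_append)

lemma word_perm_Nil [simp]: "word_perm [] = id"
  by (simp add: word_perm_def)

lemma word_perm_Cons: "word_perm (i # is) = Transposition.transpose i (i + 1) \<circ> word_perm is"
  by (simp add: word_perm_def)

lemma word_perm_permutes: "set is \<subseteq> {1..<n} \<Longrightarrow> word_perm is permutes {1..n}"
proof (induction "is")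
  case (Cons i "is")
  then show ?case unfolding word_perm_Cons
    by (intro permutes_compose permutes_swap_id) auto
qed (simp only: word_perm_Nil permutes_id)

lemma sign_word_perm: "set is \<subseteq> {1..<n} \<Longrightarrow> sign (word_perm is) = (-1) ^ length is"
proof (induction "is")
  case (Cons i "is")
  have "permutation (word_perm is)"
    using word_perm_permutes[of "is" n] Cons.prems permutation_permutes by auto
  then have "sign (word_perm (i # is)) = sign (Transposition.transpose i (i + 1)) * sign (word_perm is)"
    unfolding word_perm_Cons by (intro sign_compose permutation_swap_id)
  then show ?case using Cons by (simp add: sign_swap_id)
qed (simp only: word_perm_Nil sign_id, simp)

lemma split_list_at: "Suc k < length e \<Longrightarrow> e = take k e @ e ! k # e ! Suc k # drop (Suc (Suc k)) e"
  by (metis Cons_nth_drop_Suc Suc_lessD append_take_drop_id)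

text \<open>Composing on the left with a transposition permutes output places, hence exchanges two
  neighbouring letters.\<close>

lemma perm_word_transpose:
  assumes w: "w permutes {1..n}" and i: "i \<in> {1..<n}"
    and e: "perm_word p n w = e1 @ a # b # e2" "length e1 = i - 1"
  shows "perm_word p n (Transposition.transpose i (i + 1) \<circ> w) = e1 @ b # a # e2"
proof (rule nth_equalityI)
  have len: "n = length e1 + 2 + length e2" 
    using arg_cong[OF e(1), of length] by simp
  then show "length (perm_word p n (Transposition.transpose i (i + 1) \<circ> w)) = length (e1 @ b # a # e2)"
    by simp
  have inv: "inv (Transposition.transpose a b \<circ> w) = inv w \<circ> Transposition.transpose a b" for a b
    by (subst o_inv_distrib) (simp_all add: permutes_bij[OF w])
  fix k assume "k < length (perm_word p n (Transposition.transpose i (i + 1) \<circ> w))"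
  then have k: "k < n" by simp
  have old: "inv w (Suc j) \<le> p \<longleftrightarrow> (e1 @ a # b # e2) ! j" if "j < n" for j
    using nth_perm_word[OF that, of p w] e(1) by simp
  have "i = Suc (length e1)" using e(2) i by auto
  consider "k = length e1" | "k = Suc (length e1)" | "k \<noteq> length e1" "k \<noteq> Suc (length e1)" by blast
  then show "perm_word p n (Transposition.transpose i (i + 1) \<circ> w) ! k = (e1 @ b # a # e2) ! k"
  proof cases
    case 1
    then show ?thesis
      using old[of "Suc (length e1)"] len k \<open>i = _\<close> by (simp add: nth_perm_word inv nth_append)
  next
    case 2
    then show ?thesis
      using old[of "length e1"] len k \<open>i = _\<close> by (simp add: nth_perm_word inv nth_append)
  next
    case 3
    then have "Transposition.transpose i (i + 1) (Suc k) = Suc k"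
      using \<open>i = _\<close> by (auto simp: transpose_def)
    moreover have "(e1 @ b # a # e2) ! k = (e1 @ a # b # e2) ! k"
      using 3 by (auto simp: nth_append nth_Cons split: nat.splits)
    ultimately show ?thesis using old[OF k] k by (simp add: nth_perm_word inv)
  qed
qed

lemma perm_word_in_words:
  assumes "w permutes {1..p + q}"
  shows "perm_word p (p + q) w \<in> words p q"
proof -
  have b: "bij w" using assms by (rule permutes_bij)
  have *: "count_list (perm_word p (p + q) w) c = card {i \<in> {1..p + q}. (inv w i \<le> p) = c}" for c
  proof -
    have "count_list (perm_word p (p + q) w) c = length (filter (\<lambda>i. (inv w i \<le> p) = c) [1..<Suc (p + q)])"
      by (simp add: perm_word_def count_list_eq_length_filter filter_map comp_def eq_commute[of c] del: upt_Suc)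
    also have "\<dots> = card (set (filter (\<lambda>i. (inv w i \<le> p) = c) [1..<Suc (p + q)]))"
      by (rule distinct_card[symmetric]) (simp del: upt_Suc)
    also have "set (filter (\<lambda>i. (inv w i \<le> p) = c) [1..<Suc (p + q)]) = {i \<in> {1..p + q}. (inv w i \<le> p) = c}"
      by auto
    finally show ?thesis .
  qed
  have "{i \<in> {1..p + q}. inv w i \<le> p} = w ` {1..p}"
  proof (intro set_eqI iffI)
    fix i assume "i \<in> {i \<in> {1..p + q}. inv w i \<le> p}"
    then have "inv w i \<in> {1..p}" "w (inv w i) = i"
      using permutes_in_image[OF permutes_inv[OF assms], of i] permutes_inverses[OF assms] by auto
    then show "i \<in> w ` {1..p}" by (metis imageI)
  next
    fix i assume "i \<in> w ` {1..p}"
    then obtain j where "i = w j" "j \<in> {1..p}" by blast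
    then show "i \<in> {i \<in> {1..p + q}. inv w i \<le> p}"
      using permutes_in_image[OF assms, of j] permutes_inverses[OF assms] by auto
  qed
  moreover have "inj_on w {1..p}" using b by (auto simp: bij_def intro: inj_on_subset)
  ultimately have T: "count_list (perm_word p (p + q) w) True = p"
    by (simp add: * card_image)
  then show ?thesis
    using length_count_bool[of "perm_word p (p + q) w"] by (simp add: words_def)
qed

text \<open>The word determines the image of each block, and an increasing map is determined by its
  image.\<close>

lemma perm_word_inj:
  assumes w: "w \<in> shuffle_perms p n" "w' \<in> shuffle_perms p n"
    and eq: "perm_word p n w = perm_word p n w'"
  shows "w = w'"
proof
  fix j
  have P: "w permutes {1..n}" "w' permutes {1..n}"
    using w by (auto simp: shuffle_perms_def)
  have inv_eq: "inv w i \<le> p \<longleftrightarrow> inv w' i \<le> p" if "i \<in> {1..n}" for i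
    using nth_perm_word[of "i - 1" n p w] nth_perm_word[of "i - 1" n p w'] that eq by auto
  have img: "v ` {a \<in> {1..n}. Q a} = {i \<in> {1..n}. Q (inv v i)}" if v: "v permutes {1..n}" for v and Q :: "nat \<Rightarrow> bool"
  proof (intro set_eqI iffI)
    fix i assume i: "i \<in> {i \<in> {1..n}. Q (inv v i)}"
    then have "inv v i \<in> {1..n}" "v (inv v i) = i"
      using permutes_in_image[OF permutes_inv[OF v], of i] permutes_inverses[OF v] by auto
    with i show "i \<in> v ` {a \<in> {1..n}. Q a}" by (metis (mono_tags, lifting) imageI mem_Collect_eq)
  next
    fix i assume "i \<in> v ` {a \<in> {1..n}. Q a}"
    then obtain j where "i = v j" "j \<in> {1..n}" "Q j" by blast
    then show "i \<in> {i \<in> {1..n}. Q (inv v i)}"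
      using permutes_in_image[OF v, of j] permutes_inverses[OF v] by auto
  qed
  \<comment> \<open>Both maps list the common image in increasing order.\<close>
  have uniq: "f x = g x" if "strict_mono_on A f" "strict_mono_on A g" "f ` A = g ` A" "x \<in> A"
    "finite A" for f g :: "nat \<Rightarrow> nat" and A x
  proof -
    have s: "sorted (map f (sorted_list_of_set A))" if f: "strict_mono_on A f" for f :: "nat \<Rightarrow> nat"
      unfolding sorted_map
      by (rule sorted_wrt_mono_rel[OF _ sorted_sorted_list_of_set])
        (use strict_mono_on_leD[OF f] \<open>finite A\<close> in auto)
    have d: "distinct (map f (sorted_list_of_set A))" if "strict_mono_on A f" for f :: "nat \<Rightarrow> nat"
      using strict_mono_on_imp_inj_on[OF that] \<open>finite A\<close> by (simp add: distinct_map)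
    have "map f (sorted_list_of_set A) = map g (sorted_list_of_set A)"
      by (rule sorted_distinct_set_unique) (use that in \<open>simp_all add: s d\<close>)
    then show ?thesis using that by auto
  qed
  show "w j = w' j"
  proof (cases "j \<in> {1..n}")
    case False
    then show ?thesis using P by (simp add: permutes_def)
  next
    case True
    have le: "w ` {a \<in> {1..n}. a \<le> p} = w' ` {a \<in> {1..n}. a \<le> p}"
      unfolding img[OF P(1)] img[OF P(2)] using inv_eq by blast
    have gt: "w ` {a \<in> {1..n}. \<not> a \<le> p} = w' ` {a \<in> {1..n}. \<not> a \<le> p}"
      unfolding img[OF P(1)] img[OF P(2)] using inv_eq by blast
    have sub: "{a \<in> {1..n}. a \<le> p} \<subseteq> {1..p}" "{a \<in> {1..n}. \<not> a \<le> p} \<subseteq> {p+1..n}" by auto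
    have m: "strict_mono_on {a \<in> {1..n}. a \<le> p} v" "strict_mono_on {a \<in> {1..n}. \<not> a \<le> p} v"
      if "v \<in> shuffle_perms p n" for v
      using that sub by (auto simp: shuffle_perms_def intro: monotone_on_subset)
    show ?thesis
    proof (cases "j \<le> p")
      case j: True
      show ?thesis by (rule uniq[OF m(1)[OF w(1)] m(1)[OF w(2)] le]) (use j True in auto)
    next
      case j: False
      show ?thesis by (rule uniq[OF m(2)[OF w(1)] m(2)[OF w(2)] gt]) (use j True in auto)
    qed
  qed
qed

text \<open>The transposition reverses the order of \<open>i\<close> and \<open>i + 1\<close> only,
  and these two values come from different blocks.\<close>

lemma shuffle_perms_transpose:
  assumes w: "w \<in> shuffle_perms p n" and i: "i \<in> {1..<n}"
    and "inv w i \<le> p" "\<not> inv w (i + 1) \<le> p"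
  shows "Transposition.transpose i (i + 1) \<circ> w \<in> shuffle_perms p n"
proof -
  let ?t = "Transposition.transpose i (i + 1)"
  have P: "w permutes {1..n}" using w by (simp add: shuffle_perms_def)
  have inv: "inv w (w a) = a" for a using permutes_inverses[OF P] by simp
  have lt: "?t x < ?t y" if "x < y" "\<not> (x = i \<and> y = i + 1)" for x y
    using that by (auto simp: transpose_def)
  have "?t \<circ> w permutes {1..n}"
    using i by (intro permutes_compose[OF P] permutes_swap_id) auto
  moreover have "strict_mono_on {1..p} (?t \<circ> w)"
  proof (rule strict_mono_onI)
    fix a b assume ab: "a \<in> {1..p}" "b \<in> {1..p}" "a < b"
    have "w a < w b" by (rule strict_mono_onD[of "{1..p}"]) (use w ab in \<open>simp_all add: shuffle_perms_def\<close>)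
    moreover have "w b \<noteq> i + 1" using inv[of b] ab assms(4) by auto
    ultimately show "(?t \<circ> w) a < (?t \<circ> w) b" using lt by simp
  qed
  moreover have "strict_mono_on {p+1..n} (?t \<circ> w)"
  proof (rule strict_mono_onI)
    fix a b assume ab: "a \<in> {p+1..n}" "b \<in> {p+1..n}" "a < b"
    have "w a < w b" by (rule strict_mono_onD[of "{p+1..n}"]) (use w ab in \<open>simp_all add: shuffle_perms_def\<close>)
    moreover have "w a \<noteq> i" using inv[of a] ab assms(3) by auto
    ultimately show "(?t \<circ> w) a < (?t \<circ> w) b" using lt by simp
  qed
  ultimately show ?thesis by (simp add: shuffle_perms_def)
qed

text \<open>Adjacent inversions are undone one at a time, each costing one letter. This shows that
  every two-letter word comes from a shuffle and gives a word of the least length that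
  \<open>inversions_le_length\<close> permits.\<close>

lemma word_of_shuffle:
  assumes "e \<in> words p q"
  obtains "is" where "set is \<subseteq> {1..<p + q}" "length is = inversions e"
    "perm_word p (p + q) (word_perm is) = e" "word_perm is \<in> shuffle_perms p (p + q)"
  using assms
proof (induction "inversions e" arbitrary: e thesis)
  case 0
  then have "e = replicate p True @ replicate q False"
    using inversions_0[of e] by (simp add: words_def)
  moreover have "id \<in> shuffle_perms p (p + q)"
    by (simp add: shuffle_perms_def permutes_id strict_mono_on_def)
  ultimately show ?case
    using "0.hyps" by (intro "0.prems"(1)[of "[]"]) (simp_all only: word_perm_Nil perm_word_id, simp_all)
next
  case (Suc k)
  then have "inversions e \<noteq> 0" by simp
  then obtain e1 e2 where e: "e = e1 @ False # True # e2" by (rule inversions_Suc)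
  define e' where "e' = e1 @ True # False # e2"
  have "k = inversions e'" using Suc.hyps(2) by (simp add: e e'_def inversions_swap)
  moreover have "e' \<in> words p q" using Suc.prems(2) by (simp add: e e'_def words_def)
  ultimately obtain "is" where IH: "set is \<subseteq> {1..<p + q}" "length is = inversions e'"
    "perm_word p (p + q) (word_perm is) = e'" "word_perm is \<in> shuffle_perms p (p + q)"
    using Suc.hyps(1) by blast
  define i where "i = Suc (length e1)"
  have n: "p + q = length e1 + 2 + length e2" 
    using Suc.prems(2) length_count_bool[of e] by (simp add: e words_def)
  have i: "i \<in> {1..<p + q}" using n by (simp add: i_def)
  have "inv (word_perm is) i \<le> p" "\<not> inv (word_perm is) (i + 1) \<le> p"
    using nth_perm_word[of "length e1" "p + q" p "word_perm is"]
      nth_perm_word[of "Suc (length e1)" "p + q" p "word_perm is"] n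
    unfolding IH(3) by (simp_all add: i_def e'_def nth_append)
  then have "word_perm (i # is) \<in> shuffle_perms p (p + q)"
    unfolding word_perm_Cons by (intro shuffle_perms_transpose IH(4) i)
  moreover have "perm_word p (p + q) (word_perm (i # is)) = e"
    unfolding word_perm_Cons e
    by (rule perm_word_transpose[OF word_perm_permutes[OF IH(1)] i])
      (simp_all add: IH(3) e'_def i_def)
  ultimately show ?case
    using Suc.prems(1)[of "i # is"] IH i \<open>k = _\<close> Suc.hyps(2) by simp
qed

text \<open>The identity has no inversions, and each letter changes their number by at most
  one.\<close>

lemma inversions_le_length:
  "set is \<subseteq> {1..<p + q} \<Longrightarrow> inversions (perm_word p (p + q) (word_perm is)) \<le> length is"
proof (induction "is")
  case Nil
  have "inversions (replicate p True @ replicate q False) = 0"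
    by (induction p; induction q) simp_all
  then show ?case by (simp only: word_perm_Nil perm_word_id)
next
  case (Cons i "is")
  define e where "e = perm_word p (p + q) (word_perm is)"
  have i: "i \<in> {1..<p + q}" and "is": "set is \<subseteq> {1..<p + q}" using Cons.prems by auto
  obtain e1 a b e2 where e': "e = e1 @ a # b # e2" "length e1 = i - 1"
    using split_list_at[of "i - 1" e] i by (auto simp: e_def)
  have "perm_word p (p + q) (word_perm (i # is)) = e1 @ b # a # e2"
    unfolding word_perm_Cons
    by (rule perm_word_transpose[OF word_perm_permutes[OF "is"] i]) (use e' in \<open>simp_all add: e_def\<close>)
  moreover have "inversions (e1 @ b # a # e2) \<le> Suc (inversions (e1 @ a # b # e2))"
    by (cases a; cases b) (simp_all add: inversions_swap)
  ultimately show ?case using Cons.IH[OF "is"] e' by (simp add: e_def)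
qed

text \<open>The choice in \<open>T_sigma\<close> ranges over a nonempty set: the word from
  \<open>word_of_shuffle\<close> is shortest by \<open>inversions_le_length\<close>, and it
  represents \<open>w\<close> by \<open>perm_word_inj\<close>.\<close>

lemma shuffle_word:
  assumes w: "w \<in> shuffle_perms p (p + q)" and is_def: "is = (SOME is. is \<in> reduced_words (p + q) w)"
  shows "set is \<subseteq> {1..<p + q}" "word_perm is = w" "length is = inversions (perm_word p (p + q) w)"
proof -
  have "perm_word p (p + q) w \<in> words p q"
    using w by (intro perm_word_in_words) (simp add: shuffle_perms_def)
  then obtain js where js: "set js \<subseteq> {1..<p + q}" "length js = inversions (perm_word p (p + q) w)"
    "perm_word p (p + q) (word_perm js) = perm_word p (p + q) w" "word_perm js \<in> shuffle_perms p (p + q)"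
    by (rule word_of_shuffle)
  have js_w: "word_perm js = w"
    by (rule perm_word_inj[OF js(4) w js(3)])
  have "length js \<le> length ks" if "set ks \<subseteq> {1..<p + q}" "word_perm ks = w" for ks
    using inversions_le_length[of ks p q] that js by simp
  then have "js \<in> reduced_words (p + q) w"
    using js js_w by (auto simp: reduced_words_def)
  then have "is \<in> reduced_words (p + q) w" unfolding is_def by (rule someI)
  then show *: "set is \<subseteq> {1..<p + q}" "word_perm is = w"
    by (auto simp: reduced_words_def)
  have "length is \<le> length js"
    using \<open>is \<in> _\<close> js js_w by (auto simp: reduced_words_def)
  then show "length is = inversions (perm_word p (p + q) w)"
    using inversions_le_length[OF *(1)] * js by simp
qed

context braiding
begin

text \<open>A word whose length is the number of inversions of the shuffle raises that number by one at each
  letter, so each letter moves an entry of \<open>ys\<close> past an entry of \<open>xs\<close>.  In particular the operator of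
  a reduced word depends on the shuffle only.\<close>

lemma word_dual_word_sum:
  assumes "set is \<subseteq> {1..<length xs + length ys}"
    and "length is = inversions (perm_word (length xs) (length xs + length ys) (word_perm is))"
  shows "word_dual is F (xs @ ys)
    = ev F (word_sum (perm_word (length xs) (length xs + length ys) (word_perm is)) xs ys)"
  using assms
proof (induction "is" arbitrary: F)
  case Nil
  then show ?case by (simp only: word_perm_Nil perm_word_id word_sum_initial word_dual.simps)
next
  case (Cons i "is")
  let ?p = "length xs" and ?q = "length ys"
  define e where "e = perm_word ?p (?p + ?q) (word_perm is)"
  have i: "i \<in> {1..<?p + ?q}" and "is": "set is \<subseteq> {1..<?p + ?q}" using Cons.prems by auto
  obtain e1 a b e2 where e': "e = e1 @ a # b # e2" "length e1 = i - 1"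
    using split_list_at[of "i - 1" e] i by (auto simp: e_def)
  have eq: "perm_word ?p (?p + ?q) (word_perm (i # is)) = e1 @ b # a # e2"
    unfolding word_perm_Cons
    by (rule perm_word_transpose[OF word_perm_permutes[OF "is"] i]) (use e' in \<open>simp_all add: e_def\<close>)
  have le: "inversions e \<le> length is"
    unfolding e_def by (rule inversions_le_length[OF "is"])
  have len: "Suc (length is) = inversions (e1 @ b # a # e2)"
    using Cons.prems(2) eq by simp
  have ab: "a" "\<not> b"
    using le len e' by (cases a; cases b; simp add: inversions_swap)+
  have "length is = inversions e"
    using len ab by (simp add: e' inversions_swap)
  then have "word_dual is (sigma_dual (i - 1) F) (xs @ ys) = ev (sigma_dual (i - 1) F) (word_sum e xs ys)"
    using Cons.IH[OF "is"] by (simp add: e_def)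
  also have "\<dots> = ev F (word_sum (e1 @ b # a # e2) xs ys)"
    using perm_word_in_words[OF word_perm_permutes[OF "is"]] ab e' word_sum_swap[of e1 e2 xs ys F]
    by (simp add: e_def)
  finally show ?case by (simp add: eq)
qed

text \<open>Passes from the sum over permutations to the sum over two-letter words along the
  bijection \<open>perm_word\<close>. The signs agree because a reduced word has as many letters as
  there are inversions.\<close>

lemma sum_shuffle_perms:
  assumes "p = length xs" "n = length xs + length ys"
  shows "(\<Sum>w\<in>shuffle_perms p n. of_int (sign w) * word_dual (SOME is. is \<in> reduced_words n w) F (xs @ ys))
    = shuffle xs ys F"
proof -
  define q where "q = length ys"
  have n: "n = p + q" using assms by (simp add: q_def)
  have bij: "bij_betw (perm_word p n) (shuffle_perms p n) (words p q)"
    unfolding bij_betw_def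
  proof (intro conjI inj_onI set_eqI iffI)
    fix e assume "e \<in> perm_word p n ` shuffle_perms p n"
    then show "e \<in> words p q"
      using perm_word_in_words by (auto simp: n shuffle_perms_def)
  next
    fix e assume "e \<in> words p q"
    then show "e \<in> perm_word p n ` shuffle_perms p n"
      by (rule word_of_shuffle) (auto simp: n)
  qed (rule perm_word_inj)
  have "of_int (sign w) * word_dual (SOME is. is \<in> reduced_words n w) F (xs @ ys)
      = word_sign (perm_word p n w) * ev F (word_sum (perm_word p n w) xs ys)"
    if w: "w \<in> shuffle_perms p n" for w
  proof -
    define "is" where "is = (SOME is. is \<in> reduced_words n w)"
    note "is" = shuffle_word[OF w[unfolded n] is_def[unfolded n]]
    note len = "is"(3)
    have "word_dual is F (xs @ ys) = ev F (word_sum (perm_word p n w) xs ys)"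
      using word_dual_word_sum[of "is" xs ys F] "is" len by (simp add: n assms(1) q_def)
    moreover have "(of_int (sign w) :: 'k) = word_sign (perm_word p n w)"
      using sign_word_perm[OF "is"(1)] by (simp add: n "is"(2) len word_sign_inversions)
    ultimately show ?thesis by (simp add: is_def)
  qed
  then have "(\<Sum>w\<in>shuffle_perms p n. of_int (sign w) * word_dual (SOME is. is \<in> reduced_words n w) F (xs @ ys))
      = (\<Sum>w\<in>shuffle_perms p n. word_sign (perm_word p n w) * ev F (word_sum (perm_word p n w) xs ys))"
    by (rule sum.cong[OF refl])
  also have "\<dots> = (\<Sum>e\<in>words p q. word_sign e * ev F (word_sum e xs ys))"
    by (rule sum.reindex_bij_betw[OF bij])
  finally show ?thesis by (simp add: shuffle_sum assms(1) q_def)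
qed

end

section \<open>The chain morphism\<close>

lemma ev_rep_qadd: "annihilates R F \<Longrightarrow> ev F (rep (qadd R X Y)) = ev F (rep X) + ev F (rep Y)"
  by (simp add: qadd_def)

lemma ev_rep_qscale: "annihilates R F \<Longrightarrow> ev F (rep (qscale R c X)) = c * ev F (rep X)"
  by (simp add: qscale_def)

lemma pure_add:
  assumes "\<And>F. annihilates R F \<Longrightarrow> lin sc (\<lambda>v. F (g v))"
  shows "pure R (g (u + v)) = qadd R (pure R (g u)) (pure R (g v))"
proof (rule quot_eqI[of _ R])
  fix F assume F: "annihilates R F"
  show "ev F (rep (pure R (g (u + v)))) = ev F (rep (qadd R (pure R (g u)) (pure R (g v))))"
    using assms[OF F] F by (simp add: ev_rep_qadd lin_def)
qed (auto simp: qadd_def)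

lemma pure_scale:
  assumes "\<And>F. annihilates R F \<Longrightarrow> lin sc (\<lambda>v. F (g v))"
  shows "pure R (g (sc c v)) = qscale R c (pure R (g v))"
proof (rule quot_eqI[of _ R])
  fix F assume F: "annihilates R F"
  show "ev F (rep (pure R (g (sc c v)))) = ev F (rep (qscale R c (pure R (g v))))"
    using assms[OF F] F by (simp add: ev_rep_qscale lin_def)
qed (auto simp: qscale_def)

text \<open>The choice is restricted to combinations of pairs: an arbitrary representative may also
  contain relations between tuples of other lengths, which cannot be read as pairs.\<close>

definition pairs_of :: "('k::field \<Rightarrow> 'a \<Rightarrow> 'a) \<Rightarrow> (('a::ab_group_add list, 'k) free set \<Rightarrow> ('a list, 'k) free set)
    \<Rightarrow> 'a \<Rightarrow> 'a \<Rightarrow> ('a \<times> 'a, 'k) free" where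
  "pairs_of sA \<sigma> a b = extend (\<lambda>zs. gen (zs ! 0, zs ! 1))
    (SOME p. (\<forall>zs\<in>Poly_Mapping.keys p. length zs = 2) \<and> coset (T_rel sA) p = \<sigma> (pure (T_rel sA) [a, b]))"

lemma ev_rep_sigma:
  assumes \<sigma>: "linear_from_to (T_rel sA) (tensor_power sA 2) (T_rel sA) (tensor_power sA 2) \<sigma>"
    and F: "multilin sA F"
  shows "ev F (rep (\<sigma> (pure (T_rel sA) [a, b]))) = ev (\<lambda>t. F [fst t, snd t]) (pairs_of sA \<sigma> a b)"
proof -
  let ?P = "\<lambda>p. (\<forall>zs\<in>Poly_Mapping.keys p. length zs = 2) \<and> coset (T_rel sA) p = \<sigma> (pure (T_rel sA) [a, b])"
  define p where "p = (SOME p. ?P p)"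
  have "pure (T_rel sA) [a, b] \<in> tensor_power sA 2"
    using pure_in_part[of "T_rel sA" "[a, b]" length] by (simp add: numeral_2_eq_2)
  then have "\<sigma> (pure (T_rel sA) [a, b]) \<in> tensor_power sA 2"
    using \<sigma> by (auto simp: linear_from_to_def)
  then have "\<exists>p. ?P p" by (auto simp: part_def)
  then have p: "?P p" unfolding p_def by (rule someI_ex)
  have "ev F (rep (\<sigma> (pure (T_rel sA) [a, b]))) = ev F p"
    using p F ev_rep_coset[of "T_rel sA" F p] by (simp add: annihilates_T_rel)
  also have "\<dots> = ev (\<lambda>zs. F [zs ! 0, zs ! 1]) p"
  proof (rule ev_cong)
    fix zs assume "zs \<in> Poly_Mapping.keys p"
    then have "length zs = 2" using p by blast
    then show "F zs = F [zs ! 0, zs ! 1]"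
      by (auto simp: numeral_2_eq_2 length_Suc_conv)
  qed
  finally show ?thesis by (simp add: pairs_of_def p_def)
qed

lemma ev_rep_act_at:
  assumes "multilin sA F"
  shows "ev F (rep (act_at sA 2 f (Suc i) X)) = ev (\<lambda>xs. if i + 2 \<le> length xs
    then ev (\<lambda>zs. F (take i xs @ zs @ drop (i + 2) xs)) (rep (f (pure (T_rel sA) [xs ! i, xs ! (i + 1)])))
    else 0) (rep X)"
proof -
  have *: "take 2 (drop i xs) = [xs ! i, xs ! (i + 1)]" if "i + 2 \<le> length xs" for xs :: "'b list"
    using that by (simp add: numeral_2_eq_2 Cons_nth_drop_Suc[symmetric])
  show ?thesis
    unfolding act_at_def using assms
    by (subst ev_rep_induced) (auto simp: annihilates_T_rel * intro!: ev_cong)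
qed

lemma multilin_subst: "multilin sA F \<Longrightarrow> multilin sA (\<lambda>zs. F (us @ zs @ vs))"
  using multilin_lin[of sA F "us @ _" "_ @ vs"] by (simp add: multilin_def)

text \<open>Multilinearity never compares different lengths, so a form on one length extends by 0.
  This supplies test functions on a single tensor power.\<close>

lemma multilin_length: 
  assumes "\<And>us vs. length us + length vs + 1 = n \<Longrightarrow> lin sA (\<lambda>a. F (us @ a # vs))"
  shows "multilin sA (\<lambda>zs. if length zs = n then F zs else 0)"
  using assms by (auto simp: multilin_def intro!: lin_if)

lemma multilin_1: "lin sA g \<Longrightarrow> multilin sA (\<lambda>zs. if length zs = 1 then g (hd zs) else 0)"
  by (rule multilin_length) simp

lemma (in braiding) multilin_2: "bilin G \<Longrightarrow> multilin sA (\<lambda>zs. if length zs = 2 then G (hd zs) (hd (tl zs)) else 0)"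
proof (rule multilin_length)
  fix us vs :: "'a list" assume "bilin G" "length us + length vs + 1 = 2"
  then show "lin sA (\<lambda>a. G (hd (us @ a # vs)) (hd (tl (us @ a # vs))))"
    by (cases us) (auto simp: bilin_def)
qed

lemma (in unital_algebra) ev_rep_mu:
  assumes F: "multilin sA F"
  shows "ev F (rep (mu sA X)) = ev (\<lambda>xs. if length xs = 2 then F [xs ! 0 * xs ! 1] else 0) (rep X)"
    and "multilin sA (\<lambda>xs. if length xs = 2 then F [xs ! 0 * xs ! 1] else 0)"
proof -
  have *: "ev F (case xs of [a, b] \<Rightarrow> gen [a * b] | _ \<Rightarrow> 0) = (if length xs = 2 then F [xs ! 0 * xs ! 1] else 0)"
    for xs :: "'a list"
    by (auto split: list.splits)
  show "ev F (rep (mu sA X)) = ev (\<lambda>xs. if length xs = 2 then F [xs ! 0 * xs ! 1] else 0) (rep X)"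
    using F by (simp add: mu_def annihilates_T_rel *)
  have l: "lin sA (\<lambda>a. F [a * b])" "lin sA (\<lambda>a. F [b * a])" for b
    using multilin_lin_Cons[OF F, of "[]"]
    by (simp_all add: lin_def scale_mult_left[symmetric] scale_mult_right[symmetric] algebra_simps)
  show "multilin sA (\<lambda>xs. if length xs = 2 then F [xs ! 0 * xs ! 1] else 0)"
  proof (rule multilin_length)
    fix us vs :: "'a list" assume "length us + length vs + 1 = 2"
    then show "lin sA (\<lambda>a. F [(us @ a # vs) ! 0 * (us @ a # vs) ! 1])"
      using l by (cases us; cases vs) auto
  qed
qed

lemma (in unital_algebra) ev_rep_mu_pure:
  assumes F: "multilin sA F"
  shows "ev F (rep (mu sA (pure (T_rel sA) [a, b]))) = F [a * b]"
  using ev_rep_mu(2)[OF F] by (simp add: ev_rep_mu(1)[OF F] annihilates_T_rel)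

locale sigma_algebra = unital_algebra sA
  for sA :: "'k::field \<Rightarrow> 'a::{ring,monoid_mult} \<Rightarrow> 'a" +
  fixes \<sigma> :: "('a list, 'k) free set \<Rightarrow> ('a list, 'k) free set"
  assumes sigma_linear: "linear_from_to (T_rel sA) (tensor_power sA 2) (T_rel sA) (tensor_power sA 2) \<sigma>"
begin

sublocale braiding sA "pairs_of sA \<sigma>" ..

lemma ev_rep_sigma': "multilin sA F \<Longrightarrow> ev F (rep (\<sigma> (pure (T_rel sA) [a, b]))) = S (\<lambda>u v. F [u, v]) a b"
  unfolding S_def by (rule ev_rep_sigma[OF sigma_linear])

text \<open>\<open>pairs_of\<close> is chosen separately for each pair and need not be additive.
  Evaluated at a bilinear function it depends only on the coset, where \<sigma> and
  \<open>pure\<close> are linear in each entry.\<close>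

lemma bilin_S_sigma:
  assumes G: "bilin G"
  shows "bilin (S G)"
proof -
  let ?F = "\<lambda>zs. if length zs = 2 then G (hd zs) (hd (tl zs)) else 0" and ?R = "T_rel sA"
  have F: "multilin sA ?F" by (rule multilin_2[OF G])
  then have annF: "annihilates ?R ?F" by (simp add: annihilates_T_rel)
  have S: "S G a b = ev ?F (rep (\<sigma> (pure ?R [a, b])))" for a b
    by (simp add: ev_rep_sigma'[OF F])
  have in2: "pure ?R [a, b] \<in> tensor_power sA 2" for a b
    using pure_in_part[of ?R "[a, b]" length] by (simp add: numeral_2_eq_2)
  have left: "lin sA (\<lambda>a. H [a, b])" and right: "lin sA (\<lambda>b. H [a, b])" if "annihilates ?R H" for H a b
    using that multilin_lin[of sA H "[]" "[b]"] multilin_lin[of sA H "[a]" "[]"]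
    by (simp_all add: annihilates_T_rel)
  have add: "pure ?R [a + a', b] = qadd ?R (pure ?R [a, b]) (pure ?R [a', b])"
    "pure ?R [b, a + a'] = qadd ?R (pure ?R [b, a]) (pure ?R [b, a'])" for a a' b
    by (rule pure_add[where g = "\<lambda>v. [v, b]"], erule left)
      (rule pure_add[where g = "\<lambda>v. [b, v]"], erule right)
  have scale: "pure ?R [sA c a, b] = qscale ?R c (pure ?R [a, b])"
    "pure ?R [b, sA c a] = qscale ?R c (pure ?R [b, a])" for a b c
    by (rule pure_scale[where g = "\<lambda>v. [v, b]"], erule left)
      (rule pure_scale[where g = "\<lambda>v. [b, v]"], erule right)
  have \<sigma>: "\<sigma> (qadd ?R X Y) = qadd ?R (\<sigma> X) (\<sigma> Y)" "\<sigma> (qscale ?R c X) = qscale ?R c (\<sigma> X)"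
    if "X \<in> tensor_power sA 2" "Y \<in> tensor_power sA 2" for X Y c
    using sigma_linear that unfolding linear_from_to_def by blast+
  have "lin sA (\<lambda>a. S G a b)" for b
    unfolding lin_def S by (simp add: add scale \<sigma>[OF in2 in2] ev_rep_qadd ev_rep_qscale annF)
  moreover have "lin sA (S G a)" for a
    unfolding lin_def S by (simp add: add scale \<sigma>[OF in2 in2] ev_rep_qadd ev_rep_qscale annF)
  ultimately show ?thesis by (simp add: bilin_def)
qed

lemma ev_rep_sigma_at:
  assumes "multilin sA F" "i \<noteq> 0"
  shows "ev F (rep (sigma_at sA \<sigma> i X)) = ev (sigma_dual (i - 1) F) (rep X)"
proof -
  obtain j where "i = Suc j" using assms(2) by (cases i) auto
  then show ?thesis
    unfolding sigma_at_def using assms(1)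
    by (auto simp: ev_rep_act_at ev_rep_sigma' multilin_subst sigma_dual_def intro!: ev_cong)
qed

lemma ev_rep_sigma_word:
  "multilin sA F \<Longrightarrow> 0 \<notin> set is \<Longrightarrow> ev F (rep (sigma_word sA \<sigma> is X)) = ev (word_dual is F) (rep X)"
  by (induction "is" arbitrary: F) (simp_all add: sigma_word_def ev_rep_sigma_at multilin_sigma_dual bilin_S_sigma)

lemma ev_rep_sigma_word_pure:
  "multilin sA F \<Longrightarrow> 0 \<notin> set is \<Longrightarrow> ev F (rep (sigma_word sA \<sigma> is (pure (T_rel sA) xs))) = word_dual is F xs"
  by (simp add: ev_rep_sigma_word multilin_word_dual bilin_S_sigma annihilates_T_rel)

definition mu_dual :: "nat \<Rightarrow> ('a list \<Rightarrow> 'k) \<Rightarrow> 'a list \<Rightarrow> 'k" where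
  "mu_dual i F xs = (if i + 2 \<le> length xs then F (take i xs @ (xs ! i * xs ! (i + 1)) # drop (i + 2) xs) else 0)"

lemma ev_rep_mu_at:
  assumes "multilin sA F" "i \<noteq> 0"
  shows "ev F (rep (act_at sA 2 (mu sA) i X)) = ev (mu_dual (i - 1) F) (rep X)"
proof -
  obtain j where "i = Suc j" using assms(2) by (cases i) auto
  then show ?thesis
    using assms(1) by (auto simp: ev_rep_act_at ev_rep_mu_pure multilin_subst mu_dual_def intro!: ev_cong)
qed

lemma multilin_mu_dual:
  assumes F: "multilin sA F"
  shows "multilin sA (mu_dual i F)"
proof -
  have mu_dual_Suc: "mu_dual (Suc i) F (x # zs) = mu_dual i (\<lambda>w. F (x # w)) zs" for i F x zs
    by (simp add: mu_dual_def)
  have "lin sA (\<lambda>a. mu_dual i F (us @ a # vs))" for us vs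
    using F
  proof (induction us arbitrary: i F)
    case Nil
    show ?case
    proof (cases i)
      case 0
      then show ?thesis using lin_mult_left[OF multilin_lin_Cons[OF Nil]]
        by (cases vs) (simp_all add: mu_dual_def)
    next
      case (Suc j)
      then show ?thesis
        using multilin_lin_Cons[OF Nil] by (auto simp: mu_dual_def intro!: lin_if)
    qed
  next
    case (Cons u us)
    show ?case
    proof (cases i)
      case 0
      show ?thesis
      proof (cases us)
        case Nil
        then show ?thesis using lin_mult_right[OF multilin_lin_Cons[OF Cons.prems]]
          by (simp add: mu_dual_def 0)
      next
        case (Cons u' us')
        then show ?thesis using multilin_lin[OF Cons.prems, of "u * u' # us'"]
          by (simp add: mu_dual_def 0)
      qed
    next
      case (Suc j)
      then show ?thesis using Cons.IH[OF multilin_Cons[OF Cons.prems]] by (simp add: Suc mu_dual_Suc)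
    qed
  qed
  then show ?thesis by (simp add: multilin_def)
qed

end

text \<open>Each law is the corresponding hypothesis on \<sigma> at a pure tensor, tested against
  \<open>G\<close> or \<open>g\<close> extended by 0 to other lengths.\<close>

lemma multiplicative_braiding_pairs_of:
  fixes sA :: "'k::field \<Rightarrow> 'a::{ring,monoid_mult} \<Rightarrow> 'a"
    and \<sigma> :: "('a list, 'k) free set \<Rightarrow> ('a list, 'k) free set"
  assumes "unital_algebra sA"
    and sigma_linear: "linear_from_to (T_rel sA) (tensor_power sA 2) (T_rel sA) (tensor_power sA 2) \<sigma>"
    and sigma_mu_left: "\<And>X. X \<in> tensor_power sA 3 \<Longrightarrow>
      sigma_at sA \<sigma> 1 (act_at sA 2 (mu sA) 1 X)
        = act_at sA 2 (mu sA) 2 (sigma_at sA \<sigma> 1 (sigma_at sA \<sigma> 2 X))"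
    and sigma_mu_right: "\<And>X. X \<in> tensor_power sA 3 \<Longrightarrow>
      sigma_at sA \<sigma> 1 (act_at sA 2 (mu sA) 2 X)
        = act_at sA 2 (mu sA) 1 (sigma_at sA \<sigma> 2 (sigma_at sA \<sigma> 1 X))"
    and mu_sigma: "\<And>X. X \<in> tensor_power sA 2 \<Longrightarrow> mu sA (\<sigma> X) = mu sA X"
  shows "multiplicative_braiding sA (pairs_of sA \<sigma>)"
proof -
  interpret sigma_algebra sA \<sigma>
    using assms(1,2) by (simp add: sigma_algebra_def sigma_algebra_axioms_def)
  let ?R = "T_rel sA"
  note bil = bilin_S_sigma
  show ?thesis
  proof
    show "bilin (S G)" if "bilin G" for G by (rule bil[OF that])
  next
    fix G a b c assume G: "bilin G"
    define F where "F zs = (if length zs = 2 then G (hd zs) (hd (tl zs)) else 0)" for zs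
    have F: "multilin sA F" unfolding F_def by (rule multilin_2[OF G])
    have X: "pure ?R [a, b, c] \<in> tensor_power sA 3"
      using pure_in_part[of ?R "[a, b, c]" length] by (simp add: numeral_3_eq_3)
    note ms = multilin_sigma_dual[OF bil] multilin_mu_dual
    have "ev F (rep (sigma_at sA \<sigma> 1 (act_at sA 2 (mu sA) 1 (pure ?R [a, b, c])))) = S G (a * b) c"
      using F by (simp add: ev_rep_sigma_at ev_rep_mu_at ms annihilates_T_rel)
        (simp add: sigma_dual_def[of "Suc 0"] mu_dual_def F_def numeral_2_eq_2)
    moreover have "ev F (rep (act_at sA 2 (mu sA) 2 (sigma_at sA \<sigma> 1 (sigma_at sA \<sigma> 2 (pure ?R [a, b, c])))))
        = S (\<lambda>u v. S (\<lambda>x y. G x (y * v)) a u) b c"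
      using F by (simp add: ev_rep_sigma_at ev_rep_mu_at ms annihilates_T_rel)
        (simp add: sigma_dual_def[of "Suc 0"] mu_dual_def F_def numeral_2_eq_2)
    ultimately show "S G (a * b) c = S (\<lambda>u v. S (\<lambda>x y. G x (y * v)) a u) b c"
      using sigma_mu_left[OF X] by simp
  next
    fix G a b c assume G: "bilin G"
    define F where "F zs = (if length zs = 2 then G (hd zs) (hd (tl zs)) else 0)" for zs
    have F: "multilin sA F" unfolding F_def by (rule multilin_2[OF G])
    have X: "pure ?R [a, b, c] \<in> tensor_power sA 3"
      using pure_in_part[of ?R "[a, b, c]" length] by (simp add: numeral_3_eq_3)
    note ms = multilin_sigma_dual[OF bil] multilin_mu_dual
    have "ev F (rep (sigma_at sA \<sigma> 1 (act_at sA 2 (mu sA) 2 (pure ?R [a, b, c])))) = S G a (b * c)"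
      using F by (simp add: ev_rep_sigma_at ev_rep_mu_at ms annihilates_T_rel)
        (simp add: sigma_dual_def[of "Suc 0"] mu_dual_def F_def numeral_2_eq_2)
    moreover have "ev F (rep (act_at sA 2 (mu sA) 1 (sigma_at sA \<sigma> 2 (sigma_at sA \<sigma> 1 (pure ?R [a, b, c])))))
        = S (\<lambda>u v. S (\<lambda>x y. G (u * x) y) v c) a b"
      using F by (simp add: ev_rep_sigma_at ev_rep_mu_at ms annihilates_T_rel)
        (simp add: sigma_dual_def[of "Suc 0"] mu_dual_def F_def numeral_2_eq_2)
    ultimately show "S G a (b * c) = S (\<lambda>u v. S (\<lambda>x y. G (u * x) y) v c) a b"
      using sigma_mu_right[OF X] by simp
  next
    fix g a b assume g: "lin sA g"
    have X: "pure ?R [a, b] \<in> tensor_power sA 2"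
      using pure_in_part[of ?R "[a, b]" length] by (simp add: numeral_2_eq_2)
    note F = multilin_1[OF g]
    show "S (\<lambda>x y. g (x * y)) a b = g (a * b)"
      using arg_cong[OF mu_sigma[OF X], of "\<lambda>X. ev (\<lambda>zs. if length zs = 1 then g (hd zs) else 0) (rep X)"]
      unfolding ev_rep_mu(1)[OF F] by (simp add: ev_rep_sigma'[OF ev_rep_mu(2)[OF F], simplified] annihilates_T_rel ev_rep_mu(2)[OF F, simplified])
  qed
qed

section \<open>Assembly: the two differentials and the shuffle map as transposes\<close>

locale sigma_bimodule = sigma_algebra sA \<sigma> + braided_bimodule sA "pairs_of sA \<sigma>" sM l r
  for sA :: "'k::field \<Rightarrow> 'a::{ring,monoid_mult} \<Rightarrow> 'a"
    and \<sigma> :: "('a list, 'k) free set \<Rightarrow> ('a list, 'k) free set"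
    and sM :: "'k \<Rightarrow> 'm::ab_group_add \<Rightarrow> 'm"
    and l :: "'a \<Rightarrow> 'm \<Rightarrow> 'm" and r :: "'m \<Rightarrow> 'a \<Rightarrow> 'm"
begin

lemma annihilates_multilin_M: "annihilates (MT_rel sM sA) F \<longleftrightarrow> multilin_M F"
  by (simp add: annihilates_MT_rel multilin_M_def)

lemma annihilates_multilin_MM: "annihilates (MTT_rel sM sA) F \<longleftrightarrow> multilin_MM F"
  by (simp add: annihilates_MTT_rel multilin_MM_def)

text \<open>Naming the value on generators makes the map visibly \<open>induced\<close>, so that the
  general criteria apply.\<close>

definition hochschild_gen :: "'m \<times> 'a list \<Rightarrow> ('m \<times> 'a list, 'k) free" where
  "hochschild_gen = (\<lambda>(m, xs). let n = length xs in
     if n = 0 then 0 else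
       gen (r m (hd xs), tl xs)
       + (\<Sum>i=1..n-1. fscale ((-1) ^ i) (gen (m, merge i xs)))
       + fscale ((-1) ^ n) (gen (l (last xs) m, butlast xs)))"

definition rho_gen :: "'m \<times> 'a list \<times> 'a list \<Rightarrow> ('m \<times> 'a list \<times> 'a list, 'k) free" where
  "rho_gen = (\<lambda>(m, xs, ys).
     let p = length xs; q = length ys in
     (if p = 0 then 0 else
        gen (r m (hd xs), tl xs, ys)
        + (\<Sum>i=1..p-1. fscale ((-1) ^ i) (gen (m, merge i xs, ys)))
        + fscale ((-1) ^ p) (extend (\<lambda>zs. gen (l (last zs) m, butlast xs, butlast zs))
            (rep (sigma_word sA \<sigma> (rev [1..<q+1]) (pure (T_rel sA) (last xs # ys))))))
     + (if q = 0 then 0 else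
        fscale ((-1) ^ p) (extend (\<lambda>zs. gen (r m (hd zs), tl zs, tl ys))
            (rep (sigma_word sA \<sigma> [1..<p+1] (pure (T_rel sA) (xs @ [hd ys])))))
        + (\<Sum>i=1..q-1. fscale ((-1) ^ (i + p)) (gen (m, xs, merge i ys)))
        + fscale ((-1) ^ (p + q)) (gen (l (last ys) m, xs, butlast ys))))"

definition shuffle_gen :: "'m \<times> 'a list \<times> 'a list \<Rightarrow> ('m \<times> 'a list, 'k) free" where
  "shuffle_gen = (\<lambda>(m, xs, ys).
     extend (\<lambda>zs. gen (m, zs)) (rep (quantum_shuffle sA \<sigma> (pure (TT_rel sA) (xs, ys)))))"

lemma hochschild_d_eq: "hochschild_d sA sM l r = induced (MT_rel sM sA) hochschild_gen"
  unfolding hochschild_d_def hochschild_gen_def ..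

lemma rho_eq: "rho sA sM l r \<sigma> = induced (MTT_rel sM sA) rho_gen"
  unfolding rho_def rho_gen_def ..

lemma id_M_tensor_eq: "id_M_tensor sM sA (quantum_shuffle sA \<sigma>) = induced (MT_rel sM sA) shuffle_gen"
  unfolding id_M_tensor_def shuffle_gen_def ..

text \<open>This holds against every \<open>F\<close>, since no representative is chosen in the
  formula.\<close>

lemma ev_hochschild_gen: "ev F (hochschild_gen z) = hochschild_dual F z"
  by (cases z) (simp add: hochschild_gen_def hochschild_dual_apply left_dual_def bar_merge Let_def)

lemma multilin_last: "multilin2 K \<Longrightarrow> multilin sA (\<lambda>zs. K (last zs) (butlast zs))"
proof -
  assume K: "multilin2 K"
  have "lin sA (\<lambda>a. K (last (us @ a # vs)) (butlast (us @ a # vs)))" for us vs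
    using multilin2D1[OF K] multilin2D2[OF K, where us = us and vs = "butlast vs"]
    by (cases "vs = []") (simp_all add: butlast_append)
  then show ?thesis by (simp add: multilin_def)
qed

lemma multilin_hd: "multilin2 K \<Longrightarrow> multilin sA (\<lambda>zs. K (hd zs) (tl zs))"
proof -
  assume K: "multilin2 K"
  have "lin sA (\<lambda>a. K (hd (us @ a # vs)) (tl (us @ a # vs)))" for us vs
    using multilin2D1[OF K] multilin2D2[OF K, where us = "tl us" and vs = vs]
    by (cases us) simp_all
  then show ?thesis by (simp add: multilin_def)
qed

text \<open>Multilinearity of \<open>G\<close> makes the two middle terms independent of the
  representatives chosen after the \<sigma> words.\<close>

lemma ev_rho_gen:
  assumes G: "multilin_MM G"
  shows "ev G (rho_gen z) = rho_dual G z"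
proof (cases z)
  case (fields m xs ys)
  have 1: "ev (\<lambda>zs. G (l (last zs) m, butlast xs, butlast zs))
      (rep (sigma_word sA \<sigma> (rev [1..<length ys + 1]) (pure (T_rel sA) (last xs # ys))))
      = R (last xs) ys (\<lambda>w a. G (l a m, butlast xs, w))"
    using multilin_last[OF multilin2_l[OF G]]
    by (subst ev_rep_sigma_word_pure) (simp_all only: word_dual_R last_snoc butlast_snoc, auto)
  have 2: "ev (\<lambda>zs. G (r m (hd zs), tl zs, tl ys))
      (rep (sigma_word sA \<sigma> [1..<length xs + 1] (pure (T_rel sA) (xs @ [hd ys]))))
      = L xs (hd ys) (\<lambda>c w. G (r m c, w, tl ys))"
    using multilin_hd[OF multilin2_r[OF G]]
    by (subst ev_rep_sigma_word_pure) (simp_all only: word_dual_L list.sel, auto)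
  have 3: "(\<Sum>i=1..length ys - 1. (-1) ^ (i + length xs) * G (m, xs, merge i ys))
      = (-1) ^ length xs * bar (\<lambda>w. G (m, xs, w)) ys"
    by (simp add: bar_merge sum_distrib_left power_add mult_ac)
  have "ev G (rho_gen (m, xs, ys)) = (if xs = [] then 0 else
        G (r m (hd xs), tl xs, ys) + bar (\<lambda>w. G (m, w, ys)) xs
        + (-1) ^ length xs * R (last xs) ys (\<lambda>w a. G (l a m, butlast xs, w)))
     + (if ys = [] then 0 else
        (-1) ^ length xs * L xs (hd ys) (\<lambda>c w. G (r m c, w, tl ys))
        + (-1) ^ length xs * bar (\<lambda>w. G (m, xs, w)) ys
        + (-1) ^ (length xs + length ys) * G (l (last ys) m, xs, butlast ys))"
    unfolding 1[symmetric] 2[symmetric] 3[symmetric]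
    by (simp add: rho_gen_def Let_def bar_merge del: upt_Suc)
  also have "\<dots> = rho_dual G (m, xs, ys)"
    by (simp add: rho_dual_def left_dual_def right_dual_def power_add algebra_simps)
  finally show ?thesis by (simp add: fields)
qed

text \<open>Representatives are chosen for xs \<otimes> ys, for each T_\<sigma>(w) and for their
  sum. Multilinearity of \<open>F\<close> removes the last two choices, multilinearity of the
  shuffle sum in both tuples the first.\<close>

lemma ev_shuffle_gen:
  assumes F: "multilin_M F"
  shows "ev F (shuffle_gen z) = shuffle_dual F z"
proof (cases z)
  case (fields m xs ys)
  let ?F = "\<lambda>zs. F (m, zs)"
  have mF: "multilin sA ?F" using F by (simp add: multilin_M_def)
  define h :: "'a list \<times> 'a list \<Rightarrow> ('a list, 'k) free" where "h = (\<lambda>(xs, ys).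
     let n = length xs + length ys in
     \<Sum>w\<in>shuffle_perms (length xs) n.
       fscale (of_int (sign w)) (rep (T_sigma sA \<sigma> n w (pure (T_rel sA) (xs @ ys)))))"
  have red: "0 \<notin> set (SOME is. is \<in> reduced_words (p + q) w)" if "w \<in> shuffle_perms p (p + q)" for p q w
    using shuffle_word(1)[OF that refl] by auto
  have h: "ev ?F (h (xs, ys)) = shuffle xs ys ?F" for xs ys
    unfolding sum_shuffle_perms[OF refl refl, symmetric]
    by (auto simp: h_def Let_def T_sigma_def ev_rep_sigma_word_pure[OF mF] red intro!: sum.cong)
  have "ev ?F (rep (quantum_shuffle sA \<sigma> (pure (TT_rel sA) (xs, ys))))
      = ev (\<lambda>z. ev ?F (h z)) (rep (pure (TT_rel sA) (xs, ys)))"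
    using mF by (simp add: quantum_shuffle_def h_def[symmetric] annihilates_T_rel)
  also have "\<dots> = shuffle xs ys ?F"
    using multilin_shuffle_left[OF mF] multilin_shuffle_right[OF mF]
    by (subst ev_rep_pure) (simp_all add: annihilates_TT_rel h)
  finally show ?thesis by (simp add: fields shuffle_gen_def shuffle_dual_def)
qed

lemma compatible_hochschild_gen: "compatible (MT_rel sM sA) (MT_rel sM sA) hochschild_gen"
  by (simp add: compatible_def annihilates_multilin_M ev_hochschild_gen multilin_hochschild_dual)

lemma compatible_rho_gen: "compatible (MTT_rel sM sA) (MTT_rel sM sA) rho_gen"
  by (simp add: compatible_def annihilates_multilin_MM ev_rho_gen multilin_rho_dual)

lemma compatible_shuffle_gen: "compatible (MTT_rel sM sA) (MT_rel sM sA) shuffle_gen"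
  by (simp add: compatible_def annihilates_multilin_M annihilates_multilin_MM ev_shuffle_gen multilin_shuffle_dual)

lemma left_dual_zero:
  assumes "\<And>m ws zs. Suc (length ws + length zs) = length xs + length ys \<Longrightarrow> G (m, ws, zs) = 0"
  shows "left_dual G (m, xs, ys) = 0"
proof (cases "xs = []")
  case False
  have "bar (\<lambda>w. G (m, w, ys)) xs = bar (\<lambda>w. 0) xs"
    by (rule bar_cong) (simp add: assms)
  moreover have "R (last xs) ys (\<lambda>w a. G (l a m, butlast xs, w)) = R (last xs) ys (\<lambda>w a. 0)"
    by (rule R_cong) (use False in \<open>simp add: assms\<close>)
  moreover have "G (r m (hd xs), tl xs, ys) = 0"
    by (rule assms) (use False in simp)
  ultimately show ?thesis by (simp add: left_dual_def)
qed (simp add: left_dual_def)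

lemma right_dual_zero:
  assumes "\<And>m ws zs. Suc (length ws + length zs) = length xs + length ys \<Longrightarrow> G (m, ws, zs) = 0"
  shows "right_dual G (m, xs, ys) = 0"
proof (cases "ys = []")
  case False
  have "bar (\<lambda>w. G (m, xs, w)) ys = bar (\<lambda>w. 0) ys"
    by (rule bar_cong) (simp add: assms)
  moreover have "L xs (hd ys) (\<lambda>c w. G (r m c, w, tl ys)) = L xs (hd ys) (\<lambda>c w. 0)"
    by (rule L_cong) (use False in \<open>simp add: assms\<close>)
  moreover have "G (l (last ys) m, xs, butlast ys) = 0"
    by (rule assms) (use False in simp)
  ultimately show ?thesis by (simp add: right_dual_def)
qed (simp add: right_dual_def)

lemma chain_complex_rho:
  "chain_complex (MTT_rel sM sA) (\<lambda>(m, xs, ys). length xs + length ys) (rho sA sM l r \<sigma>)"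
  unfolding rho_eq
proof (rule chain_complex_induced[OF compatible_rho_gen graded_MTT_rel])
  fix F and x :: "'m \<times> 'a list \<times> 'a list"
  assume "annihilates (MTT_rel sM sA) F"
  then have F: "multilin_MM F" by (simp add: annihilates_multilin_MM)
  obtain m xs ys where x: "x = (m, xs, ys)" by (cases x)
  show "ev F (rho_gen x) = 0" if "(case x of (m, xs, ys) \<Rightarrow> length xs + length ys) = 0"
    using that by (simp add: x ev_rho_gen[OF F] rho_dual_def left_dual_def right_dual_def)
  show "ev F (rho_gen x) = 0" if zero: "\<And>y. Suc (case y of (m, xs, ys) \<Rightarrow> length xs + length ys)
      = (case x of (m, xs, ys) \<Rightarrow> length xs + length ys) \<Longrightarrow> F y = 0"
  proof -
    have "F (m, ws, zs) = 0" if "Suc (length ws + length zs) = length xs + length ys" for m ws zs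
      using zero[of "(m, ws, zs)"] that by (simp add: x)
    then show ?thesis by (simp add: x ev_rho_gen[OF F] rho_dual_def left_dual_zero right_dual_zero)
  qed
  show "ev (\<lambda>y. ev F (rho_gen y)) (rho_gen x) = 0"
    by (simp add: ev_rho_gen[OF F] ev_rho_gen[OF multilin_rho_dual[OF F]] rho_dual_rho_dual[OF F])
qed

lemma chain_complex_hochschild:
  "chain_complex (MT_rel sM sA) (\<lambda>(m, xs). length xs) (hochschild_d sA sM l r)"
  unfolding hochschild_d_eq
proof (rule chain_complex_induced[OF compatible_hochschild_gen graded_MT_rel])
  fix F and x :: "'m \<times> 'a list"
  assume "annihilates (MT_rel sM sA) F"
  then have F: "multilin_M F" by (simp add: annihilates_multilin_M)
  obtain m xs where x: "x = (m, xs)" by (cases x)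
  show "ev F (hochschild_gen x) = 0" if "(case x of (m, xs) \<Rightarrow> length xs) = 0"
    using that by (simp add: x ev_hochschild_gen hochschild_dual_apply left_dual_def)
  show "ev F (hochschild_gen x) = 0" if zero: "\<And>y. Suc (case y of (m, xs) \<Rightarrow> length xs)
      = (case x of (m, xs) \<Rightarrow> length xs) \<Longrightarrow> F y = 0"
  proof -
    have "F (m, ws) = 0" if "Suc (length ws) = length xs" for m ws
      using zero[of "(m, ws)"] that by (simp add: x)
    then show ?thesis by (auto simp: x ev_hochschild_gen hochschild_dual_apply intro!: left_dual_zero)
  qed
  show "ev (\<lambda>y. ev F (hochschild_gen y)) (hochschild_gen x) = 0"
    by (simp add: ev_hochschild_gen hochschild_dual_hochschild_dual[OF F])
qed

lemma chain_morphism_shuffle: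
  "chain_morphism
    (MTT_rel sM sA) (\<lambda>(m, xs, ys). length xs + length ys) (rho sA sM l r \<sigma>)
    (MT_rel sM sA) (\<lambda>(m, xs). length xs) (hochschild_d sA sM l r)
    (id_M_tensor sM sA (quantum_shuffle sA \<sigma>))"
  unfolding rho_eq hochschild_d_eq id_M_tensor_eq
proof (rule chain_morphism_induced[OF _ _ compatible_rho_gen compatible_hochschild_gen compatible_shuffle_gen graded_MT_rel])
  show "chain_complex (MTT_rel sM sA) (\<lambda>(m, xs, ys). length xs + length ys) (induced (MTT_rel sM sA) rho_gen)"
    using chain_complex_rho unfolding rho_eq .
  show "chain_complex (MT_rel sM sA) (\<lambda>(m, xs). length xs) (induced (MT_rel sM sA) hochschild_gen)"
    using chain_complex_hochschild unfolding hochschild_d_eq .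
  fix F and x :: "'m \<times> 'a list \<times> 'a list"
  assume "annihilates (MT_rel sM sA) F"
  then have F: "multilin_M F" by (simp add: annihilates_multilin_M)
  obtain m xs ys where x: "x = (m, xs, ys)" by (cases x)
  show "ev F (shuffle_gen x) = 0" if zero: "\<And>y. (case y of (m, xs) \<Rightarrow> length xs)
      = (case x of (m, xs, ys) \<Rightarrow> length xs + length ys) \<Longrightarrow> F y = 0"
  proof -
    have "shuffle xs ys (\<lambda>zs. F (m, zs)) = shuffle xs ys (\<lambda>zs. 0)"
      by (rule shuffle_cong) (simp add: zero x)
    then show ?thesis by (simp add: x ev_shuffle_gen[OF F] shuffle_dual_def shuffle_def)
  qed
  show "ev (\<lambda>y. ev F (shuffle_gen y)) (rho_gen x) = ev (\<lambda>y. ev F (hochschild_gen y)) (shuffle_gen x)"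
    by (simp add: ev_shuffle_gen[OF F] ev_rho_gen[OF multilin_shuffle_dual[OF F]] ev_hochschild_gen ev_shuffle_gen[OF multilin_hochschild_dual[OF F]] rho_dual_shuffle_dual[OF F])
qed

end

theorem corollary2p1:
  fixes sA :: "'k::field \<Rightarrow> 'a::{ring,monoid_mult} \<Rightarrow> 'a"
    and sM :: "'k \<Rightarrow> 'm::ab_group_add \<Rightarrow> 'm"
    and l :: "'a \<Rightarrow> 'm \<Rightarrow> 'm" and r :: "'m \<Rightarrow> 'a \<Rightarrow> 'm"
    and \<sigma> :: "('a list, 'k) free set \<Rightarrow> ('a list, 'k) free set"
  assumes alg: "unital_algebra sA"
    and bimod: "algebra_bimodule sA sM l r"
    and sigma_linear: "linear_from_to (T_rel sA) (tensor_power sA 2) (T_rel sA) (tensor_power sA 2) \<sigma>"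
    and sigma_bij: "bij_betw \<sigma> (tensor_power sA 2) (tensor_power sA 2)"
    and sigma_mu_left: "\<And>X. X \<in> tensor_power sA 3 \<Longrightarrow>
      sigma_at sA \<sigma> 1 (act_at sA 2 (mu sA) 1 X)
        = act_at sA 2 (mu sA) 2 (sigma_at sA \<sigma> 1 (sigma_at sA \<sigma> 2 X))"
    and sigma_mu_right: "\<And>X. X \<in> tensor_power sA 3 \<Longrightarrow>
      sigma_at sA \<sigma> 1 (act_at sA 2 (mu sA) 2 X)
        = act_at sA 2 (mu sA) 1 (sigma_at sA \<sigma> 2 (sigma_at sA \<sigma> 1 X))"
    and sigma_unit_right: "\<And>a. \<sigma> (pure (T_rel sA) [a, 1]) = pure (T_rel sA) [1, a]"
    and sigma_unit_left: "\<And>a. \<sigma> (pure (T_rel sA) [1, a]) = pure (T_rel sA) [a, 1]"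
    and mu_sigma: "\<And>X. X \<in> tensor_power sA 2 \<Longrightarrow> mu sA (\<sigma> X) = mu sA X"
  shows "chain_morphism
    (MTT_rel sM sA) (\<lambda>(m, xs, ys). length xs + length ys) (rho sA sM l r \<sigma>)
    (MT_rel sM sA) (\<lambda>(m, xs). length xs) (hochschild_d sA sM l r)
    (id_M_tensor sM sA (quantum_shuffle sA \<sigma>))"
proof -
  interpret sigma_algebra sA \<sigma>
    using alg sigma_linear by (simp add: sigma_algebra_def sigma_algebra_axioms_def)
  interpret multiplicative_braiding sA "pairs_of sA \<sigma>"
    by (rule multiplicative_braiding_pairs_of) (fact alg sigma_linear sigma_mu_left sigma_mu_right mu_sigma)+
  interpret algebra_bimodule sA sM l r by (rule bimod)
  interpret sigma_bimodule sA \<sigma> sM l r ..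
  show ?thesis by (rule chain_morphism_shuffle)
qed

end
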